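(* Let $\Gamma$ be a geometrically finite group, i.e. $\Gamma$ admits a finite $K(\Gamma,1)$ CW-complex $B\Gamma$, and let $E\Gamma$ be its universal cover with the geodesic metric lifted from $B\Gamma$. Then $\mathrm{p\text{-}cat}(\Gamma):=\mathrm{p\text{-}cat}(E\Gamma)\le \mathrm{c\text{-}cat}(E\Gamma)=\mathrm{c\text{-}cat}(\Gamma)$.
   Context: Notation: $\mathbb{R}_+=[0,\infty)$. A (not necessarily continuous) map between metric spaces is controlled if for every $r>0$ there is $S>0$ with $d(x,x')<r\Rightarrow d(f(x),f(x'))<S$; proper if preimages of bounded sets are bounded; coarse if both. For a coarse map $q:X\to\mathbb{R}_+$, $I_qX=\{(x,t)\in X\times\mathbb{R}_+: t\le q(x)\}$ (product sup metric), $i_0(x)=(x,0)$, $i_1(x)=(x,q(x))$; coarse maps $f,g:X\to Y$ are coarsely homotopic if there exist a coarse $q$ and a coarse $H:I_qX\to Y$ with $H\circ i_0=f$, $H\circ i_1=g$. $A\subseteq X$ is coarsely categorical if there are coarse maps $\alpha:\mathbb{R}_+\to X$, $j:A\to\mathbb{R}_+$ with $\alpha\circ j$ coarsely homotopic to the inclusion $A\hookrightarrow X$; $\mathrm{c\text{-}cat}(X)$ is the least $k$ such that $X$ is covered by $k+1$ coarsely categorical sets. $\mathrm{c\text{-}cat}$ is a coarse homotopy invariant, and $\mathrm{c\text{-}cat}(\Gamma)$ denotes $\mathrm{c\text{-}cat}$ of any proper geodesic metric space on which $\Gamma$ acts properly cocompactly by isometries (e.g. $\Gamma$ with a word metric,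 or $E\Gamma$). Proper LS-category: a closed subset $C$ of a non-compact locally compact Hausdorff space $X$ is properly deformable to $\mathbb{R}_+$ if there are proper continuous maps $r:C\to\mathbb{R}_+$, $\alpha:\mathbb{R}_+\to X$ with $\alpha\circ r$ properly homotopic (via a proper continuous homotopy) to the inclusion $C\hookrightarrow X$; $A\subseteq X$ is properly categorical if some closed neighborhood of $A$ is properly deformable to $\mathbb{R}_+$; $\mathrm{p\text{-}cat}(X)$ is the least $n$ such that $X$ has an open cover by $n+1$ properly categorical sets ($\infty$ if none). *)

theory Defs
  imports "HOL-Analysis.Analysis"
begin

definition tproper :: "'a topology \<Rightarrow> 'b topology \<Rightarrow> ('a \<Rightarrow> 'b) \<Rightarrow> bool" where
  "tproper X Y f \<longleftrightarrow> continuous_map X Y f \<and>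
     (\<forall>K. compactin Y K \<longrightarrow> compactin X {x \<in> topspace X. f x \<in> K})"

definition Rplus_top :: "real topology" where
  "Rplus_top = top_of_set {0..}"

definition properly_deformable :: "'a topology \<Rightarrow> 'a set \<Rightarrow> bool" where
  "properly_deformable X C \<longleftrightarrow> closedin X C \<and>
     (\<exists>r \<alpha> H. tproper (subtopology X C) Rplus_top r \<and> tproper Rplus_top X \<alpha> \<and>
        tproper (prod_topology (subtopology X C) (top_of_set {0..(1::real)})) X H \<and>
        (\<forall>x\<in>C. H (x, 0) = \<alpha> (r x) \<and> H (x, 1) = x))"

definition properly_categorical :: "'a topology \<Rightarrow> 'a set \<Rightarrow> bool" where
  "properly_categorical X A \<longleftrightarrow>
     (\<exists>N. closedin X N \<and> A \<subseteq> X interior_of N \<and> properly_deformable X N)"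

definition p_cat :: "'a topology \<Rightarrow> enat" where
  "p_cat X = Inf {enat n | n. \<exists>U :: nat \<Rightarrow> 'a set.
      (\<forall>i\<le>n. openin X (U i) \<and> properly_categorical X (U i)) \<and>
      topspace X = (\<Union>i\<le>n. U i)}"

definition mbdd :: "'a set \<Rightarrow> ('a \<Rightarrow> 'a \<Rightarrow> real) \<Rightarrow> 'a set \<Rightarrow> bool" where
  "mbdd M d S \<longleftrightarrow> S \<subseteq> M \<and> (\<exists>x b. \<forall>y\<in>S. d x y \<le> b)"

definition controlled :: "'a set \<Rightarrow> ('a \<Rightarrow> 'a \<Rightarrow> real) \<Rightarrow> 'b set \<Rightarrow> ('b \<Rightarrow> 'b \<Rightarrow> real)
    \<Rightarrow> ('a \<Rightarrow> 'b) \<Rightarrow> bool" where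
  "controlled M d N e f \<longleftrightarrow> (\<forall>x\<in>M. f x \<in> N) \<and>
     (\<forall>r>0. \<exists>S>0. \<forall>x\<in>M. \<forall>x'\<in>M. d x x' < r \<longrightarrow> e (f x) (f x') < S)"

definition mproper :: "'a set \<Rightarrow> ('a \<Rightarrow> 'a \<Rightarrow> real) \<Rightarrow> 'b set \<Rightarrow> ('b \<Rightarrow> 'b \<Rightarrow> real)
    \<Rightarrow> ('a \<Rightarrow> 'b) \<Rightarrow> bool" where
  "mproper M d N e f \<longleftrightarrow> (\<forall>x\<in>M. f x \<in> N) \<and>
     (\<forall>B. mbdd N e B \<longrightarrow> mbdd M d {x\<in>M. f x \<in> B})"

definition coarse :: "'a set \<Rightarrow> ('a \<Rightarrow> 'a \<Rightarrow> real) \<Rightarrow> 'b set \<Rightarrow> ('b \<Rightarrow> 'b \<Rightarrow> real)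
    \<Rightarrow> ('a \<Rightarrow> 'b) \<Rightarrow> bool" where
  "coarse M d N e f \<longleftrightarrow> controlled M d N e f \<and> mproper M d N e f"

definition Rplus :: "real set" where "Rplus = {0..}"
definition rdist :: "real \<Rightarrow> real \<Rightarrow> real" where "rdist s t = \<bar>s - t\<bar>"

definition Iq :: "'a set \<Rightarrow> ('a \<Rightarrow> real) \<Rightarrow> ('a \<times> real) set" where
  "Iq M q = {(x, t). x \<in> M \<and> 0 \<le> t \<and> t \<le> q x}"

definition supdist :: "('a \<Rightarrow> 'a \<Rightarrow> real) \<Rightarrow> ('a \<times> real) \<Rightarrow> ('a \<times> real) \<Rightarrow> real" where
  "supdist d p p' = max (d (fst p) (fst p')) \<bar>snd p - snd p'\<bar>"

definition coarsely_homotopic :: "'a set \<Rightarrow> ('a \<Rightarrow> 'a \<Rightarrow> real) \<Rightarrow> 'b set \<Rightarrow> ('b \<Rightarrow> 'b \<Rightarrow> real)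
    \<Rightarrow> ('a \<Rightarrow> 'b) \<Rightarrow> ('a \<Rightarrow> 'b) \<Rightarrow> bool" where
  "coarsely_homotopic M d N e f g \<longleftrightarrow> coarse M d N e f \<and> coarse M d N e g \<and>
     (\<exists>q H. coarse M d Rplus rdist q \<and> coarse (Iq M q) (supdist d) N e H \<and>
        (\<forall>x\<in>M. H (x, 0) = f x \<and> H (x, q x) = g x))"

definition coarsely_categorical :: "'a set \<Rightarrow> ('a \<Rightarrow> 'a \<Rightarrow> real) \<Rightarrow> 'a set \<Rightarrow> bool" where
  "coarsely_categorical M d A \<longleftrightarrow> A \<subseteq> M \<and>
     (\<exists>\<alpha> j. coarse Rplus rdist M d \<alpha> \<and> coarse A d Rplus rdist j \<and>
        coarsely_homotopic A d M d (\<alpha> \<circ> j) (\<lambda>x. x))"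

definition c_cat :: "'a set \<Rightarrow> ('a \<Rightarrow> 'a \<Rightarrow> real) \<Rightarrow> enat" where
  "c_cat M d = Inf {enat k | k. \<exists>U :: nat \<Rightarrow> 'a set.
      (\<forall>i\<le>k. coarsely_categorical M d (U i)) \<and> M = (\<Union>i\<le>k. U i)}"

definition dball_set :: "nat \<Rightarrow> (nat \<Rightarrow> real) set" where
  "dball_set n = {x. (\<forall>i\<ge>n. x i = 0) \<and> (\<Sum>i<n. x i ^ 2) \<le> 1}"
definition obball_set :: "nat \<Rightarrow> (nat \<Rightarrow> real) set" where
  "obball_set n = {x. (\<forall>i\<ge>n. x i = 0) \<and> (\<Sum>i<n. x i ^ 2) < 1}"
definition bsphere_set :: "nat \<Rightarrow> (nat \<Rightarrow> real) set" where
  "bsphere_set n = {x. (\<forall>i\<ge>n. x i = 0) \<and> (\<Sum>i<n. x i ^ 2) = 1}"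

text \<open>A finite CW complex structure on a Hausdorff space: finitely many cells,
  characteristic maps from closed balls, homeomorphic on the open ball, open cells
  partition the space, boundary spheres go into cells of lower dimension.
  (For finite complexes closure-finiteness and the weak topology are automatic.)\<close>
definition finite_CW :: "'b topology \<Rightarrow> bool" where
  "finite_CW B \<longleftrightarrow> Hausdorff_space B \<and>
    (\<exists>(I :: nat set) (dim :: nat \<Rightarrow> nat) (\<phi> :: nat \<Rightarrow> (nat \<Rightarrow> real) \<Rightarrow> 'b).
       finite I \<and>
       (\<forall>i\<in>I. continuous_map (subtopology (Euclidean_space (dim i)) (dball_set (dim i))) B (\<phi> i) \<and>
          homeomorphic_map (subtopology (Euclidean_space (dim i)) (obball_set (dim i)))
             (subtopology B (\<phi> i ` obball_set (dim i))) (\<phi> i) \<and>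
          \<phi> i ` bsphere_set (dim i) \<subseteq> (\<Union>j\<in>{j\<in>I. dim j < dim i}. \<phi> j ` obball_set (dim j))) \<and>
       (\<forall>i\<in>I. \<forall>j\<in>I. i \<noteq> j \<longrightarrow> \<phi> i ` obball_set (dim i) \<inter> \<phi> j ` obball_set (dim j) = {}) \<and>
       topspace B = (\<Union>i\<in>I. \<phi> i ` obball_set (dim i)))"

text \<open>Aspherical: pi_n vanishes for n >= 2, i.e. every map of S^n is (freely) nullhomotopic.\<close>
definition aspherical :: "'b topology \<Rightarrow> bool" where
  "aspherical B \<longleftrightarrow> (\<forall>n\<ge>2. \<forall>f. continuous_map (nsphere n) B f \<longrightarrow>
      (\<exists>c. homotopic_with (\<lambda>_. True) (nsphere n) B f (\<lambda>_. c)))"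

definition simply_connected_sp :: "'a topology \<Rightarrow> bool" where
  "simply_connected_sp X \<longleftrightarrow> path_connected_space X \<and>
     (\<forall>g. pathin X g \<and> g 1 = g 0 \<longrightarrow>
        homotopic_with (\<lambda>h. h 0 = g 0 \<and> h 1 = g 1) (top_of_set {0..1}) X g (\<lambda>_. g 0))"

definition covering_map :: "'a topology \<Rightarrow> 'b topology \<Rightarrow> ('a \<Rightarrow> 'b) \<Rightarrow> bool" where
  "covering_map E B p \<longleftrightarrow> continuous_map E B p \<and> p ` topspace E = topspace B \<and>
     (\<forall>b\<in>topspace B. \<exists>U. openin B U \<and> b \<in> U \<and>
        (\<exists>\<V>. (\<Union>\<V>) = {x\<in>topspace E. p x \<in> U} \<and> pairwise disjnt \<V> \<and>
           (\<forall>V\<in>\<V>. openin E V \<and> homeomorphic_map (subtopology E V) (subtopology B U) p)))"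

definition geodesic_metric :: "'b set \<Rightarrow> ('b \<Rightarrow> 'b \<Rightarrow> real) \<Rightarrow> bool" where
  "geodesic_metric M d \<longleftrightarrow> Metric_space M d \<and>
     (\<forall>x\<in>M. \<forall>y\<in>M. \<exists>\<gamma>. (\<forall>t\<in>{0..d x y}. \<gamma> t \<in> M) \<and> \<gamma> 0 = x \<and> \<gamma> (d x y) = y \<and>
        (\<forall>s\<in>{0..d x y}. \<forall>t\<in>{0..d x y}. d (\<gamma> s) (\<gamma> t) = \<bar>s - t\<bar>))"

definition curve_length :: "('b \<Rightarrow> 'b \<Rightarrow> real) \<Rightarrow> (real \<Rightarrow> 'b) \<Rightarrow> ereal" where
  "curve_length d c = (SUP (k, t) \<in> {(k, t :: nat \<Rightarrow> real). t 0 = 0 \<and> t k = 1 \<and>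
        (\<forall>i<k. t i \<le> t (Suc i))}. ereal (\<Sum>i<k. d (c (t i)) (c (t (Suc i)))))"

definition lifted_metric :: "'a topology \<Rightarrow> ('a \<Rightarrow> 'b) \<Rightarrow> ('b \<Rightarrow> 'b \<Rightarrow> real)
    \<Rightarrow> ('a \<Rightarrow> 'a \<Rightarrow> real) \<Rightarrow> bool" where
  "lifted_metric E p d dE \<longleftrightarrow> (\<forall>x\<in>topspace E. \<forall>y\<in>topspace E.
      ereal (dE x y) = (INF g \<in> {g. pathin E g \<and> g 0 = x \<and> g 1 = y}. curve_length d (p \<circ> g)))"

end

theory Submission
  imports Defs "HOL-Probability.Discrete_Topology"
begin

text \<open>The universal cover \<open>E\<close> is contractible: it is simply connected, its higher homotopy groups
  vanish by asphericity, and the cells of \<open>B\<close> lift. Conjugating one contraction by deck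
  transformations, which are isometries, contracts \<open>E\<close> to every point \<open>y\<close> of an orbit, with control
  depending only on the distance to \<open>y\<close>. These contractions replace coarse maps into \<open>E\<close> by continuous
  ones at bounded distance: for finitely many weight functions, each supported in a disjoint union of
  sets of bounded diameter, one pushes a map successively, for a time given by the weight, towards the
  value of the coarse map at a nearby sample point. Where some weight is \<open>1\<close> the starting map is
  forgotten. So the result is close to the coarse map, and letting the weights grow from \<open>0\<close> to \<open>1\<close>
  shows that two continuous maps close to the same coarse map are homotopic along short tracks. Applied
  to the data of a coarsely categorical set \<open>A\<close>, extended to a closed neighbourhood of \<open>A\<close>, this makes
  the neighbourhood properly deformable to the half-line.\<close>

section \<open>Length of curves\<close>

text \<open>A contraction of \<open>E\<close> may distort distances arbitrarily; only its effect
  near its end point is bounded, by compactness. This dictates the interpolation. Pushes go only to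
  points of one fibre, because those are the targets to which deck transformations carry the
  contraction. Their number is fixed in advance by a finite cover of \<open>B\<close>, because each
  push replaces the error by a larger one that is uniform but otherwise unknown. The coarse data
  bring a second difficulty: they are given only on \<open>A\<close>, and the homotopy only below
  the graph of a discontinuous \<open>q\<close>. They are pulled back to the closed neighbourhood
  along a discontinuous choice of nearby points of \<open>A\<close>, and the homotopy is frozen
  above \<open>q\<close>, which extends it over the whole half-line. There it is approximated, and a
  continuous height above \<open>q\<close> then cuts out a homotopy. Interpolation in the half-line
  itself supplies that height and the map to the half-line.\<close>

lemma curve_length_ge:
  assumes "t 0 = 0" "t k = 1" "\<And>i. i < k \<Longrightarrow> t i \<le> t (Suc i)"
  shows "ereal (\<Sum>i<k. d (c (t i)) (c (t (Suc i)))) \<le> curve_length d c"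
  unfolding curve_length_def using assms
  by (intro SUP_upper2[where i="(k,t)"]) auto

lemma curve_length_le:
  assumes "\<And>k t. t 0 = 0 \<Longrightarrow> t k = 1 \<Longrightarrow> (\<And>i. i < k \<Longrightarrow> t i \<le> t (Suc i)) \<Longrightarrow>
     ereal (\<Sum>i<k. d (c (t i)) (c (t (Suc i)))) \<le> L"
  shows "curve_length d c \<le> L"
  unfolding curve_length_def using assms by (intro SUP_least) auto

lemma partition_bounds:
  fixes t :: "nat \<Rightarrow> real"
  assumes "t 0 = 0" "t k = 1" "\<And>i. i < k \<Longrightarrow> t i \<le> t (Suc i)" "i \<le> k"
  shows "0 \<le> t i" "t i \<le> 1"
proof -
  have "t a \<le> t b" if "a \<le> b" "b \<le> k" for a b
    using that proof (induction rule: dec_induct)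
      case (step n)
      then show ?case using assms(3)[of n] by auto
    qed auto
  from this[of 0 i] this[of i k] show "0 \<le> t i" "t i \<le> 1" using assms by auto
qed

text \<open>Concatenation for topologies given as values, as those of \<open>B\<close> and
  \<open>E\<close> are here, rather than by a type class.\<close>

definition cjoin :: "(real \<Rightarrow> 'a) \<Rightarrow> (real \<Rightarrow> 'a) \<Rightarrow> real \<Rightarrow> 'a" where
  "cjoin g h = (\<lambda>x. if x \<le> 1/2 then g (2 * x) else h (2 * x - 1))"

context Metric_space
begin

text \<open>The partition 0, t, 1 already gives this bound. It confines a short curve to a ball
  about its starting point, which is how paths are later kept inside one sheet.\<close>

lemma dist_le_curve_length:
  assumes "c ` {0..1} \<subseteq> M" "0 \<le> t" "t \<le> 1"
  shows "ereal (d (c 0) (c t)) \<le> curve_length d c"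
proof -
  define s where "s = (\<lambda>i::nat. if i = 0 then 0 else if i = 1 then t else (1::real))"
  have "ereal (\<Sum>i<2. d (c (s i)) (c (s (Suc i)))) \<le> curve_length d c"
    using assms by (intro curve_length_ge) (auto simp: s_def less_2_cases_iff)
  moreover have "(\<Sum>i<2. d (c (s i)) (c (s (Suc i)))) = d (c 0) (c t) + d (c t) (c 1)"
    by (simp add: s_def numeral_2_eq_2)
  ultimately have "ereal (d (c 0) (c t) + d (c t) (c 1)) \<le> curve_length d c"
    by metis
  moreover have "ereal (d (c 0) (c t)) \<le> ereal (d (c 0) (c t) + d (c t) (c 1))"
    by simp
  ultimately show ?thesis by (rule order_trans[rotated])
qed

lemma curve_length_cjoin_le:
  assumes "g ` {0..1} \<subseteq> M" "h ` {0..1} \<subseteq> M" "g 1 = h 0"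
  shows "curve_length d (cjoin g h) \<le> curve_length d g + curve_length d h"
proof (rule curve_length_le)
  fix k and t :: "nat \<Rightarrow> real"
  assume t: "t 0 = 0" "t k = 1" "\<And>i. i < k \<Longrightarrow> t i \<le> t (Suc i)"
  \<comment> \<open>Each half receives the whole partition, clamped at 1/2 and rescaled. On the far
    side of 1/2 a clamped partition stands still and contributes zero, so only the step across 1/2
    needs the triangle inequality.\<close>
  define s r where "s = (\<lambda>i. 2 * min (t i) (1/2))" and "r = (\<lambda>i. 2 * max (t i) (1/2) - 1)"
  have bd: "0 \<le> t i" "t i \<le> 1" if "i \<le> k" for i
    using partition_bounds[OF t that] by auto
  have S: "ereal (\<Sum>i<k. d (g (s i)) (g (s (Suc i)))) \<le> curve_length d g"
  proof (intro curve_length_ge)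
    show "s i \<le> s (Suc i)" if "i < k" for i using t(3)[OF that] by (auto simp: s_def min_def)
  qed (use t in \<open>auto simp: s_def\<close>)
  have R: "ereal (\<Sum>i<k. d (h (r i)) (h (r (Suc i)))) \<le> curve_length d h"
  proof (intro curve_length_ge)
    show "r i \<le> r (Suc i)" if "i < k" for i using t(3)[OF that] by (auto simp: r_def max_def)
  qed (use t in \<open>auto simp: r_def\<close>)
  have "d ((cjoin g h) (t i)) ((cjoin g h) (t (Suc i)))
      \<le> d (g (s i)) (g (s (Suc i))) + d (h (r i)) (h (r (Suc i)))" if i: "i < k" for i
  proof -
    have b: "0 \<le> t i" "t i \<le> 1" "0 \<le> t (Suc i)" "t (Suc i) \<le> 1" "t i \<le> t (Suc i)"
      using bd[of i] bd[of "Suc i"] t(3) i by auto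
    have G: "g u \<in> M" "h u \<in> M" if "0 \<le> u" "u \<le> 1" for u using assms that by auto
    consider "t (Suc i) \<le> 1/2" | "t i \<le> 1/2" "t (Suc i) > 1/2" | "t i > 1/2" by linarith
    then show ?thesis
    proof cases
      case 1
      then show ?thesis using b by (auto simp: cjoin_def s_def r_def min_def max_def intro: G)
    next
      case 2
      have "d (g (2 * t i)) (h (2 * t (Suc i) - 1)) \<le> d (g (2 * t i)) (g 1) + d (h 0) (h (2 * t (Suc i) - 1))"
        unfolding assms(3)[symmetric] by (rule triangle) (use 2 b assms in \<open>auto\<close>)
      then show ?thesis using 2 b by (auto simp: cjoin_def s_def r_def min_def max_def)
    next
      case 3
      then show ?thesis using b by (auto simp: cjoin_def s_def r_def min_def max_def intro: G)
    qed
  qed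
  then have "(\<Sum>i<k. d ((cjoin g h) (t i)) ((cjoin g h) (t (Suc i))))
     \<le> (\<Sum>i<k. d (g (s i)) (g (s (Suc i)))) + (\<Sum>i<k. d (h (r i)) (h (r (Suc i))))"
    unfolding sum.distrib[symmetric] by (intro sum_mono) auto
  then have "ereal (\<Sum>i<k. d ((cjoin g h) (t i)) ((cjoin g h) (t (Suc i))))
     \<le> ereal (\<Sum>i<k. d (g (s i)) (g (s (Suc i)))) + ereal (\<Sum>i<k. d (h (r i)) (h (r (Suc i))))"
    by simp
  also have "\<dots> \<le> curve_length d g + curve_length d h" by (intro add_mono S R)
  finally show "ereal (\<Sum>i<k. d ((cjoin g h) (t i)) ((cjoin g h) (t (Suc i)))) \<le> \<dots>" .
qed

lemma curve_length_reversepath_le: "curve_length d (c \<circ> (\<lambda>s. 1 - s)) \<le> curve_length d c"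
proof (rule curve_length_le)
  fix k and t :: "nat \<Rightarrow> real"
  assume t: "t 0 = 0" "t k = 1" "\<And>i. i < k \<Longrightarrow> t i \<le> t (Suc i)"
  define s where "s = (\<lambda>i. 1 - t (k - i))"
  have S: "ereal (\<Sum>i<k. d (c (s i)) (c (s (Suc i)))) \<le> curve_length d c"
  proof (intro curve_length_ge)
    show "s i \<le> s (Suc i)" if "i < k" for i
      using t(3)[of "k - Suc i"] that by (simp add: s_def Suc_diff_Suc)
  qed (use t in \<open>auto simp: s_def\<close>)
  have "(\<Sum>i<k. d (c (1 - t i)) (c (1 - t (Suc i)))) = (\<Sum>i<k. d (c (1 - t (k - Suc i))) (c (1 - t (Suc (k - Suc i)))))"
    by (rule sum.nat_diff_reindex[symmetric])
  also have "\<dots> = (\<Sum>i<k. d (c (s i)) (c (s (Suc i))))"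
    by (intro sum.cong) (auto simp: s_def Suc_diff_Suc commute)
  finally show "ereal (\<Sum>i<k. d ((c \<circ> (\<lambda>s. 1 - s)) (t i)) ((c \<circ> (\<lambda>s. 1 - s)) (t (Suc i)))) \<le> curve_length d c"
    using S by simp
qed

end

text \<open>Partitions of the two pieces concatenate to a partition of the whole, so their sums add
  up to at most the total length. The bound is a real number so that the arithmetic with suprema in
  \<open>ereal\<close> stays finite.\<close>

lemma curve_length_split:
  assumes a: "0 \<le> a" "a \<le> 1"
    and l: "curve_length d c \<le> ereal l"
  shows "curve_length d (c \<circ> (\<lambda>s. a * s)) + curve_length d (c \<circ> (\<lambda>s. a + (1 - a) * s)) \<le> ereal l"
proof -
  have *: "ereal ((\<Sum>i<k. d (c (a * t i)) (c (a * t (Suc i))))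
     + (\<Sum>i<k'. d (c (a + (1 - a) * t' i)) (c (a + (1 - a) * t' (Suc i))))) \<le> ereal l"
    if t: "t 0 = 0" "t k = 1" "\<And>i. i < k \<Longrightarrow> t i \<le> t (Suc i)"
      and t': "t' 0 = 0" "t' k' = 1" "\<And>i. i < k' \<Longrightarrow> t' i \<le> t' (Suc i)"
    for k k' and t t' :: "nat \<Rightarrow> real"
  proof -
    define s where "s = (\<lambda>i. if i \<le> k then a * t i else a + (1 - a) * t' (i - k))"
    have s1: "s i = a * t i" if "i \<le> k" for i using that by (simp add: s_def)
    have s2: "s (k + i) = a + (1 - a) * t' i" for i using t t' by (cases i) (auto simp: s_def)
    have "ereal (\<Sum>i<k+k'. d (c (s i)) (c (s (Suc i)))) \<le> curve_length d c"
    proof (rule curve_length_ge)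
      show "s i \<le> s (Suc i)" if "i < k + k'" for i
      proof (cases "i < k")
        case True
        then show ?thesis using t(3)[of i] a by (simp add: s1 mult_left_mono)
      next
        case False
        then obtain m where m: "i = k + m" using le_Suc_ex not_less by blast
        then show ?thesis using t'(3)[of m] that a s2[of m] s2[of "Suc m"] by (simp add: mult_left_mono)
      qed
    qed (use t t' s1[of 0] s2[of k'] in auto)
    also have "(\<Sum>i<k+k'. d (c (s i)) (c (s (Suc i)))) = (\<Sum>i<k. d (c (s i)) (c (s (Suc i)))) + (\<Sum>i<k'. d (c (s (k + i))) (c (s (k + Suc i))))"
      by (induction k') (auto simp: add.assoc)
    also have "(\<Sum>i<k. d (c (s i)) (c (s (Suc i)))) = (\<Sum>i<k. d (c (a * t i)) (c (a * t (Suc i))))"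
      by (intro sum.cong) (auto simp: s1)
    finally show ?thesis using l s2 s2[of "Suc i" for i] by (auto simp del: ereal_less_eq(3) intro: order_trans)
  qed
  have triv: "\<exists>k t. t 0 = 0 \<and> t k = (1::real) \<and> (\<forall>i<k. t i \<le> t (Suc i))"
    by (intro exI[of _ 1] exI[of _ real]) auto
  \<comment> \<open>The suprema are taken one after the other: first over \<open>t\<close> with
    \<open>t'\<close> fixed, then over \<open>t'\<close> once the first supremum is known to be a
    real number and can be moved across the inequality.\<close>
  have "curve_length d (c \<circ> (\<lambda>s. a * s)) \<le> ereal l - ereal (\<Sum>i<k'. d (c (a + (1 - a) * t' i)) (c (a + (1 - a) * t' (Suc i))))"
    if t': "t' 0 = 0" "t' k' = 1" "\<And>i. i < k' \<Longrightarrow> t' i \<le> t' (Suc i)"  for k' and t' :: "nat \<Rightarrow> real"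
    using *[OF _ _ _ t'] by (intro curve_length_le) (fastforce simp: le_diff_eq)
  then have "ereal (\<Sum>i<k'. d (c (a + (1 - a) * t' i)) (c (a + (1 - a) * t' (Suc i)))) + curve_length d (c \<circ> (\<lambda>s. a * s)) \<le> ereal l"
    if t': "t' 0 = 0" "t' k' = 1" "\<And>i. i < k' \<Longrightarrow> t' i \<le> t' (Suc i)"  for k' and t' :: "nat \<Rightarrow> real"
    using that by (metis (no_types, lifting) add.commute ereal_le_minus_iff abs_ereal.simps(1) PInfty_neq_ereal(1) ereal_le_minus)
  note ** = this
  have ne: "curve_length d (c \<circ> (\<lambda>s. a * s)) \<noteq> -\<infinity>"
    by (metis (no_types) curve_length_ge triv ereal_infty_less_eq(2) MInfty_neq_ereal(1))
  have ni: "curve_length d (c \<circ> (\<lambda>s. a * s)) \<noteq> \<infinity>"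
    using ** triv by fastforce
  obtain l1 where l1: "curve_length d (c \<circ> (\<lambda>s. a * s)) = ereal l1"
    using ne ni by (cases "curve_length d (c \<circ> (\<lambda>s. a * s))") auto
  have "curve_length d (c \<circ> (\<lambda>s. a + (1 - a) * s)) \<le> ereal (l - l1)"
    using ** unfolding l1 by (intro curve_length_le) (fastforce simp: algebra_simps)
  then show ?thesis unfolding l1
    by (cases "curve_length d (c \<circ> (\<lambda>s. a + (1 - a) * s))") auto
qed

lemma curve_length_geodesic:
  assumes "\<And>s t. s \<in> {0..1} \<Longrightarrow> t \<in> {0..1} \<Longrightarrow> d (c s) (c t) = D * \<bar>s - t\<bar>"
  shows "curve_length d c \<le> ereal D"
proof (rule curve_length_le)
  fix k and t :: "nat \<Rightarrow> real"
  assume t: "t 0 = 0" "t k = 1" "\<And>i. i < k \<Longrightarrow> t i \<le> t (Suc i)"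
  have "(\<Sum>i<k. d (c (t i)) (c (t (Suc i)))) = (\<Sum>i<k. D * (t (Suc i) - t i))"
    using t partition_bounds[OF t] assms by (intro sum.cong) auto
  also have "\<dots> = D" using t by (simp add: sum_distrib_left[symmetric] sum_lessThan_telescope)
  finally show "ereal (\<Sum>i<k. d (c (t i)) (c (t (Suc i)))) \<le> ereal D" by simp
qed

section \<open>The lifted metric\<close>

lemma pathin_cjoin:
  assumes "pathin X g" "pathin X h" "g 1 = h 0"
  shows "pathin X (cjoin g h)"
  unfolding pathin_def cjoin_def
proof (rule continuous_map_cases_le)
  let ?I = "top_of_set {0..1::real}"
  have 1: "continuous_map (subtopology ?I {x \<in> topspace ?I. x \<le> 1/2}) ?I (\<lambda>x::real. 2 * x)"
    and 2: "continuous_map (subtopology ?I {x \<in> topspace ?I. 1/2 \<le> x}) ?I (\<lambda>x::real. 2 * x - 1)"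
    by (auto simp: subtopology_subtopology intro!: continuous_intros)
  show "continuous_map (subtopology ?I {x \<in> topspace ?I. x \<le> 1/2}) X (\<lambda>x. g (2 * x))"
    using continuous_map_compose[OF 1] assms(1) unfolding pathin_def o_def by blast
  show "continuous_map (subtopology ?I {x \<in> topspace ?I. 1/2 \<le> x}) X (\<lambda>x. h (2 * x - 1))"
    using continuous_map_compose[OF 2] assms(2) unfolding pathin_def o_def by blast
  show "g (2 * x) = h (2 * x - 1)" if "x = 1/2" for x :: real
    unfolding that using assms(3) by simp
qed (auto intro: continuous_intros)

lemma pathin_reparam:
  assumes "pathin X g" "continuous_on {0..1} f" "f ` {0..1} \<subseteq> {0..1}"
  shows "pathin X (g \<circ> f)"
  unfolding pathin_def
  by (rule continuous_map_compose[of _ "top_of_set {0..1}"]) (use assms in \<open>auto simp: pathin_def\<close>)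

locale lifted_geodesic =
  fixes B :: "'b topology" and dB :: "'b \<Rightarrow> 'b \<Rightarrow> real"
    and E :: "'a topology" and p :: "'a \<Rightarrow> 'b" and dE :: "'a \<Rightarrow> 'a \<Rightarrow> real"
  assumes geodesic: "geodesic_metric (topspace B) dB"
    and top: "Metric_space.mtopology (topspace B) dB = B"
    and compact_B: "compact_space B"
    and cov: "covering_map E B p"
    and path_conn: "path_connected_space E"
    and lifted: "lifted_metric E p dB dE"
begin

sublocale MB: Metric_space "topspace B" dB
  using geodesic by (simp add: geodesic_metric_def)

section \<open>The covering map and its sheets\<close>

lemma cont_p: "continuous_map E B p"
  and surj_p: "p ` topspace E = topspace B"
  using cov by (auto simp: covering_map_def)

lemma p_in: "x \<in> topspace E \<Longrightarrow> p x \<in> topspace B"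
  using surj_p by blast

lemma openin_B: "openin B U \<longleftrightarrow> U \<subseteq> topspace B \<and> (\<forall>x. x \<in> U \<longrightarrow> (\<exists>r>0. MB.mball x r \<subseteq> U))"
  using MB.openin_mtopology top by simp

lemma openin_ball: "openin B (MB.mball x r)"
  using MB.openin_mball top by simp

text \<open>The openness of the rest of the preimage records what disjointness from the other sheets
  is good for: a connected set over \<open>U\<close> that meets \<open>V\<close> lies in
  \<open>V\<close>. A single sheet can thus be handled without its family.\<close>

definition sheet :: "'b set \<Rightarrow> 'a set \<Rightarrow> bool" where
  "sheet U V \<longleftrightarrow> openin B U \<and> openin E V \<and> openin E ({x \<in> topspace E. p x \<in> U} - V) \<and>
     homeomorphic_map (subtopology E V) (subtopology B U) p"

lemma evenly_covered:
  assumes "b \<in> topspace B"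
  obtains U \<V> where "openin B U" "b \<in> U" "\<Union>\<V> = {x \<in> topspace E. p x \<in> U}"
    "pairwise disjnt \<V>" "\<And>V. V \<in> \<V> \<Longrightarrow> sheet U V"
proof -
  obtain U \<V> where U: "openin B U" "b \<in> U" "\<Union>\<V> = {x \<in> topspace E. p x \<in> U}" "pairwise disjnt \<V>"
     and V: "\<And>V. V \<in> \<V> \<Longrightarrow> openin E V \<and> homeomorphic_map (subtopology E V) (subtopology B U) p"
    using cov assms unfolding covering_map_def by metis
  have "sheet U V" if "V \<in> \<V>" for V
  proof -
    have "{x \<in> topspace E. p x \<in> U} - V = \<Union>(\<V> - {V})"
      unfolding U(3)[symmetric] using U(4) that by (auto simp: pairwise_def disjnt_iff)
    then show ?thesis unfolding sheet_def using U V that by (auto intro!: openin_Union)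
  qed
  with that U show thesis by blast
qed

lemma sheet_exists:
  assumes "x \<in> topspace E"
  obtains U V where "sheet U V" "x \<in> V" "p x \<in> U"
proof -
  obtain U \<V> where "openin B U" "p x \<in> U" "\<Union>\<V> = {x \<in> topspace E. p x \<in> U}"
    "\<And>V. V \<in> \<V> \<Longrightarrow> sheet U V"
    using evenly_covered[OF p_in[OF assms]] by metis
  moreover from this assms obtain V where "V \<in> \<V>" "x \<in> V" by blast
  ultimately show thesis using that by blast
qed

lemma sheetD:
  assumes "sheet U V"
  shows "openin B U" "openin E V" "V \<subseteq> topspace E" "U \<subseteq> topspace B" "p ` V = U" "inj_on p V"
    "openin E ({x \<in> topspace E. p x \<in> U} - V)" "homeomorphic_map (subtopology E V) (subtopology B U) p"
proof -
  show 1: "openin B U" "openin E V" "openin E ({x \<in> topspace E. p x \<in> U} - V)"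
    and h: "homeomorphic_map (subtopology E V) (subtopology B U) p"
    using assms by (auto simp: sheet_def)
  show sub: "V \<subseteq> topspace E" "U \<subseteq> topspace B" using 1 by (auto simp: openin_subset)
  show "p ` V = U" "inj_on p V"
    using homeomorphic_imp_surjective_map[OF h] homeomorphic_imp_injective_map[OF h]
    by (simp_all add: topspace_subtopology_subset[OF sub(1)] topspace_subtopology_subset[OF sub(2)]
        del: topspace_subtopology)
qed

lemma sheet_path:
  assumes S: "sheet U V" and g: "pathin E g" "g 0 \<in> V" and U: "\<And>t. t \<in> {0..1} \<Longrightarrow> p (g t) \<in> U"
    and t: "t \<in> {0..1}"
  shows "g t \<in> V"
proof (rule ccontr)
  assume *: "g t \<notin> V"
  let ?W = "{x \<in> topspace E. p x \<in> U} - V"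
  have "connectedin E (g ` {0..1})" using g by (simp add: connectedin_path_image)
  moreover have sub: "g ` {0..1} \<subseteq> topspace E"
    using path_image_subset_topspace[OF g(1)] by blast
  then have "g ` {0..1} \<subseteq> V \<union> ?W" using U by auto
  moreover have "g 0 \<in> V \<inter> g ` {0..1}" "g t \<in> ?W \<inter> g ` {0..1}" using g sub t * U by auto
  ultimately show False using sheetD[OF S] unfolding connectedin by blast
qed

section \<open>Metric axioms for \<open>dE\<close> and the topology of \<open>E\<close>\<close>

lemma path_sub: "pathin E g \<Longrightarrow> (p \<circ> g) ` {0..1} \<subseteq> topspace B"
  using path_image_subset_topspace p_in by fastforce

lemma dE_le:
  assumes "pathin E g" "curve_length dB (p \<circ> g) \<le> ereal l"
  shows "dE (g 0) (g 1) \<le> l"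
proof -
  have "g 0 \<in> topspace E" "g 1 \<in> topspace E"
    using assms path_start_in_topspace path_finish_in_topspace by auto
  then have "ereal (dE (g 0) (g 1)) = (INF h \<in> {h. pathin E h \<and> h 0 = g 0 \<and> h 1 = g 1}. curve_length dB (p \<circ> h))"
    using lifted unfolding lifted_metric_def by blast
  also have "\<dots> \<le> curve_length dB (p \<circ> g)" using assms by (intro INF_lower) auto
  finally show ?thesis using assms(2) order_trans by fastforce
qed

lemma curve_length_nonneg: "pathin E g \<Longrightarrow> 0 \<le> curve_length dB (p \<circ> g)"
  using MB.dist_le_curve_length[of "p \<circ> g" 0] path_sub
  by (metis MB.nonneg ereal_less_eq(5) image_comp order.trans order_refl zero_le_one)

lemma dE_ex:
  assumes "x \<in> topspace E" "y \<in> topspace E" "dE x y < r"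
  obtains g l where "pathin E g" "g 0 = x" "g 1 = y" "curve_length dB (p \<circ> g) = ereal l" "0 \<le> l" "l < r"
proof -
  have "ereal (dE x y) = (INF h \<in> {h. pathin E h \<and> h 0 = x \<and> h 1 = y}. curve_length dB (p \<circ> h))"
    using lifted assms unfolding lifted_metric_def by blast
  with assms(3) have "(INF h \<in> {h. pathin E h \<and> h 0 = x \<and> h 1 = y}. curve_length dB (p \<circ> h)) < ereal r"
    by (metis less_ereal.simps(1))
  then obtain g where g: "pathin E g" "g 0 = x" "g 1 = y" "curve_length dB (p \<circ> g) < ereal r"
    unfolding INF_less_iff by blast
  with curve_length_nonneg[of g] that show thesis
    by (cases "curve_length dB (p \<circ> g)") auto
qed

lemma dE_nonneg:
  assumes "x \<in> topspace E" "y \<in> topspace E" shows "0 \<le> dE x y"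
proof (rule ccontr)
  assume "\<not> 0 \<le> dE x y"
  then have "dE x y < 0" by simp
  from dE_ex[OF assms this] show False by force
qed

lemma dE_commute_le:
  assumes "x \<in> topspace E" "y \<in> topspace E" shows "dE y x \<le> dE x y"
proof (rule dense_ge)
  fix r assume "dE x y < r"
  then obtain g l where g: "pathin E g" "g 0 = x" "g 1 = y" "curve_length dB (p \<circ> g) = ereal l" "l < r"
    using dE_ex[OF assms] by metis
  let ?h = "g \<circ> (\<lambda>s. 1 - s)"
  have "pathin E ?h" by (rule pathin_reparam[OF g(1)]) (auto intro: continuous_intros)
  moreover have "curve_length dB (p \<circ> ?h) \<le> ereal l"
    using MB.curve_length_reversepath_le[of "p \<circ> g"] g(4) by (simp add: o_assoc)
  ultimately have "dE (?h 0) (?h 1) \<le> l" by (rule dE_le)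
  then show "dE y x \<le> r" using g by simp
qed

lemma dE_commute: "x \<in> topspace E \<Longrightarrow> y \<in> topspace E \<Longrightarrow> dE x y = dE y x"
  by (simp add: dE_commute_le order_antisym)

lemma dE_triangle:
  assumes "x \<in> topspace E" "y \<in> topspace E" "z \<in> topspace E"
  shows "dE x z \<le> dE x y + dE y z"
proof (rule field_le_epsilon)
  fix e :: real assume e: "0 < e"
  obtain g l where g: "pathin E g" "g 0 = x" "g 1 = y" "curve_length dB (p \<circ> g) = ereal l" "l < dE x y + e/2"
    by (rule dE_ex[OF assms(1,2), of "dE x y + e/2"]) (use e in auto)
  obtain h m where h: "pathin E h" "h 0 = y" "h 1 = z" "curve_length dB (p \<circ> h) = ereal m" "m < dE y z + e/2"
    by (rule dE_ex[OF assms(2,3), of "dE y z + e/2"]) (use e in auto)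
  have J: "p \<circ> cjoin g h = cjoin (p \<circ> g) (p \<circ> h)" by (auto simp: cjoin_def fun_eq_iff)
  have "curve_length dB (p \<circ> cjoin g h) \<le> ereal (l + m)"
    unfolding J using MB.curve_length_cjoin_le[OF path_sub[OF g(1)] path_sub[OF h(1)]] g h by simp
  moreover have "pathin E (cjoin g h)" using g h by (auto intro: pathin_cjoin)
  ultimately have "dE (cjoin g h 0) (cjoin g h 1) \<le> l + m" by (intro dE_le)
  then show "dE x z \<le> dE x y + dE y z + e" using g h by (simp add: cjoin_def)
qed

lemma dB_le_dE:
  assumes "x \<in> topspace E" "y \<in> topspace E" shows "dB (p x) (p y) \<le> dE x y"
proof (rule dense_ge)
  fix r assume "dE x y < r"
  then obtain g l where g: "pathin E g" "g 0 = x" "g 1 = y" "curve_length dB (p \<circ> g) = ereal l" "l < r"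
    using dE_ex[OF assms] by metis
  then show "dB (p x) (p y) \<le> r"
    using MB.dist_le_curve_length[OF path_sub[OF g(1)], of 1] by simp
qed

text \<open>A path of length below r projects into the ball of radius r about \<open>p x\<close>,
  hence into \<open>U\<close>, and so cannot leave the sheet of x.\<close>

lemma sheet_near:
  assumes S: "sheet U V" and x: "x \<in> V" and U: "MB.mball (p x) r \<subseteq> U"
    and y: "y \<in> topspace E" "dE x y < r"
  shows "y \<in> V"
proof -
  have xE: "x \<in> topspace E" using x sheetD[OF S] by blast
  obtain g l where g: "pathin E g" "g 0 = x" "g 1 = y" "curve_length dB (p \<circ> g) = ereal l" "l < r"
    using dE_ex[OF xE y] by metis
  have "p (g t) \<in> U" if "t \<in> {0..1}" for t
    using MB.dist_le_curve_length[OF path_sub[OF g(1)], of t] that path_sub[OF g(1)] g U xE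
    by (auto simp: p_in image_subset_iff)
  with sheet_path[OF S g(1)] x g show ?thesis by force
qed

lemma sheet_lift_path:
  assumes S: "sheet U V" and c: "pathin B c" "\<And>t. t \<in> {0..1} \<Longrightarrow> c t \<in> U"
  obtains g where "pathin E g" "\<And>t. t \<in> {0..1} \<Longrightarrow> g t \<in> V \<and> p (g t) = c t"
proof -
  obtain q where q: "homeomorphic_maps (subtopology E V) (subtopology B U) p q"
    using sheetD(8)[OF S] homeomorphic_map_maps by blast
  have "pathin (subtopology B U) c" using c by (simp add: pathin_subtopology)
  then have 1: "pathin (subtopology E V) (q \<circ> c)"
    using q by (auto simp: homeomorphic_maps_def intro: pathin_compose)
  have "p (q (c t)) = c t" if "t \<in> {0..1}" for t
  proof -
    have "c t \<in> topspace B \<inter> U" using c(2)[OF that] sheetD(4)[OF S] by blast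
    then show ?thesis using q by (simp add: homeomorphic_maps_def)
  qed
  with that[of "q \<circ> c"] 1 show thesis by (auto simp: pathin_subtopology)
qed

lemma geodesic_path:
  assumes "b \<in> topspace B" "c \<in> topspace B"
  obtains \<gamma> where "pathin B \<gamma>" "\<gamma> 0 = b" "\<gamma> 1 = c"
    "\<And>s t. s \<in> {0..1} \<Longrightarrow> t \<in> {0..1} \<Longrightarrow> dB (\<gamma> s) (\<gamma> t) = dB b c * \<bar>s - t\<bar>"
proof -
  obtain \<gamma> where g: "\<And>t. t \<in> {0..dB b c} \<Longrightarrow> \<gamma> t \<in> topspace B" "\<gamma> 0 = b" "\<gamma> (dB b c) = c"
    "\<And>s t. s \<in> {0..dB b c} \<Longrightarrow> t \<in> {0..dB b c} \<Longrightarrow> dB (\<gamma> s) (\<gamma> t) = \<bar>s - t\<bar>"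
    using geodesic assms unfolding geodesic_metric_def by metis
  define h where "h = (\<lambda>t. \<gamma> (dB b c * t))"
  have rng: "dB b c * t \<in> {0..dB b c}" if "t \<in> {0..1}" for t
    using that by (auto simp: mult_left_le)
  have d: "dB (h s) (h t) = dB b c * \<bar>s - t\<bar>" if "s \<in> {0..1}" "t \<in> {0..1}" for s t
    using g(4)[OF rng rng, OF that] by (simp add: h_def abs_mult flip: right_diff_distrib)
  have "pathin B h"
    unfolding pathin_def
  proof (subst top[symmetric], subst MB.continuous_map_to_metric, intro ballI allI impI)
    fix x and e :: real assume x: "x \<in> topspace (top_of_set {0..1::real})" and e: "0 < e"
    \<comment> \<open>The added 1 keeps the quotient meaningful when b = c.\<close>
    let ?d = "e / (dB b c + 1)"
    have D: "dB b c + 1 > 0" using MB.nonneg[of b c] by linarith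
    have "h y \<in> MB.mball (h x) e" if y: "y \<in> {0..1}" "\<bar>x - y\<bar> < ?d" for y
    proof -
      have "dB (h x) (h y) = dB b c * \<bar>x - y\<bar>" using d x y by simp
      also have "\<dots> \<le> (dB b c + 1) * \<bar>x - y\<bar>" by (simp add: mult_right_mono)
      also have "\<dots> < e" using y D by (simp add: field_simps)
      finally show ?thesis using g(1)[OF rng] x y by (simp add: h_def)
    qed
    then show "\<exists>U. openin (top_of_set {0..1}) U \<and> x \<in> U \<and> (\<forall>y\<in>U. h y \<in> MB.mball (h x) e)"
      using x e D by (intro exI[of _ "{0..1} \<inter> ball x ?d"]) (auto simp: dist_real_def)
  qed
  with that[of h] d g show thesis by (simp add: h_def)
qed

text \<open>Lifts the geodesic between the two projections. It has length below 2e and starts within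
  e of b, so it stays in the ball of radius 3e, over which the sheet is defined. Together with
  \<open>dB_le_dE\<close> this makes \<open>p\<close> an isometry on that part of the sheet.\<close>

lemma sheet_dist:
  assumes S: "sheet U V" and U: "MB.mball b (3 * e) \<subseteq> U"
    and y: "y \<in> V" "p y \<in> MB.mball b e" and z: "z \<in> V" "p z \<in> MB.mball b e"
  shows "dE y z \<le> dB (p y) (p z)"
proof -
  have pin: "p y \<in> topspace B" "p z \<in> topspace B" using y z by auto
  obtain \<gamma> where \<gamma>: "pathin B \<gamma>" "\<gamma> 0 = p y" "\<gamma> 1 = p z"
    "\<And>s t. s \<in> {0..1} \<Longrightarrow> t \<in> {0..1} \<Longrightarrow> dB (\<gamma> s) (\<gamma> t) = dB (p y) (p z) * \<bar>s - t\<bar>"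
    using geodesic_path[OF pin] by metis
  have "\<gamma> t \<in> U" if t: "t \<in> {0..1}" for t
  proof -
    have gt: "\<gamma> t \<in> topspace B" using \<gamma>(1) t path_image_subset_topspace by fastforce
    have "dB (p y) (\<gamma> t) = dB (p y) (p z) * t" using \<gamma>(4)[of 0 t] t \<gamma>(2) by simp
    also have "\<dots> \<le> dB (p y) (p z)" using t by (simp add: mult_left_le)
    also have "\<dots> \<le> dB b (p y) + dB b (p z)"
      using MB.triangle''[of "p y" b "p z"] y z by auto
    finally have "dB b (\<gamma> t) < 3 * e"
      using MB.triangle[of b "p y" "\<gamma> t"] y z gt by auto
    then show ?thesis using U gt y by auto
  qed
  from sheet_lift_path[OF S \<gamma>(1) this]
  obtain g where g: "pathin E g" "\<And>t. t \<in> {0..1} \<Longrightarrow> g t \<in> V \<and> p (g t) = \<gamma> t" by metis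
  have "curve_length dB (p \<circ> g) \<le> ereal (dB (p y) (p z))"
    by (rule curve_length_geodesic) (use g \<gamma> in auto)
  then have "dE (g 0) (g 1) \<le> dB (p y) (p z)" by (rule dE_le[OF g(1)])
  moreover have "g 0 = y" "g 1 = z"
    using inj_onD[OF sheetD(6)[OF S]] g(2)[of 0] g(2)[of 1] \<gamma> y z by auto
  ultimately show ?thesis by simp
qed

text \<open>\<open>Metric_space\<close> requires symmetry and nonnegativity on the whole type, whereas \<open>dE\<close> is arbitrary
  outside \<open>E\<close>.\<close>

definition dd :: "'a \<Rightarrow> 'a \<Rightarrow> real" where
  "dd x y = (if x \<in> topspace E \<and> y \<in> topspace E then dE x y else 0)"

text \<open>One half of the comparison of topologies: every \<open>dE\<close>-ball contains an open
  neighbourhood of its centre. It also yields that \<open>dE x x\<close> is 0.\<close>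

lemma sheet_small:
  assumes "x \<in> topspace E" "0 < r"
  obtains W where "openin E W" "x \<in> W" "\<And>y. y \<in> W \<Longrightarrow> dE x y < r"
proof -
  obtain U V where S: "sheet U V" "x \<in> V" "p x \<in> U" by (rule sheet_exists[OF assms(1)])
  then obtain e where e: "e > 0" "MB.mball (p x) e \<subseteq> U" using sheetD(1) openin_B by metis
  \<comment> \<open>A third of e, because \<open>sheet_dist\<close> wants three times the radius
    inside \<open>U\<close>.\<close>
  define s where "s = min (e/3) r"
  let ?W = "V \<inter> {z \<in> topspace E. p z \<in> MB.mball (p x) s}"
  have "openin E ?W"
    using sheetD(2)[OF S(1)] openin_continuous_map_preimage[OF cont_p openin_ball] by blast
  moreover have "x \<in> ?W" using S e assms p_in by (auto simp: s_def)
  moreover have "dE x y < r" if "y \<in> ?W" for y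
  proof -
    have "MB.mball (p x) (3 * (e/3)) \<subseteq> U" using e by simp
    from sheet_dist[OF S(1) this, of x y] have "dE x y \<le> dB (p x) (p y)"
      using that S e assms p_in by (auto simp: s_def)
    then show ?thesis using that by (auto simp: s_def)
  qed
  ultimately show thesis using that by blast
qed

text \<open>Separation rests on the covering: two points at distance 0 lie in one sheet and have the
  same projection.\<close>

sublocale ME: Metric_space "topspace E" dd
proof
  fix x y show "0 \<le> dd x y" by (simp add: dd_def dE_nonneg)
  show "dd x y = dd y x" by (simp add: dd_def dE_commute)
next
  fix x y z assume "x \<in> topspace E" "y \<in> topspace E" "z \<in> topspace E"
  then show "dd x z \<le> dd x y + dd y z" using dE_triangle by (simp add: dd_def)
next
  fix x y assume xy: "x \<in> topspace E" "y \<in> topspace E"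
  have "x = y" if 0: "dE x y = 0"
  proof -
    obtain U V where S: "sheet U V" "x \<in> V" "p x \<in> U" by (rule sheet_exists[OF xy(1)])
    then obtain e where e: "e > 0" "MB.mball (p x) e \<subseteq> U" using sheetD(1) openin_B by metis
    have "y \<in> V" using sheet_near[OF S(1,2) e(2) xy(2)] 0 e by simp
    moreover have "p x = p y" using dB_le_dE[OF xy] 0 p_in xy MB.nonneg[of "p x" "p y"] by auto
    ultimately show ?thesis using inj_onD[OF sheetD(6)[OF S(1)]] S by auto
  qed
  moreover have "dE x x = 0"
  proof (rule ccontr)
    assume "dE x x \<noteq> 0"
    then have "dE x x > 0" using dE_nonneg xy by fastforce
    then show False using sheet_small[OF xy(1)] by blast
  qed
  ultimately show "dd x y = 0 \<longleftrightarrow> x = y" using xy by (auto simp: dd_def)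
qed

text \<open>For an open \<open>W\<close> about x, the image of the part of \<open>W\<close> in one
  sheet contains a ball of \<open>B\<close>. A point of \<open>E\<close> that close to x stays in
  the sheet and projects into that image, so it lies in \<open>W\<close> because \<open>p\<close> is
  injective on the sheet.\<close>

lemma mtopology_E: "ME.mtopology = E"
proof (rule topology_eq[THEN iffD2], intro allI iffI)
  fix W assume W: "openin ME.mtopology W"
  show "openin E W"
  proof (subst openin_subopen, intro ballI)
    fix x assume x: "x \<in> W"
    then obtain r where r: "r > 0" "ME.mball x r \<subseteq> W" "x \<in> topspace E"
      using W unfolding ME.openin_mtopology by blast
    obtain W' where W': "openin E W'" "x \<in> W'" "\<And>y. y \<in> W' \<Longrightarrow> dE x y < r"
      using sheet_small[OF r(3,1)] by blast
    have "W' \<subseteq> ME.mball x r" using W' r openin_subset[OF W'(1)] by (auto simp: dd_def)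
    then show "\<exists>T. openin E T \<and> x \<in> T \<and> T \<subseteq> W" using W' r by blast
  qed
next
  fix W assume W: "openin E W"
  show "openin ME.mtopology W"
    unfolding ME.openin_mtopology
  proof (intro conjI allI impI)
    show "W \<subseteq> topspace E" using W by (rule openin_subset)
    fix x assume x: "x \<in> W"
    then have xE: "x \<in> topspace E" using W openin_subset by blast
    obtain U V where S: "sheet U V" "x \<in> V" "p x \<in> U" by (rule sheet_exists[OF xE])
    have "openin (subtopology E V) (V \<inter> W)" using W by (simp add: openin_subtopology_Int2)
    then have "openin (subtopology B U) (p ` (V \<inter> W))"
      using homeomorphic_imp_open_map[OF sheetD(8)[OF S(1)]] unfolding open_map_def by blast
    then have "openin B (p ` (V \<inter> W))" using sheetD(1)[OF S(1)] by (rule openin_trans_full)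
    moreover have "p x \<in> p ` (V \<inter> W)" using S x by blast
    ultimately obtain r where r: "r > 0" "MB.mball (p x) r \<subseteq> p ` (V \<inter> W)"
      unfolding openin_B by blast
    have "y \<in> W" if y: "y \<in> ME.mball x r" for y
    proof -
      have yE: "y \<in> topspace E" "dE x y < r" using y by (auto simp: dd_def)
      have "MB.mball (p x) r \<subseteq> U" using r sheetD(5)[OF S(1)] by blast
      then have yV: "y \<in> V" using sheet_near[OF S(1,2) _ yE] by simp
      have "dB (p x) (p y) < r" using dB_le_dE[OF xE yE(1)] yE by simp
      then have "p y \<in> p ` (V \<inter> W)" using r xE yE p_in by auto
      then obtain w where "w \<in> V" "w \<in> W" "p y = p w" by blast
      then show ?thesis using inj_onD[OF sheetD(6)[OF S(1)], of y w] yV by blast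
    qed
    then show "\<exists>r>0. ME.mball x r \<subseteq> W" using r by blast
  qed
qed

end

lemma (in Metric_space) continuous_map_dist:
  assumes "continuous_map X mtopology f" "continuous_map X mtopology g"
  shows "continuous_map X euclideanreal (\<lambda>x. d (f x) (g x))"
  using continuous_map_mdist[of X Self f g] assms by (simp add: Self_def)

section \<open>Uniform estimates from the compactness of \<open>B\<close>\<close>

context lifted_geodesic
begin

lemma dE_refl: "x \<in> topspace E \<Longrightarrow> dE x x = 0"
  using ME.mdist_zero[of x] by (simp add: dd_def)

definition evenly :: "'b set \<Rightarrow> 'a set set \<Rightarrow> bool" where
  "evenly U \<V> \<longleftrightarrow> openin B U \<and> \<Union>\<V> = {x \<in> topspace E. p x \<in> U} \<and> pairwise disjnt \<V> \<and> (\<forall>V\<in>\<V>. sheet U V)"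

text \<open>A Lebesgue number of the cover of \<open>B\<close> by evenly covered sets gives one
  radius that serves all points of \<open>E\<close>.\<close>

lemma uniform_sheets:
  obtains e where "e > 0" "\<And>b. b \<in> topspace B \<Longrightarrow> \<exists>U \<V>. evenly U \<V> \<and> MB.mball b e \<subseteq> U"
proof -
  have "compactin MB.mtopology (topspace B)" using compact_B top by (simp add: compact_space_def)
  moreover have "topspace B \<subseteq> \<Union>{U. \<exists>\<V>. evenly U \<V>}"
  proof
    fix b assume "b \<in> topspace B"
    then obtain U \<V> where "openin B U" "b \<in> U" "\<Union>\<V> = {x \<in> topspace E. p x \<in> U}"
      "pairwise disjnt \<V>" "\<And>V. V \<in> \<V> \<Longrightarrow> sheet U V" by (rule evenly_covered) blast
    then have "evenly U \<V>" "b \<in> U" by (auto simp: evenly_def)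
    then show "b \<in> \<Union>{U. \<exists>\<V>. evenly U \<V>}" by blast
  qed
  moreover have "\<And>U. U \<in> {U. \<exists>\<V>. evenly U \<V>} \<Longrightarrow> openin MB.mtopology U"
    using top by (auto simp: evenly_def)
  ultimately have "\<exists>e>0. \<forall>b\<in>topspace B. \<exists>U\<in>{U. \<exists>\<V>. evenly U \<V>}. MB.mball b e \<subseteq> U"
    by (rule MB.lebesgue_number)
  then show thesis using that by blast
qed

lemma uniform_sheets':
  obtains e where "e > 0"
    "\<And>x. x \<in> topspace E \<Longrightarrow> \<exists>U V. sheet U V \<and> x \<in> V \<and> MB.mball (p x) e \<subseteq> U"
proof -
  obtain e where e: "e > 0" "\<And>b. b \<in> topspace B \<Longrightarrow> \<exists>U \<V>. evenly U \<V> \<and> MB.mball b e \<subseteq> U"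
    by (rule uniform_sheets) blast
  have "\<exists>U V. sheet U V \<and> x \<in> V \<and> MB.mball (p x) e \<subseteq> U" if x: "x \<in> topspace E" for x
  proof -
    obtain U \<V> where U: "evenly U \<V>" "MB.mball (p x) e \<subseteq> U" using e(2)[OF p_in[OF x]] by blast
    have "p x \<in> U" using U p_in[OF x] e(1) by auto
    then show ?thesis using U x unfolding evenly_def by blast
  qed
  with e(1) that show thesis by blast
qed

text \<open>A ball of half the uniform radius is covered by the lift, through one sheet, of a closed
  ball of the compact space \<open>B\<close>. The radius is the same for all centres, as the
  induction in \<open>proper_E\<close> requires.\<close>

lemma compact_small_ball:
  obtains e where "e > 0" "\<And>x. x \<in> topspace E \<Longrightarrow> \<exists>K. compactin E K \<and> ME.mball x e \<subseteq> K"
proof -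
  obtain e where e: "e > 0"
    "\<And>x. x \<in> topspace E \<Longrightarrow> \<exists>U V. sheet U V \<and> x \<in> V \<and> MB.mball (p x) e \<subseteq> U"
    by (rule uniform_sheets') blast
  have "\<exists>K. compactin E K \<and> ME.mball x (e/2) \<subseteq> K" if x: "x \<in> topspace E" for x
  proof -
    obtain U V where S: "sheet U V" "x \<in> V" "MB.mball (p x) e \<subseteq> U" using e(2)[OF x] by blast
    obtain q where q: "homeomorphic_maps (subtopology E V) (subtopology B U) p q"
      using sheetD(8)[OF S(1)] homeomorphic_map_maps by blast
    let ?C = "MB.mcball (p x) (e/2)"
    have "?C \<subseteq> U" using S(3) MB.mcball_subset_mball_concentric[of "e/2" e "p x"] e(1) by auto
    moreover have "compactin B ?C"
      using compact_B MB.closedin_mcball top by (metis closedin_compact_space)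
    ultimately have "compactin (subtopology B U) ?C" by (simp add: compactin_subtopology)
    then have K: "compactin (subtopology E V) (q ` ?C)"
      using q by (auto simp: homeomorphic_maps_def intro: image_compactin)
    have "y \<in> q ` ?C" if "y \<in> ME.mball x (e/2)" for y
    proof -
      have yE: "y \<in> topspace E" "dE x y < e/2" using that by (auto simp: dd_def)
      have "MB.mball (p x) (e/2) \<subseteq> U" using S(3) MB.mball_subset_concentric[of "e/2" e "p x"] e(1) by auto
      then have "y \<in> V" using sheet_near[OF S(1,2) _ yE] by blast
      then have "q (p y) = y" using q yE by (auto simp: homeomorphic_maps_def)
      moreover have "p y \<in> ?C" using dB_le_dE[OF x yE(1)] yE p_in x by auto
      ultimately show ?thesis by (metis imageI)
    qed
    then show ?thesis using K by (auto simp: compactin_subtopology)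
  qed
  then show thesis using that[of "e/2"] e(1) by auto
qed

text \<open>\<open>E\<close> is treated as a length space. A path of length below a + \<delta> is
  cut where its distance from x equals a; the first piece has length at least a, which leaves less
  than \<delta> for the second.\<close>

lemma intermediate_point:
  assumes x: "x \<in> topspace E" and y: "y \<in> topspace E" and "0 \<le> a" "0 < \<delta>" "dE x y < a + \<delta>"
  obtains z where "z \<in> topspace E" "dE x z \<le> a" "dE z y < \<delta>"
proof (cases "dE x y \<le> a")
  case True
  then show thesis using that[of y] y assms by (simp add: dE_refl)
next
  case False
  obtain g l where g: "pathin E g" "g 0 = x" "g 1 = y" "curve_length dB (p \<circ> g) = ereal l" "l < a + \<delta>"
    using dE_ex[OF x y assms(5)] by metis
  have gin: "g t \<in> topspace E" if "t \<in> {0..1}" for t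
    using path_image_subset_topspace[OF g(1)] that by blast
  have "continuous_map (top_of_set {0..1}) euclideanreal (\<lambda>t. dd x (g t))"
    by (rule ME.continuous_map_dist) (use g x in \<open>auto simp: mtopology_E pathin_def\<close>)
  then have "continuous_on {0..1} (\<lambda>t. dd x (g t))" by simp
  moreover have "dd x (g 0) \<le> a" "a \<le> dd x (g 1)"
    using g x y assms False by (auto simp: dd_def dE_refl)
  ultimately obtain t where t: "0 \<le> t" "t \<le> 1" "dd x (g t) = a"
    using IVT'[of "\<lambda>t. dd x (g t)" 0 a 1] by auto
  have t': "g t \<in> topspace E" "dE x (g t) = a" using t gin[of t] x by (auto simp: dd_def)
  let ?g1 = "g \<circ> (\<lambda>s. t * s)" and ?g2 = "g \<circ> (\<lambda>s. t + (1 - t) * s)"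
  have p12: "pathin E ?g1" "pathin E ?g2"
    using t by (auto intro!: pathin_reparam[OF g(1)] continuous_intros simp: mult_le_one)
      (metis (no_types) add.commute convex_bound_le diff_add_cancel diff_ge_0_iff_ge mult.right_neutral mult_left_le_one_le order.refl)
  have spl: "curve_length dB (p \<circ> ?g1) + curve_length dB (p \<circ> ?g2) \<le> ereal l"
    using curve_length_split[OF t(1,2), of dB "p \<circ> g" l] g(4) by (simp add: o_assoc)
  then obtain l1 l2 where l: "curve_length dB (p \<circ> ?g1) = ereal l1" "curve_length dB (p \<circ> ?g2) = ereal l2"
    using curve_length_nonneg[OF p12(1)] curve_length_nonneg[OF p12(2)]
    by (cases "curve_length dB (p \<circ> ?g1)"; cases "curve_length dB (p \<circ> ?g2)") auto
  have "a \<le> l1" "dE (g t) y \<le> l2" "l1 + l2 \<le> l"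
    using dE_le[OF p12(1), of l1] dE_le[OF p12(2), of l2] l spl g t' by auto
  then show thesis using that[of "g t"] t' g by auto
qed

text \<open>A Hopf-Rinow argument with nearly shortest paths: compactness of a closed ball spreads
  to a slightly larger radius, and the gain in radius is always the same.\<close>

lemma proper_E:
  assumes x: "x \<in> topspace E"
  obtains K where "compactin E K" "ME.mcball x r \<subseteq> K"
proof -
  obtain e where e: "e > 0" "\<And>x. x \<in> topspace E \<Longrightarrow> \<exists>K. compactin E K \<and> ME.mball x e \<subseteq> K"
    by (rule compact_small_ball) blast
  \<comment> \<open>Radii grow by e/4. A point of the larger ball is within e/2 of a point of
    \<open>K\<close>, which in turn is within e/2 of the finite net \<open>F\<close>, so it lies in
    the ball of radius e about a net point.\<close>
  have "\<exists>K. compactin E K \<and> ME.mcball x (real n * (e/4)) \<subseteq> K" for n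
  proof (induction n)
    case 0
    have "ME.mcball x (real 0 * (e/4)) \<subseteq> {x}"
      using x ME.zero ME.nonneg by (auto simp: order_antisym_conv)
    then show ?case using x by (intro exI[of _ "{x}"]) auto
  next
    case (Suc n)
    then obtain K where K: "compactin E K" "ME.mcball x (real n * (e/4)) \<subseteq> K" by blast
    have KE: "K \<subseteq> topspace E" using K compactin_subset_topspace by blast
    have "K \<subseteq> \<Union>((\<lambda>z. ME.mball z (e/2)) ` K)" using KE e by auto
    moreover have "\<forall>U \<in> (\<lambda>z. ME.mball z (e/2)) ` K. openin E U"
      using ME.openin_mball mtopology_E by auto
    ultimately obtain \<F> where "finite \<F>" "\<F> \<subseteq> (\<lambda>z. ME.mball z (e/2)) ` K" "K \<subseteq> \<Union>\<F>"
      using K(1) unfolding compactin_def by meson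
    then obtain F where F: "finite F" "F \<subseteq> K" "K \<subseteq> (\<Union>z\<in>F. ME.mball z (e/2))"
      by (metis finite_subset_image)
    obtain C where C: "\<And>z. z \<in> F \<Longrightarrow> compactin E (C z) \<and> ME.mball z e \<subseteq> C z"
      using e(2) F(2) KE by (metis subsetD)
    have "compactin E (\<Union>(C ` F))" using F C by (intro compactin_Union) auto
    moreover have "y \<in> \<Union>(C ` F)" if y: "y \<in> ME.mcball x (real (Suc n) * (e/4))" for y
    proof -
      have yE: "y \<in> topspace E" "dE x y \<le> real (Suc n) * (e/4)" using y by (auto simp: dd_def)
      have "dE x y < real n * (e/4) + e/2" using yE e(1) by (simp add: field_simps)
      then obtain z where z: "z \<in> topspace E" "dE x z \<le> real n * (e/4)" "dE z y < e/2"
        using intermediate_point[OF x yE(1), of "real n * (e/4)" "e/2"] e(1) by auto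
      then have "z \<in> K" using K(2) x by (auto simp: dd_def subset_iff)
      then obtain w where w: "w \<in> F" "z \<in> ME.mball w (e/2)" using F by blast
      then have "dd w y < e" using ME.triangle[of w z y] z yE by (auto simp: dd_def)
      then show ?thesis using C[OF w(1)] w yE by auto
    qed
    ultimately show ?case by blast
  qed
  moreover obtain n where "r / (e/4) \<le> real n" using real_arch_simple by blast
  then have "r \<le> real n * (e/4)" using e(1) by (simp add: field_simps)
  ultimately show thesis using that ME.mcball_subset_concentric by (meson subset_trans)
qed

text \<open>All fibres are coarsely dense with one constant. A geodesic of \<open>B\<close> is
  followed in steps short enough to be lifted through sheets, and the boundedness of
  \<open>B\<close> limits the number of steps.\<close>

lemma near_fibre:
  obtains D where "\<And>x b. x \<in> topspace E \<Longrightarrow> b \<in> topspace B \<Longrightarrow> \<exists>y\<in>topspace E. p y = b \<and> dE x y \<le> D"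
proof -
  obtain e where e: "e > 0"
    "\<And>x. x \<in> topspace E \<Longrightarrow> \<exists>U V. sheet U V \<and> x \<in> V \<and> MB.mball (p x) e \<subseteq> U"
    by (rule uniform_sheets') blast
  \<comment> \<open>Strictly below e/3, so that points at distance at most s fall inside the open
    ball of radius e/3 used with \<open>sheet_dist\<close>.\<close>
  define s where "s = e/4"
  have s: "s > 0" using e by (simp add: s_def)
  have base: "\<exists>y\<in>topspace E. p y = b \<and> dE x y \<le> s"
    if x: "x \<in> topspace E" and b: "b \<in> topspace B" "dB (p x) b \<le> s" for x b
  proof -
    obtain U V where S: "sheet U V" "x \<in> V" "MB.mball (p x) e \<subseteq> U" using e(2)[OF x] by blast
    have "b \<in> MB.mball (p x) e" using b x p_in e by (auto simp: s_def)
    then obtain y where y: "y \<in> V" "p y = b" using S(3) sheetD(5)[OF S(1)] by blast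
    have "MB.mball (p x) (3 * (e/3)) \<subseteq> U" using S by simp
    then have "dE x y \<le> dB (p x) (p y)"
      by (rule sheet_dist[OF S(1)]) (use S y b x p_in e in \<open>auto simp: s_def\<close>)
    then show ?thesis using y b sheetD(3)[OF S(1)] by force
  qed
  have *: "\<exists>y\<in>topspace E. p y = b \<and> dE x y \<le> real n * s"
    if "x \<in> topspace E" "b \<in> topspace B" "dB (p x) b \<le> real n * s" for n x b
    using that
  proof (induction n arbitrary: b)
    case 0
    then have "p x = b" "dE x x = 0" using p_in[of x] MB.nonneg[of "p x" b] by (auto simp: dE_refl order_antisym_conv)
    then show ?case using 0 by auto
  next
    case (Suc n)
    obtain \<gamma> where \<gamma>: "pathin B \<gamma>" "\<gamma> 0 = p x" "\<gamma> 1 = b"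
      "\<And>s t. s \<in> {0..1} \<Longrightarrow> t \<in> {0..1} \<Longrightarrow> dB (\<gamma> s) (\<gamma> t) = dB (p x) b * \<bar>s - t\<bar>"
      using geodesic_path[OF p_in[OF Suc.prems(1)] Suc.prems(2)] by metis
    let ?t = "real n / real (Suc n)"
    have t: "0 \<le> ?t" "?t \<le> 1" "1 - ?t = 1 / real (Suc n)" by (auto simp: field_simps)
    have c: "\<gamma> ?t \<in> topspace B" using \<gamma>(1) t path_image_subset_topspace by fastforce
    have "dB (p x) (\<gamma> ?t) = dB (p x) b * ?t" using \<gamma>(4)[of 0 ?t] t \<gamma>(2) by simp
    also have "\<dots> \<le> (real (Suc n) * s) * ?t" using Suc.prems t by (intro mult_right_mono) auto
    also have "\<dots> = real n * s" by simp
    finally obtain y where y: "y \<in> topspace E" "p y = \<gamma> ?t" "dE x y \<le> real n * s"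
      using Suc.IH[OF Suc.prems(1) c] by blast
    have "dB (p y) b = dB (p x) b * (1 - ?t)" using \<gamma>(4)[of ?t 1] t \<gamma>(3) y by simp
    also have "\<dots> \<le> (real (Suc n) * s) * (1 - ?t)" using Suc.prems t by (intro mult_right_mono) auto
    also have "\<dots> = s" unfolding t by simp
    finally obtain z where z: "z \<in> topspace E" "p z = b" "dE y z \<le> s" using base[OF y(1) Suc.prems(2)] by blast
    have "dE x z \<le> real (Suc n) * s" using dE_triangle[OF Suc.prems(1) y(1) z(1)] y z by (simp add: algebra_simps)
    then show ?case using z by blast
  qed
  have "MB.mbounded (topspace B)"
    using compact_B top by (intro MB.compactin_imp_mbounded) (simp add: compact_space_def)
  then obtain R where R: "\<And>b c. b \<in> topspace B \<Longrightarrow> c \<in> topspace B \<Longrightarrow> dB b c \<le> R"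
    unfolding MB.mbounded_alt by blast
  obtain n where "R / s \<le> real n" using real_arch_simple by blast
  then have "R \<le> real n * s" using s by (simp add: field_simps)
  then show thesis using that[of "real n * s"] * R p_in by (meson order_trans)
qed

text \<open>The weights are pulled back from finitely many bump functions on \<open>B\<close>, and
  the label of a point is the sheet through it. Over one bump, the part of the support in each sheet
  is no larger than its image in \<open>B\<close>, by \<open>sheet_dist\<close>.\<close>

lemma coloring_E:
  obtains m D and u :: "nat \<Rightarrow> 'a \<Rightarrow> real" and l :: "nat \<Rightarrow> 'a \<Rightarrow> 'a set" where
    "\<And>j. j < m \<Longrightarrow> continuous_map E euclideanreal (u j)"
    "\<And>j x. j < m \<Longrightarrow> x \<in> topspace E \<Longrightarrow> 0 \<le> u j x \<and> u j x \<le> 1"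
    "\<And>j x. j < m \<Longrightarrow> x \<in> topspace E \<Longrightarrow> u j x > 0 \<Longrightarrow>
        \<exists>W. openin E W \<and> x \<in> W \<and> (\<forall>z\<in>W. l j z = l j x)"
    "\<And>j x y. j < m \<Longrightarrow> x \<in> topspace E \<Longrightarrow> y \<in> topspace E \<Longrightarrow> u j x > 0 \<Longrightarrow> u j y > 0 \<Longrightarrow>
        l j x = l j y \<Longrightarrow> dE x y \<le> D"
    "\<And>x. x \<in> topspace E \<Longrightarrow> \<exists>j<m. u j x = 1"
proof -
  obtain e' where e': "e' > 0" "\<And>b. b \<in> topspace B \<Longrightarrow> \<exists>U \<V>. evenly U \<V> \<and> MB.mball b e' \<subseteq> U"
    by (rule uniform_sheets) blast
  \<comment> \<open>The bumps vanish outside balls of radius 2e, and \<open>sheet_dist\<close> asks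
    for three times that radius.\<close>
  define e where "e = e' / 6"
  have e: "e > 0" "e' = 3 * (2 * e)" using e' by (auto simp: e_def)
  obtain Us Vs where UV: "\<And>b. b \<in> topspace B \<Longrightarrow> evenly (Us b) (Vs b) \<and> MB.mball b e' \<subseteq> Us b"
    using e'(2) by metis
  have "compactin B (topspace B)" using compact_B by (simp add: compact_space_def)
  moreover have "\<forall>U \<in> (\<lambda>b. MB.mball b e) ` topspace B. openin B U" using openin_ball by blast
  moreover have "topspace B \<subseteq> \<Union>((\<lambda>b. MB.mball b e) ` topspace B)" using e by auto
  ultimately obtain \<F> where "finite \<F>" "\<F> \<subseteq> (\<lambda>b. MB.mball b e) ` topspace B" "topspace B \<subseteq> \<Union>\<F>"
    unfolding compactin_def by meson
  then obtain F where F: "finite F" "F \<subseteq> topspace B" "topspace B \<subseteq> (\<Union>b\<in>F. MB.mball b e)"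
    by (metis finite_subset_image)
  obtain bs where bs: "set bs = F" using F(1) finite_list by blast
  \<comment> \<open>A bump that is 1 within e of its centre, where the balls cover \<open>B\<close>,
    and 0 from 2e on.\<close>
  define u where "u = (\<lambda>j x. max 0 (min 1 (2 - dB (bs ! j) (p x) / e)))"
  define l where "l = (\<lambda>j x. THE V. V \<in> Vs (bs ! j) \<and> x \<in> V)"
  have bsB: "bs ! j \<in> topspace B" if "j < length bs" for j using that bs F(2) nth_mem by blast
  have l: "l j x = V" if "j < length bs" "V \<in> Vs (bs ! j)" "x \<in> V" for j x V
  proof -
    have "pairwise disjnt (Vs (bs ! j))" using UV[OF bsB[OF that(1)]] by (auto simp: evenly_def)
    then show ?thesis unfolding l_def using that
      by (intro the_equality) (auto simp: pairwise_def disjnt_iff)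
  qed
  have u_pos: "\<exists>V. V \<in> Vs (bs ! j) \<and> x \<in> V \<and> dB (bs ! j) (p x) < 2 * e"
    if "j < length bs" "x \<in> topspace E" "u j x > 0" for j x
  proof -
    have "dB (bs ! j) (p x) < 2 * e" using that e(1) by (auto simp: u_def max_def field_simps split: if_splits)
    then have "p x \<in> MB.mball (bs ! j) e'" using e bsB[OF that(1)] p_in[OF that(2)] by auto
    then have "p x \<in> Us (bs ! j)" using UV[OF bsB[OF that(1)]] by blast
    then have "x \<in> \<Union>(Vs (bs ! j))" using UV[OF bsB[OF that(1)]] that(2) by (auto simp: evenly_def)
    then show ?thesis using \<open>dB (bs ! j) (p x) < 2 * e\<close> by blast
  qed
  show thesis
  proof (rule that[of "length bs" u l "4 * e"])
    fix j assume j: "j < length bs"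
    have "continuous_map E euclideanreal (\<lambda>x. dB (bs ! j) (p x))"
      by (rule MB.continuous_map_dist) (use cont_p top bsB[OF j] in auto)
    then show "continuous_map E euclideanreal (u j)"
      unfolding u_def using e(1) by (intro continuous_intros) auto
  next
    fix j x assume j: "j < length bs" "x \<in> topspace E"
    show "0 \<le> u j x \<and> u j x \<le> 1" by (auto simp: u_def)
    assume "u j x > 0"
    from u_pos[OF j this] obtain V where V: "V \<in> Vs (bs ! j)" "x \<in> V" by blast
    have "openin E V" using UV[OF bsB[OF j(1)]] V sheetD(2) by (auto simp: evenly_def)
    then show "\<exists>W. openin E W \<and> x \<in> W \<and> (\<forall>z\<in>W. l j z = l j x)"
      using l[OF j(1) V(1)] V by auto
  next
    fix j x y assume j: "j < length bs" and xy: "x \<in> topspace E" "y \<in> topspace E" "u j x > 0" "u j y > 0"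
      and eq: "l j x = l j y"
    obtain V where V: "V \<in> Vs (bs ! j)" "x \<in> V" "dB (bs ! j) (p x) < 2 * e" using u_pos[OF j xy(1,3)] by blast
    obtain V' where V': "V' \<in> Vs (bs ! j)" "y \<in> V'" "dB (bs ! j) (p y) < 2 * e" using u_pos[OF j xy(2,4)] by blast
    have "V = V'" using eq l[OF j V(1,2)] l[OF j V'(1,2)] by simp
    have S: "sheet (Us (bs ! j)) V" using UV[OF bsB[OF j]] V by (auto simp: evenly_def)
    have "MB.mball (bs ! j) (3 * (2 * e)) \<subseteq> Us (bs ! j)" using UV[OF bsB[OF j]] e by simp
    then have "dE x y \<le> dB (p x) (p y)"
      by (rule sheet_dist[OF S]) (use V V' \<open>V = V'\<close> xy bsB[OF j] p_in in auto)
    also have "\<dots> \<le> 4 * e" using MB.triangle''[of "p x" "bs ! j" "p y"] V V' xy p_in bsB[OF j] by auto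
    finally show "dE x y \<le> 4 * e" .
  next
    fix x assume x: "x \<in> topspace E"
    then obtain b where b: "b \<in> F" "dB b (p x) < e" using F(3) p_in[OF x] by auto
    then obtain j where j: "j < length bs" "bs ! j = b" using bs by (metis in_set_conv_nth)
    then have "u j x = 1" using b e(1) by (auto simp: u_def max_def min_def field_simps)
    then show "\<exists>j<length bs. u j x = 1" using j by blast
  qed
qed

text \<open>An initial part of a path is no longer than the path, so a path that nearly realises the
  distance never leaves the ball. Balls are therefore path connected, which provides the local path
  connectedness used when maps are lifted.\<close>

lemma small_ball_path_connected:
  assumes "x \<in> topspace E" "y \<in> topspace E" "dE x y < r"
  obtains g where "pathin E g" "g 0 = x" "g 1 = y" "\<And>t. t \<in> {0..1} \<Longrightarrow> dE x (g t) < r"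
proof -
  obtain g l where g: "pathin E g" "g 0 = x" "g 1 = y" "curve_length dB (p \<circ> g) = ereal l" "l < r"
    using dE_ex[OF assms] by metis
  have "dE x (g t) < r" if t: "t \<in> {0..1}" for t
  proof -
    let ?g1 = "g \<circ> (\<lambda>s. t * s)" and ?g2 = "g \<circ> (\<lambda>s. t + (1 - t) * s)"
    have p12: "pathin E ?g1" "pathin E ?g2"
      using t by (auto intro!: pathin_reparam[OF g(1)] continuous_intros simp: mult_le_one)
        (metis (no_types) add.commute convex_bound_le diff_add_cancel diff_ge_0_iff_ge mult.right_neutral mult_left_le_one_le order.refl)
    have "curve_length dB (p \<circ> ?g1) + curve_length dB (p \<circ> ?g2) \<le> ereal l"
      using curve_length_split[of t dB "p \<circ> g" l] g(4) t by (simp add: o_assoc)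
    then have "curve_length dB (p \<circ> ?g1) \<le> ereal l"
      using curve_length_nonneg[OF p12(2)] by (metis add_increasing2 order_refl order_trans)
    then show ?thesis using dE_le[OF p12(1), of l] g by simp
  qed
  with g that show thesis by blast
qed

end

section \<open>Embedding into normed spaces and deck transformations\<close>

context Metric_space
begin

lemma abs_diff_dist_le: "x \<in> M \<Longrightarrow> y \<in> M \<Longrightarrow> z \<in> M \<Longrightarrow> \<bar>d x z - d y z\<bar> \<le> d x y"
  using mdist_reverse_triangle[of x z y] commute[of z y] by simp

text \<open>The library develops covering space theory only for subsets of normed spaces, hence the detour
  through an isometric embedding.\<close>

definition kuratowski :: "'a \<Rightarrow> 'a \<Rightarrow> 'a discrete \<Rightarrow>\<^sub>C real" where
  "kuratowski x0 x = Bcontfun (\<lambda>i. if of_discrete i \<in> M then d x (of_discrete i) - d x0 (of_discrete i) else 0)"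

lemma apply_kuratowski:
  assumes "x0 \<in> M" "x \<in> M"
  shows "apply_bcontfun (kuratowski x0 x) i
    = (if of_discrete i \<in> M then d x (of_discrete i) - d x0 (of_discrete i) else 0)"
proof -
  let ?f = "\<lambda>i. if of_discrete i \<in> M then d x (of_discrete i) - d x0 (of_discrete i) else 0"
  have "continuous_on UNIV ?f"
    unfolding continuous_on_open_vimage[OF open_UNIV] by (simp add: open_discrete)
  moreover have "bounded (range ?f)"
    unfolding bounded_iff using abs_diff_dist_le[OF assms(2,1)]
    by (intro exI[of _ "d x x0"]) auto
  ultimately have "?f \<in> bcontfun" by (simp add: bcontfun_def)
  then show ?thesis by (simp add: kuratowski_def Bcontfun_inverse)
qed

lemma dist_kuratowski:
  assumes "x0 \<in> M" "x \<in> M" "y \<in> M"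
  shows "dist (kuratowski x0 x) (kuratowski x0 y) = d x y"
proof (rule antisym)
  show "dist (kuratowski x0 x) (kuratowski x0 y) \<le> d x y"
    using assms abs_diff_dist_le[OF assms(2,3)]
    by (intro dist_bound) (auto simp: apply_kuratowski dist_real_def)
  have "d x y = dist (apply_bcontfun (kuratowski x0 x) (discrete y)) (apply_bcontfun (kuratowski x0 y) (discrete y))"
    using assms by (simp add: apply_kuratowski discrete_inverse dist_real_def)
  also have "\<dots> \<le> dist (kuratowski x0 x) (kuratowski x0 y)" by (rule dist_bounded)
  finally show "d x y \<le> dist (kuratowski x0 x) (kuratowski x0 y)" .
qed

lemma isometry_homeomorphic_maps:
  fixes f :: "'a \<Rightarrow> 'v::metric_space"
  assumes iso: "\<And>x y. x \<in> M \<Longrightarrow> y \<in> M \<Longrightarrow> dist (f x) (f y) = d x y"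
  shows "homeomorphic_maps mtopology (top_of_set (f ` M)) f (inv_into M f)"
proof -
  have inj: "inj_on f M" 
  proof (rule inj_onI)
    fix x y assume "x \<in> M" "y \<in> M" "f x = f y"
    then show "x = y" using iso[of x y] by simp
  qed
  have "continuous_map mtopology euclidean f"
    unfolding continuous_map_from_metric
  proof (intro conjI ballI allI impI)
    fix a U assume a: "a \<in> M" and U: "openin euclidean U \<and> f a \<in> U"
    then obtain e where "e > 0" "ball (f a) e \<subseteq> U" using open_contains_ball[of U] by auto
    then show "\<exists>r>0. \<forall>x. x \<in> M \<and> d a x < r \<longrightarrow> f x \<in> U"
      using iso[OF a] by (intro exI[of _ e]) auto
  qed auto
  moreover have "continuous_map (top_of_set (f ` M)) mtopology (inv_into M f)"
    unfolding continuous_map_to_metric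
  proof (intro ballI allI impI)
    fix x and e :: real assume x: "x \<in> topspace (top_of_set (f ` M))" and e: "e > 0"
    show "\<exists>U. openin (top_of_set (f ` M)) U \<and> x \<in> U \<and> (\<forall>y\<in>U. inv_into M f y \<in> mball (inv_into M f x) e)"
      using x e by (intro exI[of _ "f ` M \<inter> ball x e"]) (auto simp: iso inj)
  qed
  ultimately show ?thesis
    unfolding homeomorphic_maps_def using inj by (auto simp: continuous_map_in_subtopology f_inv_into_f)
qed

end

lemma homeomorphic_maps_homeomorphism:
  assumes "homeomorphic_maps (top_of_set S) (top_of_set T) f g"
  shows "homeomorphism S T f g"
proof -
  have "continuous_on S f" "continuous_on T g" "f ` S \<subseteq> T" "g ` T \<subseteq> S"
    "\<And>x. x \<in> S \<Longrightarrow> g (f x) = x" "\<And>y. y \<in> T \<Longrightarrow> f (g y) = y"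
    using assms by (auto simp: homeomorphic_maps_def continuous_map_in_subtopology)
  then show ?thesis by (intro homeomorphismI) auto
qed

text \<open>The embeddings are parameters, since the base points for \<open>kuratowski\<close>
  appear only in the final proof. In the copies \<open>C\<close> and \<open>S\<close> of
  \<open>E\<close> and \<open>B\<close> the given metrics become \<open>dist\<close>.\<close>

locale embedded = lifted_geodesic B dB E p dE
  for B :: "'b topology" and dB and E :: "'a topology" and p dE +
  fixes eE :: "'a \<Rightarrow> 'v::real_normed_vector" and eB :: "'b \<Rightarrow> 'w::real_normed_vector"
  assumes isoE: "\<And>x y. x \<in> topspace E \<Longrightarrow> y \<in> topspace E \<Longrightarrow> dist (eE x) (eE y) = dE x y"
    and isoB: "\<And>x y. x \<in> topspace B \<Longrightarrow> y \<in> topspace B \<Longrightarrow> dist (eB x) (eB y) = dB x y"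
begin

definition "C = eE ` topspace E"
definition "S = eB ` topspace B"
definition "gE = inv_into (topspace E) eE"
definition "gB = inv_into (topspace B) eB"
definition "P = eB \<circ> p \<circ> gE"

lemma homE: "homeomorphic_maps E (top_of_set C) eE gE"
  unfolding C_def gE_def using ME.isometry_homeomorphic_maps[of eE] isoE
  by (simp add: mtopology_E dd_def)

lemma homB: "homeomorphic_maps B (top_of_set S) eB gB"
  unfolding S_def gB_def using MB.isometry_homeomorphic_maps[of eB] isoB by (simp add: top)

lemma E_rules [simp]:
  "x \<in> topspace E \<Longrightarrow> eE x \<in> C" "y \<in> C \<Longrightarrow> gE y \<in> topspace E"
  "x \<in> topspace E \<Longrightarrow> gE (eE x) = x" "y \<in> C \<Longrightarrow> eE (gE y) = y"
  using homE by (auto simp: homeomorphic_maps_def continuous_map_def)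

lemma B_rules [simp]:
  "b \<in> topspace B \<Longrightarrow> eB b \<in> S" "s \<in> S \<Longrightarrow> gB s \<in> topspace B"
  "b \<in> topspace B \<Longrightarrow> gB (eB b) = b" "s \<in> S \<Longrightarrow> eB (gB s) = s"
  using homB by (auto simp: homeomorphic_maps_def continuous_map_def)

lemma inj_E: "inj_on eE (topspace E)" and inj_B: "inj_on eB (topspace B)"
  by (rule inj_on_inverseI[of _ gE], simp) (rule inj_on_inverseI[of _ gB], simp)

lemma cont_eE: "continuous_map E (top_of_set C) eE" and cont_gE: "continuous_map (top_of_set C) E gE"
  and cont_eB: "continuous_map B (top_of_set S) eB" and cont_gB: "continuous_map (top_of_set S) B gB"
  using homE homB by (auto simp: homeomorphic_maps_def)

lemma P_eq: "x \<in> topspace E \<Longrightarrow> P (eE x) = eB (p x)"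
  by (simp add: P_def)

lemma dist_C: "x \<in> C \<Longrightarrow> y \<in> C \<Longrightarrow> dist x y = dE (gE x) (gE y)"
  using isoE[of "gE x" "gE y"] by simp

lemma cont_P: "continuous_on C P" and P_in: "x \<in> C \<Longrightarrow> P x \<in> S"
proof -
  have "continuous_map (top_of_set C) (top_of_set S) P"
    unfolding P_def by (intro continuous_map_compose[OF cont_gE] continuous_map_compose[OF cont_p] cont_eB)
  then show "continuous_on C P" "x \<in> C \<Longrightarrow> P x \<in> S" by (auto simp: continuous_map_in_subtopology)
qed

lemma openin_C: "openin E W \<Longrightarrow> openin (top_of_set C) (eE ` W)"
  using homeomorphic_map_openness[OF homeomorphic_maps_imp_map[OF homE] openin_subset] by simp

lemma covering_P: "covering_space C P S"
proof
  show "continuous_on C P" by (rule cont_P)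
  show "P ` C = S"
  proof -
    have "P ` C = (\<lambda>x. eB (p x)) ` topspace E" unfolding C_def image_image by (intro image_cong) (auto simp: P_eq)
    also have "\<dots> = S" using surj_p unfolding S_def by (metis image_image)
    finally show ?thesis .
  qed
  fix s assume s: "s \<in> S"
  obtain U \<V> where U: "openin B U" "gB s \<in> U" "\<Union>\<V> = {x \<in> topspace E. p x \<in> U}"
      "pairwise disjnt \<V>" "\<And>V. V \<in> \<V> \<Longrightarrow> sheet U V"
    by (rule evenly_covered[of "gB s"]) (use s in auto)
  have UB: "U \<subseteq> topspace B" using U(1) openin_subset by blast
  have VE: "V \<subseteq> topspace E" if "V \<in> \<V>" for V using U(5)[OF that] sheetD by blast
  show "\<exists>T. s \<in> T \<and> openin (top_of_set S) T \<and>
      (\<exists>v. \<Union>v = C \<inter> P -` T \<and> (\<forall>u\<in>v. openin (top_of_set C) u) \<and> pairwise disjnt v \<and>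
         (\<forall>u\<in>v. Ex (homeomorphism u T P)))"
  proof (intro exI[of _ "eB ` U"] exI[of _ "(`) eE ` \<V>"] conjI ballI)
    show "s \<in> eB ` U" using imageI[OF U(2), of eB] s by simp
    show "openin (top_of_set S) (eB ` U)"
      using homeomorphic_map_openness[OF homeomorphic_maps_imp_map[OF homB] UB] U(1) by simp
    show "\<Union>((`) eE ` \<V>) = C \<inter> P -` (eB ` U)"
    proof -
      have *: "P (eE x) \<in> eB ` U \<longleftrightarrow> p x \<in> U" if "x \<in> topspace E" for x
        using inj_on_image_mem_iff[OF inj_B p_in[OF that] UB] P_eq[OF that] by simp
      have "C \<inter> P -` (eB ` U) = eE ` {x \<in> topspace E. p x \<in> U}"
        unfolding C_def using * by blast
      then show ?thesis unfolding U(3)[symmetric] by auto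
    qed
    show "pairwise disjnt ((`) eE ` \<V>)"
    proof -
      have "disjnt (eE ` V) (eE ` V')" if "V \<in> \<V>" "V' \<in> \<V>" "disjnt V V'" for V V'
        using inj_on_image_Int[OF inj_E VE[OF that(1)] VE[OF that(2)]] that(3) by (simp add: disjnt_def)
      then show ?thesis using U(4) unfolding pairwise_def by blast
    qed
  next
    fix u assume "u \<in> (`) eE ` \<V>"
    then obtain V where V: "V \<in> \<V>" "u = eE ` V" by blast
    note S = U(5)[OF V(1)]
    show "openin (top_of_set C) u" unfolding V(2) by (rule openin_C) (rule sheetD[OF S])
    obtain q where q: "homeomorphic_maps (subtopology E V) (subtopology B U) p q"
      using sheetD(8)[OF S] homeomorphic_map_maps by blast
    have "homeomorphic_maps (subtopology (top_of_set C) u) (subtopology E V) gE eE"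
    proof (rule homeomorphic_maps_subtopologies)
      show "homeomorphic_maps (top_of_set C) E gE eE" by (rule homeomorphic_maps_sym[THEN iffD1, OF homE])
      have "topspace (top_of_set C) \<inter> u = eE ` V" using V VE[OF V(1)] by auto
      then have "gE ` (topspace (top_of_set C) \<inter> u) = (\<lambda>x. gE (eE x)) ` V" by (simp add: image_image)
      also have "\<dots> = V" using VE[OF V(1)] by (force simp: subset_iff)
      finally show "gE ` (topspace (top_of_set C) \<inter> u) = topspace E \<inter> V" using VE[OF V(1)] by auto
    qed
    moreover have "homeomorphic_maps (subtopology B U) (subtopology (top_of_set S) (eB ` U)) eB gB"
      by (rule homeomorphic_maps_subtopologies[OF homB]) (use UB in auto)
    ultimately have "homeomorphic_maps (subtopology (top_of_set C) u) (subtopology (top_of_set S) (eB ` U))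
        (eB \<circ> (p \<circ> gE)) ((eE \<circ> q) \<circ> gB)"
      using q by (intro homeomorphic_maps_compose conjI)
    moreover have "subtopology (top_of_set C) u = top_of_set u"
      "subtopology (top_of_set S) (eB ` U) = top_of_set (eB ` U)"
      using V VE[OF V(1)] UB by (auto simp: subtopology_subtopology Int_absorb1 C_def S_def image_mono)
    ultimately have "homeomorphism u (eB ` U) P ((eE \<circ> q) \<circ> gB)"
      using homeomorphic_maps_homeomorphism[of u "eB ` U" "eB \<circ> (p \<circ> gE)" "(eE \<circ> q) \<circ> gB"]
      by (simp add: P_def o_assoc)
    then show "Ex (homeomorphism u (eB ` U) P)" by blast
  qed
qed


lemma proper_C:
  assumes "y \<in> C" shows "compact (C \<inter> cball y r)"
proof -
  obtain K where K: "compactin E K" "ME.mcball (gE y) r \<subseteq> K" by (rule proper_E[of "gE y" r]) (use assms in auto)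
  have "compactin (top_of_set C) (eE ` K)" using image_compactin[OF K(1) cont_eE] .
  then have c: "compact (eE ` K)" and sub: "eE ` K \<subseteq> C" by (simp_all add: compactin_subtopology)
  have "C \<inter> cball y r \<subseteq> eE ` K"
  proof
    fix x assume x: "x \<in> C \<inter> cball y r"
    then have "gE x \<in> K" using K(2) assms dist_C[of y x] by (auto simp: dd_def subset_iff)
    then show "x \<in> eE ` K" using x by (metis E_rules(4) IntD1 imageI)
  qed
  then have "C \<inter> cball y r = eE ` K \<inter> cball y r" using sub by auto
  then show ?thesis using c by (simp add: compact_Int_closed)
qed

lemma path_connected_C: "path_connected C"
proof -
  have "path_connectedin (top_of_set C) (eE ` topspace E)"
    using path_conn by (intro path_connectedin_continuous_map_image[OF cont_eE]) (simp add: path_connectedin_topspace)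
  then show ?thesis by (simp add: C_def path_connectedin_subtopology)
qed

lemma locally_path_connected_C: "locally path_connected C"
proof (rule locally_path_connected_1)
  fix v x assume v: "openin (top_of_set C) v" and x: "x \<in> v"
  obtain e where e: "e > 0" "ball x e \<inter> C \<subseteq> v" and xC: "x \<in> C"
    using v x by (metis openin_contains_ball openin_subset subsetD topspace_euclidean_subtopology)
  have "path_connected (C \<inter> ball x e)"
    unfolding path_connected_component
  proof (intro ballI)
    have "path_component (C \<inter> ball x e) x y" if y: "y \<in> C \<inter> ball x e" for y
    proof -
      have "dE (gE x) (gE y) < e" using y xC dist_C by auto
      then obtain g where g: "pathin E g" "g 0 = gE x" "g 1 = gE y" "\<And>t. t \<in> {0..1} \<Longrightarrow> dE (gE x) (g t) < e"
        using small_ball_path_connected[of "gE x" "gE y" e] xC y by auto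
      have gin: "g t \<in> topspace E" if "t \<in> {0..1}" for t
        using path_image_subset_topspace[OF g(1)] that by blast
      have "pathin (top_of_set C) (eE \<circ> g)" using g(1) cont_eE by (rule pathin_compose)
      moreover have "(eE \<circ> g) t \<in> ball x e" if "t \<in> {0..1}" for t
        using g(4)[OF that] gin[OF that] xC by (simp add: dist_C)
      ultimately show ?thesis
        using g xC y unfolding path_component_def pathin_canon_iff
        by (intro exI[of _ "eE \<circ> g"]) (auto simp: path_image_def pathstart_def pathfinish_def)
    qed
    then show "path_component (C \<inter> ball x e) y z" if "y \<in> C \<inter> ball x e" "z \<in> C \<inter> ball x e" for y z
      using that path_component_sym path_component_trans by meson
  qed
  then show "\<exists>u. openin (top_of_set C) u \<and> path_connected u \<and> x \<in> u \<and> u \<subseteq> v"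
    using e x xC by (intro exI[of _ "C \<inter> ball x e"]) (auto simp: openin_open_Int)
qed

lemma simply_connected_C:
  assumes "simply_connected_sp E" shows "simply_connected C"
  unfolding simply_connected_eq_contractible_path
proof (intro conjI allI impI path_connected_C)
  fix c assume c: "path c \<and> path_image c \<subseteq> C \<and> pathfinish c = pathstart c"
  have "pathin (top_of_set C) c" using c by (auto simp: pathin_canon_iff path_image_def)
  then have g: "pathin E (gE \<circ> c)" using cont_gE by (rule pathin_compose)
  have cC: "c t \<in> C" if "t \<in> {0..1}" for t using c that by (auto simp: path_image_def)
  have "c 1 = c 0" using c by (auto simp: pathstart_def pathfinish_def)
  then have "homotopic_with (\<lambda>h. h 0 = gE (c 0) \<and> h 1 = gE (c 0)) (top_of_set {0..1}) E (gE \<circ> c) (\<lambda>_. gE (c 0))"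
  proof -
    have "homotopic_with (\<lambda>h. h 0 = (gE \<circ> c) 0 \<and> h 1 = (gE \<circ> c) 1) (top_of_set {0..1}) E (gE \<circ> c) (\<lambda>_. (gE \<circ> c) 0)"
    proof -
      have "pathin E (gE \<circ> c) \<and> (gE \<circ> c) 1 = (gE \<circ> c) 0" using g \<open>c 1 = c 0\<close> by simp
      with assms show ?thesis unfolding simply_connected_sp_def by blast
    qed
    then show ?thesis using \<open>c 1 = c 0\<close> by simp
  qed
  then have "homotopic_with (\<lambda>h. h 0 = c 0 \<and> h 1 = c 0) (top_of_set {0..1}) (top_of_set C) (eE \<circ> (gE \<circ> c)) (eE \<circ> (\<lambda>_. gE (c 0)))"
    by (rule homotopic_with_compose_continuous_map_left[OF _ cont_eE]) (use cC[of 0] in auto)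
  then have "homotopic_with (\<lambda>h. h 0 = c 0 \<and> h 1 = c 0) (top_of_set {0..1}) (top_of_set C) c (\<lambda>_. c 0)"
    by (rule homotopic_with_eq) (use cC in auto)
  moreover have "linepath (pathstart c) (pathstart c) = (\<lambda>_. c 0)" by (auto simp: linepath_def pathstart_def algebra_simps simp flip: scaleR_left_distrib)
  ultimately show "homotopic_paths C c (linepath (pathstart c) (pathstart c))"
    using \<open>c 1 = c 0\<close> by (simp add: homotopic_paths_def pathstart_def pathfinish_def)
qed

text \<open>A map over the identity of \<open>S\<close> leaves the projection of every path
  unchanged, hence also the length that defines \<open>dE\<close>. For a deck transformation and its
  inverse this amounts to an isometry.\<close>

lemma lift_nonexpansive:
  assumes g: "continuous_on C g" "\<And>x. x \<in> C \<Longrightarrow> g x \<in> C" "\<And>x. x \<in> C \<Longrightarrow> P (g x) = P x"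
    and xy: "x \<in> C" "y \<in> C"
  shows "dist (g x) (g y) \<le> dist x y"
proof -
  let ?h = "gE \<circ> g \<circ> eE"
  have "continuous_map (top_of_set C) (top_of_set C) g" using g by (auto simp: continuous_map_in_subtopology)
  then have h: "continuous_map E E ?h"
    by (intro continuous_map_compose[OF cont_eE] continuous_map_compose[OF _ cont_gE])
  have ph: "p (?h z) = p z" if "z \<in> topspace E" for z
  proof -
    have gz: "g (eE z) \<in> C" using g(2) that by simp
    then have hz: "?h z \<in> topspace E" "eE (?h z) = g (eE z)" by simp_all
    have "eB (p (?h z)) = P (g (eE z))" using P_eq[OF hz(1)] hz(2) by simp
    also have "\<dots> = eB (p z)" using g(3)[of "eE z"] P_eq[OF that] that by simp
    finally show ?thesis using inj_onD[OF inj_B] p_in[OF hz(1)] p_in[OF that] by blast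
  qed
  have "dE (?h a) (?h b) \<le> dE a b" if ab: "a \<in> topspace E" "b \<in> topspace E" for a b
  proof (rule dense_ge)
    fix r assume "dE a b < r"
    then obtain c l where c: "pathin E c" "c 0 = a" "c 1 = b" "curve_length dB (p \<circ> c) = ereal l" "l < r"
      using dE_ex[OF ab] by metis
    have "pathin E (?h \<circ> c)" using c(1) h by (rule pathin_compose)
    moreover have "curve_length dB (p \<circ> (?h \<circ> c)) \<le> curve_length dB (p \<circ> c)"
    proof (rule curve_length_le)
      fix k and t :: "nat \<Rightarrow> real" assume t: "t 0 = 0" "t k = 1" "\<And>i. i < k \<Longrightarrow> t i \<le> t (Suc i)"
      have "c (t i) \<in> topspace E" if "i \<le> k" for i
        using partition_bounds[OF t that] path_image_subset_topspace[OF c(1)] by auto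
      then have "(\<Sum>i<k. dB ((p \<circ> (?h \<circ> c)) (t i)) ((p \<circ> (?h \<circ> c)) (t (Suc i))))
          = (\<Sum>i<k. dB ((p \<circ> c) (t i)) ((p \<circ> c) (t (Suc i))))"
        using ph by (intro sum.cong) auto
      then show "ereal (\<Sum>i<k. dB ((p \<circ> (?h \<circ> c)) (t i)) ((p \<circ> (?h \<circ> c)) (t (Suc i)))) \<le> curve_length dB (p \<circ> c)"
        using curve_length_ge[OF t, of dB "p \<circ> c"] by simp
    qed
    ultimately show "dE (?h a) (?h b) \<le> r" using dE_le[of "?h \<circ> c" l] c by simp
  qed
  from this[of "gE x" "gE y"] show ?thesis using xy g(2) by (simp add: dist_C)
qed

lemma near_fibre_C:
  obtains D where "\<And>x s. x \<in> C \<Longrightarrow> s \<in> S \<Longrightarrow> \<exists>y\<in>C. P y = s \<and> dist x y \<le> D"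
proof -
  obtain D where D: "\<And>x b. x \<in> topspace E \<Longrightarrow> b \<in> topspace B \<Longrightarrow> \<exists>y\<in>topspace E. p y = b \<and> dE x y \<le> D"
    by (rule near_fibre) blast
  have "\<exists>y\<in>C. P y = s \<and> dist x y \<le> D" if xs: "x \<in> C" "s \<in> S" for x s
  proof -
    obtain y where "y \<in> topspace E" "p y = gB s" "dE (gE x) y \<le> D"
      using D[of "gE x" "gB s"] E_rules(2)[OF xs(1)] B_rules(2)[OF xs(2)] by blast
    then show ?thesis using xs by (intro bexI[of _ "eE y"]) (auto simp: dist_C P_eq)
  qed
  with that show thesis by blast
qed

text \<open>Lifting \<open>P\<close> through itself gives maps over \<open>S\<close> that send a to
  b and b to a. Their composites are again lifts of \<open>P\<close> and have a fixed point, so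
  uniqueness of lifts makes them the identity.\<close>

lemma deck_transformation:
  assumes sc: "simply_connected_sp E" and ab: "a \<in> C" "b \<in> C" "P a = P b"
  obtains g g' where "continuous_on C g" "g \<in> C \<rightarrow> C" "continuous_on C g'" "g' \<in> C \<rightarrow> C"
    "\<And>x. x \<in> C \<Longrightarrow> g (g' x) = x" "\<And>x. x \<in> C \<Longrightarrow> g' (g x) = x" "g a = b" "g' b = a"
    "\<And>x y. x \<in> C \<Longrightarrow> y \<in> C \<Longrightarrow> dist (g x) (g y) \<le> dist x y"
    "\<And>x y. x \<in> C \<Longrightarrow> y \<in> C \<Longrightarrow> dist (g' x) (g' y) \<le> dist x y"
proof -
  have lift: "\<exists>g. continuous_on C g \<and> g \<in> C \<rightarrow> C \<and> g a = b \<and> (\<forall>x\<in>C. P (g x) = P x)"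
    if "a \<in> C" "b \<in> C" "P a = P b" for a b
  proof -
    have "P \<in> C \<rightarrow> S" using P_in by auto
    from covering_space_lift_strong[OF covering_P that(2,1) simply_connected_C[OF sc] locally_path_connected_C cont_P this that(3)]
    show ?thesis by metis
  qed
  obtain g where g: "continuous_on C g" "g \<in> C \<rightarrow> C" "g a = b" "\<And>x. x \<in> C \<Longrightarrow> P (g x) = P x"
    using lift[OF ab] by blast
  obtain g' where g': "continuous_on C g'" "g' \<in> C \<rightarrow> C" "g' b = a" "\<And>x. x \<in> C \<Longrightarrow> P (g' x) = P x"
    using lift[OF ab(2,1) ab(3)[symmetric]] by blast
  have uniq: "h x = x" if h: "continuous_on C h" "h \<in> C \<rightarrow> C" "h c = c" "c \<in> C" "\<And>x. x \<in> C \<Longrightarrow> P (h x) = P x" "x \<in> C" for h c x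
  proof (rule covering_space_lift_unique[OF covering_P, where f = P and T = C and a = c and ?g2.0 = "\<lambda>x. x"])
    show "connected C" using path_connected_C by (rule path_connected_imp_connected)
  qed (use h cont_P P_in in auto)
  have "g (g' x) = x" if "x \<in> C" for x
    by (rule uniq[of "\<lambda>x. g (g' x)" b x])
      (use g g' that ab in \<open>auto simp: Pi_iff intro!: continuous_on_compose2[OF g(1) g'(1)]\<close>)
  moreover have "g' (g x) = x" if "x \<in> C" for x
    by (rule uniq[of "\<lambda>x. g' (g x)" a x])
      (use g g' that ab in \<open>auto simp: Pi_iff intro!: continuous_on_compose2[OF g'(1) g(1)]\<close>)
  ultimately show thesis
    using that[of g g'] g g' lift_nonexpansive[OF g(1)] lift_nonexpansive[OF g'(1)] by (auto simp: Pi_iff)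
qed

end

section \<open>Null-homotopies of spheres\<close>

lemma powertop_real_eq: "product_topology (\<lambda>i::nat. euclideanreal) UNIV = euclidean"
  by (rule euclidean_product_topology)

lemma Euclidean_space_eq: "Euclidean_space n = top_of_set {x. \<forall>i\<ge>n. x i = 0}"
  by (simp add: Euclidean_space_def powertop_real_eq)

lemma nsphere_eq: "nsphere n = top_of_set {x. (\<forall>i\<ge>Suc n. x i = 0) \<and> (\<Sum>i\<le>n. x i ^ 2) = 1}"
  by (auto simp: nsphere_def Euclidean_space_eq subtopology_subtopology Int_def)

lemma subtopology_dball: "subtopology (Euclidean_space n) (dball_set n) = top_of_set (dball_set n)"
  and subtopology_obball: "subtopology (Euclidean_space n) (obball_set n) = top_of_set (obball_set n)"
  by (auto simp: Euclidean_space_eq subtopology_subtopology dball_set_def obball_set_def intro!: arg_cong[where f=top_of_set])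

abbreviation Sph :: "nat \<Rightarrow> (nat \<Rightarrow> real) set" where "Sph n \<equiv> topspace (nsphere n)"

lemma Sph_def: "Sph n = {x. (\<forall>i\<ge>Suc n. x i = 0) \<and> (\<Sum>i\<le>n. x i ^ 2) = 1}"
  by (simp add: nsphere_eq)

lemma continuous_map_nsphere: "continuous_map (nsphere n) (top_of_set C) f \<longleftrightarrow> continuous_on (Sph n) f \<and> f ` Sph n \<subseteq> C"
  by (simp add: nsphere_eq continuous_map_in_subtopology image_subset_iff_funcset)

lemma prod_topology_nsphere: "prod_topology (top_of_set A) (nsphere n) = top_of_set (A \<times> Sph n)"
  by (auto simp: nsphere_eq prod_topology_subtopology subtopology_subtopology intro!: arg_cong[where f = top_of_set])

lemma dball_split: "dball_set n = obball_set n \<union> bsphere_set n"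
  by (auto simp: dball_set_def obball_set_def bsphere_set_def)

lemma continuous_on_coord [continuous_intros]:
  "continuous_on A (\<lambda>x::nat \<Rightarrow> real. x i)" "continuous_on A' (\<lambda>z::'a::topological_space \<times> (nat \<Rightarrow> real). snd z i)"
  by (rule continuous_on_product_then_coordinatewise, rule continuous_on_id)
    (rule continuous_on_product_then_coordinatewise, rule continuous_on_snd, rule continuous_on_id)

lemma closed_vanishing: "closed {x::nat \<Rightarrow> real. \<forall>i\<ge>n. x i = 0}"
proof -
  have "{x::nat \<Rightarrow> real. \<forall>i\<ge>n. x i = 0} = (\<Inter>i\<in>{n..}. {x. x i = 0})" by auto
  then show ?thesis by (auto intro!: closed_INT closed_Collect_eq continuous_intros)
qed

lemma closed_dball: "closed (dball_set n)" and closed_bsphere: "closed (bsphere_set n)"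
proof -
  have "dball_set n = {x. \<forall>i\<ge>n. x i = 0} \<inter> {x. (\<Sum>i<n. x i ^ 2) \<le> 1}"
    "bsphere_set n = {x. \<forall>i\<ge>n. x i = 0} \<inter> {x. (\<Sum>i<n. x i ^ 2) = 1}"
    by (auto simp: dball_set_def bsphere_set_def)
  then show "closed (dball_set n)" "closed (bsphere_set n)"
    using closed_vanishing[of n]
    by (auto intro!: closed_Int closed_Collect_eq closed_Collect_le continuous_intros)
qed

lemma dball_coord_le: "x \<in> dball_set n \<Longrightarrow> \<bar>x i\<bar> \<le> 1"
proof (cases "i < n")
  case True
  assume x: "x \<in> dball_set n"
  have "x i ^ 2 \<le> (\<Sum>i<n. x i ^ 2)" using True by (intro member_le_sum) auto
  also have "\<dots> \<le> 1" using x by (simp add: dball_set_def)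
  finally show ?thesis by (simp add: abs_square_le_1)
qed (auto simp: dball_set_def)

text \<open>A closed subset of a cube that is compact by Tychonoff; the ambient space is an infinite
  product.\<close>

lemma compact_dball: "compact (dball_set n)"
proof -
  have "compactin (product_topology (\<lambda>i::nat. euclideanreal) UNIV) (PiE UNIV (\<lambda>_. {-1..1}))"
    unfolding compactin_PiE by auto
  then have "compact (PiE UNIV (\<lambda>_::nat. {-1..1::real}))" unfolding powertop_real_eq by simp
  moreover have "dball_set n \<subseteq> PiE UNIV (\<lambda>_. {-1..1})"
    using dball_coord_le by (force simp: abs_le_iff)
  ultimately show ?thesis using closed_dball by (metis compact_Int_closed inf.absorb2)
qed

text \<open>Reduces to convexity of the square, one coordinate at a time; the defect is t (1 - t) (a
  - b)^2.\<close>

lemma dball_convex: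
  assumes "x \<in> dball_set n" "y \<in> dball_set n" "0 \<le> t" "t \<le> 1"
  shows "(\<lambda>i. (1 - t) * x i + t * y i) \<in> dball_set n"
proof -
  have sq: "((1 - t) * a + t * b)^2 \<le> (1 - t) * a^2 + t * b^2" for a b :: real
  proof -
    have "(1 - t) * a^2 + t * b^2 - ((1 - t) * a + t * b)^2 = t * (1 - t) * (a - b)^2"
      by (simp add: power2_eq_square algebra_simps)
    moreover have "0 \<le> t * (1 - t) * (a - b)^2" using assms by simp
    ultimately show ?thesis by linarith
  qed
  have "(\<Sum>i<n. ((1 - t) * x i + t * y i)^2) \<le> (\<Sum>i<n. (1 - t) * x i ^ 2 + t * y i ^ 2)"
    by (intro sum_mono sq)
  also have "\<dots> = (1 - t) * (\<Sum>i<n. x i ^ 2) + t * (\<Sum>i<n. y i ^ 2)"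
    by (simp add: sum.distrib sum_distrib_left)
  also have "\<dots> \<le> (1 - t) * 1 + t * 1"
    using assms by (intro add_mono mult_left_mono) (auto simp: dball_set_def)
  finally show ?thesis using assms by (simp add: dball_set_def)
qed

lemma zero_in_dball: "(\<lambda>i. 0) \<in> dball_set n"
  by (simp add: dball_set_def)

lemma connected_dball: "connected (dball_set n)"
proof -
  let ?seg = "\<lambda>x::nat \<Rightarrow> real. (\<lambda>t i. t * x i) ` {0..1::real}"
  have "connected (?seg x)" for x
    by (intro connected_continuous_image) (auto intro!: continuous_intros)
  then have "connected (\<Union>(?seg ` dball_set n))"
    by (intro connected_Union) (auto intro!: exI[of _ "\<lambda>i. 0"] image_eqI[of _ _ 0])
  moreover have "\<Union>(?seg ` dball_set n) = dball_set n"
  proof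
    show "\<Union>(?seg ` dball_set n) \<subseteq> dball_set n"
      using dball_convex[OF zero_in_dball] by fastforce
    show "dball_set n \<subseteq> \<Union>(?seg ` dball_set n)"
    proof
      fix x assume "x \<in> dball_set n"
      moreover have "x \<in> ?seg x" by (auto intro!: image_eqI[of _ _ 1])
      ultimately show "x \<in> \<Union>(?seg ` dball_set n)" by blast
    qed
  qed
  ultimately show ?thesis by simp
qed

text \<open>The two hemispheres are graphs over the ball, and they share the first unit vector as
  soon as n \<ge> 1.\<close>

lemma connected_Sph:
  assumes "n \<ge> 1" shows "connected (Sph n)"
proof -
  let ?h = "\<lambda>s (u::nat \<Rightarrow> real) i. if i = n then s * sqrt (1 - (\<Sum>i<n. u i ^ 2)) else u i"
  have c: "connected (?h s ` dball_set n)" for s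
  proof (intro connected_continuous_image connected_dball continuous_on_coordinatewise_then_product)
    show "continuous_on (dball_set n) (\<lambda>u. ?h s u i)" for i
      by (cases "i = n") (auto intro!: continuous_intros)
  qed
  have "Sph n = ?h 1 ` dball_set n \<union> ?h (-1) ` dball_set n"
  proof (intro equalityI subsetI)
    fix x assume x: "x \<in> Sph n"
    let ?u = "x(n := 0)"
    have s: "(\<Sum>i<n. ?u i ^ 2) = (\<Sum>i<n. x i ^ 2)" by (intro sum.cong) auto
    have x1: "(\<Sum>i<n. x i ^ 2) + x n ^ 2 = 1"
      using x by (simp add: Sph_def lessThan_Suc_atMost[symmetric])
    then have "x n ^ 2 = 1 - (\<Sum>i<n. x i ^ 2)" by simp
    then have xn: "\<bar>x n\<bar> = sqrt (1 - (\<Sum>i<n. ?u i ^ 2))" by (metis s real_sqrt_abs)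
    have "(\<Sum>i<n. x i ^ 2) \<le> 1" using x1 zero_le_power2[of "x n"] by linarith
    then have u: "?u \<in> dball_set n" using x s by (auto simp: dball_set_def Sph_def)
    show "x \<in> ?h 1 ` dball_set n \<union> ?h (-1) ` dball_set n"
    proof (cases "x n \<ge> 0")
      case True
      then have "x = ?h 1 ?u" using xn by (auto simp: fun_eq_iff)
      then show ?thesis using u by blast
    next
      case False
      then have "x = ?h (-1) ?u" using xn by (auto simp: fun_eq_iff)
      then show ?thesis using u by blast
    qed
  next
    fix x assume "x \<in> ?h 1 ` dball_set n \<union> ?h (-1) ` dball_set n"
    then obtain s u where u: "u \<in> dball_set n" "x = ?h s u" "s = 1 \<or> s = -1" by blast
    have "(\<Sum>i<n. x i ^ 2) = (\<Sum>i<n. u i ^ 2)" using u by (intro sum.cong) auto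
    moreover have "x n ^ 2 = 1 - (\<Sum>i<n. u i ^ 2)" using u by (auto simp: dball_set_def)
    ultimately show "x \<in> Sph n" using u by (auto simp: Sph_def dball_set_def lessThan_Suc_atMost[symmetric])
  qed
  moreover have "?h 1 ` dball_set n \<inter> ?h (-1) ` dball_set n \<noteq> {}"
  proof -
    let ?e = "\<lambda>i. if i = 0 then 1 else 0 :: real"
    have "(\<Sum>i<n. ?e i ^ 2) = 1" using assms by (simp add: if_distrib[of "\<lambda>x. x^2"] cong: if_cong)
    then have "?e \<in> dball_set n" "?h 1 ?e = ?e" "?h (-1) ?e = ?e" using assms by (auto simp: dball_set_def)
    then have "?e \<in> ?h 1 ` dball_set n" "?e \<in> ?h (-1) ` dball_set n"
      by (auto intro: image_eqI[OF sym])
    then show ?thesis by blast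
  qed
  ultimately show ?thesis using connected_Un[OF c[of 1] c[of "-1"]] by simp
qed

text \<open>The balls and spheres used as parameter spaces lie in the metric space
  \<open>nat \<Rightarrow> real\<close>. The parameter space is moved isometrically into a space of
  bounded functions, the homotopy is lifted there, and the lift is moved back.\<close>

lemma covering_space_lift_homotopy_metric:
  fixes P :: "'v::real_normed_vector \<Rightarrow> 'w::real_normed_vector"
    and h :: "real \<times> 'c::metric_space \<Rightarrow> 'w"
  assumes cov: "covering_space C P S"
    and h: "continuous_on ({0..1} \<times> U) h" "h \<in> ({0..1} \<times> U) \<rightarrow> S"
    and f: "\<And>y. y \<in> U \<Longrightarrow> h (0,y) = P (f y)" "continuous_on U f" "f \<in> U \<rightarrow> C"
  obtains k where "continuous_on ({0..1} \<times> U) k" "k \<in> ({0..1} \<times> U) \<rightarrow> C"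
    "\<And>y. y \<in> U \<Longrightarrow> k (0, y) = f y" "\<And>z. z \<in> {0..1} \<times> U \<Longrightarrow> h z = P (k z)"
proof -
  define e where "e = Met_TC.kuratowski (undefined::'c)"
  define g where "g = inv_into UNIV e"
  have iso: "dist (e x) (e y) = dist x y" for x y by (simp add: e_def Met_TC.dist_kuratowski)
  have ge: "g (e x) = x" for x
  proof -
    have "inj e" using iso by (metis dist_eq_0_iff injI)
    then show ?thesis by (simp add: g_def)
  qed
  have ce: "continuous_on A e" for A
    unfolding continuous_on_iff using iso by metis
  have cg: "continuous_on (e ` A) g" for A
    unfolding continuous_on_iff using iso ge by (metis imageE)
  let ?h = "\<lambda>(t, z). h (t, g z)"
  have 1: "continuous_on ({0..1} \<times> e ` U) ?h"
    unfolding split_beta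
    by (rule continuous_on_compose2[OF h(1)])
      (auto intro!: continuous_intros continuous_on_compose2[OF cg[of U]] simp: ge)
  have 2: "?h \<in> ({0..1} \<times> e ` U) \<rightarrow> S" using h(2) ge by auto
  have 3: "?h (0, z) = P ((f \<circ> g) z)" if "z \<in> e ` U" for z using f(1) that ge by auto
  have 4: "continuous_on (e ` U) (f \<circ> g)"
    by (rule continuous_on_compose) (auto intro: cg simp: image_image ge f(2))
  have 5: "f \<circ> g \<in> e ` U \<rightarrow> C" using f(3) ge by auto
  obtain k where k: "continuous_on ({0..1} \<times> e ` U) k" "k \<in> ({0..1} \<times> e ` U) \<rightarrow> C"
    "\<And>y. y \<in> e ` U \<Longrightarrow> k (0, y) = (f \<circ> g) y" "\<And>z. z \<in> {0..1} \<times> e ` U \<Longrightarrow> ?h z = P (k z)"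
    by (rule covering_space_lift_homotopy[OF cov 1 2 3 4 5]) (assumption, blast)
  show thesis
  proof (rule that[of "\<lambda>(t, y). k (t, e y)"])
    show "continuous_on ({0..1} \<times> U) (\<lambda>(t, y). k (t, e y))"
      unfolding split_beta
      by (rule continuous_on_compose2[OF k(1)])
        (auto intro!: continuous_intros continuous_on_compose2[OF ce[of UNIV]])
    show "h z = P ((\<lambda>(t, y). k (t, e y)) z)" if "z \<in> {0..1} \<times> U" for z
      using k(4)[of "(fst z, e (snd z))"] that ge by auto
  qed (use k ge in auto)
qed

text \<open>The straight-line homotopy from the constant u to the identity of the ball turns \<phi>
  into a homotopy that begins with a constant, and this lifts starting from the constant x. The end
  of the lift is \<Phi>.\<close>

lemma lift_dball:
  fixes P :: "'v::real_normed_vector \<Rightarrow> 'w::real_normed_vector"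
  assumes cov: "covering_space C P S"
    and phi: "continuous_on (dball_set n) \<phi>" "\<phi> ` dball_set n \<subseteq> S"
    and a: "u \<in> dball_set n" "x \<in> C" "\<phi> u = P x"
  obtains \<Phi> where "continuous_on (dball_set n) \<Phi>" "\<Phi> ` dball_set n \<subseteq> C"
    "\<And>v. v \<in> dball_set n \<Longrightarrow> P (\<Phi> v) = \<phi> v" "\<Phi> u = x"
proof -
  let ?c = "\<lambda>(t, v). \<lambda>i. (1 - t) * u i + t * v i"
  let ?h = "\<lambda>z. \<phi> (?c z)"
  have "continuous_on ({0..1} \<times> dball_set n) ?c"
    unfolding split_beta by (intro continuous_on_coordinatewise_then_product continuous_intros)
  moreover have c: "?c z \<in> dball_set n" if "z \<in> {0..1} \<times> dball_set n" for z
    using dball_convex[OF a(1)] that by auto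
  ultimately have "continuous_on ({0..1} \<times> dball_set n) ?h"
    by (intro continuous_on_compose2[OF phi(1)]) auto
  moreover have "?h \<in> ({0..1} \<times> dball_set n) \<rightarrow> S" using c phi(2) by auto
  moreover have "?h (0, v) = P ((\<lambda>_. x) v)" for v using a(3) by simp
  ultimately obtain k where k: "continuous_on ({0..1} \<times> dball_set n) k" "k \<in> ({0..1} \<times> dball_set n) \<rightarrow> C"
    "\<And>v. v \<in> dball_set n \<Longrightarrow> k (0, v) = x" "\<And>z. z \<in> {0..1} \<times> dball_set n \<Longrightarrow> ?h z = P (k z)"
    by (rule covering_space_lift_homotopy_metric[OF cov, where f = "\<lambda>_. x"]) (use a in auto)
  \<comment> \<open>The homotopy fixes u, so the track of u lifts a constant path. This carries the
    value x from time 0 to time 1.\<close>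
  have const: "k (t, u) = x" if t: "t \<in> {0..1}" for t
  proof (rule covering_space_lift_unique[OF cov, where f = "\<lambda>_. P x" and T = "{0..1::real}" and a = 0
        and ?g1.0 = "\<lambda>t. k (t, u)" and ?g2.0 = "\<lambda>_. x" and x = t])
    show "continuous_on {0..1} (\<lambda>t. k (t, u))"
      by (rule continuous_on_compose2[OF k(1)]) (use a in \<open>auto intro!: continuous_intros\<close>)
    show "P x = P (k (t, u))" if "t \<in> {0..1}" for t
    proof -
      have "(\<lambda>i. (1 - t) * u i + t * u i) = u" by (auto simp: algebra_simps)
      then show ?thesis using k(4)[of "(t, u)"] that a by simp
    qed
    show "P x = P x" if "t \<in> {0..1}" for t by simp
  qed (use k a covering_space_imp_surjective[OF cov] t in auto)
  show thesis
  proof (rule that[of "\<lambda>v. k (1, v)"])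
    show "continuous_on (dball_set n) (\<lambda>v. k (1, v))"
      by (rule continuous_on_compose2[OF k(1)]) (auto intro!: continuous_intros)
    show "P (k (1, v)) = \<phi> v" if "v \<in> dball_set n" for v
      using k(4)[of "(1, v)"] that by simp
  qed (use k const[of 1] in auto)
qed

text \<open>Free null-homotopies are enough to fill balls. Including n = 0 and n = 1 lets cells of
  every dimension be attached by one argument.\<close>

definition null_spheres :: "nat \<Rightarrow> 'v::topological_space set \<Rightarrow> bool" where
  "null_spheres n C \<longleftrightarrow> (\<forall>f. continuous_on (Sph n) f \<and> f ` Sph n \<subseteq> C \<longrightarrow>
     (\<exists>K c. continuous_on ({0..1::real} \<times> Sph n) K \<and> K ` ({0..1} \<times> Sph n) \<subseteq> C \<and>
        (\<forall>x\<in>Sph n. K (0, x) = f x \<and> K (1, x) = c)))"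

lemma null_spheres_0:
  assumes "path_connected C" shows "null_spheres 0 C"
  unfolding null_spheres_def
proof (intro allI impI)
  fix f :: "(nat \<Rightarrow> real) \<Rightarrow> 'a" assume f: "continuous_on (Sph 0) f \<and> f ` Sph 0 \<subseteq> C"
  define p m :: "nat \<Rightarrow> real" where "p = (\<lambda>i. if i = 0 then 1 else 0)" and "m = (\<lambda>i. if i = 0 then -1 else 0)"
  have S0: "Sph 0 = {p, m}"
    by (auto simp: Sph_def p_def m_def fun_eq_iff power2_eq_1_iff)
  then obtain g where g: "path g" "path_image g \<subseteq> C" "pathstart g = f m" "pathfinish g = f p"
    using assms f unfolding path_connected_def by (metis image_subset_iff insertI1 insertI2)
  \<comment> \<open>One of the two image points rests while the other travels to it along the
    path.\<close>
  let ?K = "\<lambda>(t, x). if x = p then f p else g t"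
  have pm: "p \<noteq> m" by (auto simp: p_def m_def fun_eq_iff)
  have "continuous_on ({0..1} \<times> {p} \<union> {0..1} \<times> {m}) ?K"
  proof (rule continuous_on_closed_Un)
    show "continuous_on ({0..1} \<times> {p}) ?K"
      by (rule continuous_on_eq[of _ "\<lambda>_. f p"]) (auto intro: continuous_intros)
    have "continuous_on ({0..1} \<times> {m}) (\<lambda>z. g (fst z))"
      using g(1) unfolding path_def by (rule continuous_on_compose2) (auto intro!: continuous_intros)
    then show "continuous_on ({0..1} \<times> {m}) ?K"
      by (rule continuous_on_eq) (use pm in auto)
  qed (auto intro: closed_Times)
  moreover have "{0..1} \<times> {p} \<union> {0..1} \<times> {m} = {0..1::real} \<times> Sph 0" by (auto simp: S0)
  moreover have "?K ` ({0..1} \<times> Sph 0) \<subseteq> C" using f g by (auto simp: S0 path_image_def)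
  moreover have "\<forall>x\<in>Sph 0. ?K (0, x) = f x \<and> ?K (1, x) = f p"
    using g pm by (auto simp: S0 pathstart_def pathfinish_def)
  ultimately show "\<exists>K c. continuous_on ({0..1::real} \<times> Sph 0) K \<and> K ` ({0..1} \<times> Sph 0) \<subseteq> C \<and>
        (\<forall>x\<in>Sph 0. K (0, x) = f x \<and> K (1, x) = c)" by metis
qed

text \<open>Coordinates identify \<open>Sph 1\<close> with the complex unit circle, where simple
  connectedness is characterised by homotopies of circle maps.\<close>

lemma null_spheres_1:
  fixes C :: "'v::real_normed_vector set"
  assumes "simply_connected C" shows "null_spheres 1 C"
  unfolding null_spheres_def
proof (intro allI impI)
  fix f :: "(nat \<Rightarrow> real) \<Rightarrow> 'v" assume f: "continuous_on (Sph 1) f \<and> f ` Sph 1 \<subseteq> C"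
  define e :: "complex \<Rightarrow> nat \<Rightarrow> real" where "e = (\<lambda>z i. if i = 0 then Re z else if i = 1 then Im z else 0)"
  define d :: "(nat \<Rightarrow> real) \<Rightarrow> complex" where "d = (\<lambda>x. Complex (x 0) (x 1))"
  have sum1: "(\<Sum>i\<le>1. x i ^ 2) = x 0 ^ 2 + x (1::nat) ^ 2" for x :: "nat \<Rightarrow> real"
    by (simp add: numeral_2_eq_2[symmetric] atMost_Suc)
  have e: "e z \<in> Sph 1" if "z \<in> sphere 0 1" for z
    using that by (auto simp: Sph_def e_def sum1 cmod_def)
  have d: "d x \<in> sphere 0 1" "e (d x) = x" if "x \<in> Sph 1" for x
    using that by (auto simp: Sph_def sum1 cmod_def d_def e_def fun_eq_iff)
  have ce: "continuous_on (sphere 0 1) e"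
  proof (rule continuous_on_coordinatewise_then_product)
    show "continuous_on (sphere 0 1) (\<lambda>z. e z i)" for i
      unfolding e_def by (cases "i = 0"; cases "i = 1") (auto intro!: continuous_intros)
  qed
  have cd: "continuous_on A d" for A
    unfolding d_def continuous_on_def Complex_eq
    by (subst continuous_on_def[symmetric]) (intro continuous_intros)
  have fe: "continuous_on (sphere 0 1) (f \<circ> e)" "f \<circ> e \<in> sphere 0 1 \<rightarrow> C"
    using f e by (auto simp: o_def image_subset_iff intro!: continuous_on_compose2[OF _ ce, of "Sph 1" f])
  define c where "c = (f \<circ> e) 1"
  have c: "c \<in> C" using fe(2) unfolding c_def by (rule Pi_mem) simp
  have "homotopic_with_canon (\<lambda>h. True) (sphere 0 1) C (f \<circ> e) (\<lambda>_. c)"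
    by (rule simply_connected_eq_homotopic_circlemaps1[OF assms fe]) (use c in auto)
  then obtain H where H: "continuous_on ({0..1::real} \<times> sphere 0 1) H" "H \<in> {0..1} \<times> sphere 0 1 \<rightarrow> C"
    "\<forall>z\<in>sphere 0 1. H (0, z) = f (e z)" "\<forall>z\<in>sphere 0 1. H (1, z) = c"
    by (auto simp: homotopic_with)
  let ?K = "\<lambda>z. H (fst z, d (snd z))"
  have "continuous_on ({0..1} \<times> Sph 1) ?K"
    by (rule continuous_on_compose2[OF H(1)])
      (use d in \<open>auto intro!: continuous_intros continuous_on_compose2[OF cd[of UNIV]]\<close>)
  moreover have "?K ` ({0..1} \<times> Sph 1) \<subseteq> C"
  proof -
    have "H (t, d x) \<in> C" if "t \<in> {0..1}" "x \<in> Sph 1" for t x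
      using H(2) d(1)[OF that(2)] that(1) by (intro Pi_mem[of _ _ "\<lambda>_. C"]) auto
    then show ?thesis by auto
  qed
  moreover have "\<forall>x\<in>Sph 1. ?K (0, x) = f x \<and> ?K (1, x) = c" using H d by auto
  ultimately show "\<exists>K c. continuous_on ({0..1::real} \<times> Sph 1) K \<and> K ` ({0..1} \<times> Sph 1) \<subseteq> C \<and>
        (\<forall>x\<in>Sph 1. K (0, x) = f x \<and> K (1, x) = c)" by blast
qed

context embedded
begin

text \<open>The projected sphere is contracted in \<open>B\<close> and the homotopy is lifted. The
  last stage of the lift covers a constant map on a connected set, so it is constant as
  well.\<close>

lemma null_spheres_ge_2:
  assumes asph: "aspherical B" and n: "n \<ge> 2"
  shows "null_spheres n C"
  unfolding null_spheres_def
proof (intro allI impI)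
  fix f :: "(nat \<Rightarrow> real) \<Rightarrow> 'v" assume f: "continuous_on (Sph n) f \<and> f ` Sph n \<subseteq> C"
  have cB: "continuous_map (top_of_set C) B (gB \<circ> P)"
  proof (rule continuous_map_compose[OF _ cont_gB])
    show "continuous_map (top_of_set C) (top_of_set S) P"
      using cont_P P_in by (auto simp: continuous_map_in_subtopology)
  qed
  have "continuous_map (nsphere n) (top_of_set C) f"
    using f by (simp add: continuous_map_nsphere)
  then have "continuous_map (nsphere n) B (gB \<circ> P \<circ> f)" using cB by (rule continuous_map_compose)
  then obtain b where "homotopic_with (\<lambda>_. True) (nsphere n) B (gB \<circ> P \<circ> f) (\<lambda>_. b)"
    using asph n unfolding aspherical_def by blast
  then obtain h where h: "continuous_map (prod_topology (top_of_set {0..1::real}) (nsphere n)) B h"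
    "\<And>x. h (0, x) = (gB \<circ> P \<circ> f) x" "\<And>x. h (1, x) = b"
    unfolding homotopic_with_def by auto
  have "continuous_map (prod_topology (top_of_set {0..1::real}) (nsphere n)) (top_of_set S) (eB \<circ> h)"
    using h(1) cont_eB by (rule continuous_map_compose)
  then have eh: "continuous_on ({0..1} \<times> Sph n) (eB \<circ> h)" "eB \<circ> h \<in> ({0..1} \<times> Sph n) \<rightarrow> S"
    by (auto simp: prod_topology_nsphere continuous_map_in_subtopology)
  have eh0: "(eB \<circ> h) (0, x) = P (f x)" if "x \<in> Sph n" for x
    using f that P_in h(2) by auto
  obtain k where k: "continuous_on ({0..1} \<times> Sph n) k" "k \<in> ({0..1} \<times> Sph n) \<rightarrow> C"
    "\<And>x. x \<in> Sph n \<Longrightarrow> k (0, x) = f x" "\<And>z. z \<in> {0..1} \<times> Sph n \<Longrightarrow> (eB \<circ> h) z = P (k z)"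
    by (rule covering_space_lift_homotopy_metric[OF covering_P eh eh0]) (use f in auto)
  obtain x0 where x0: "x0 \<in> Sph n" using in_topspace_nsphere by blast
  have "k (1, x) = k (1, x0)" if x: "x \<in> Sph n" for x
  proof (rule covering_space_lift_unique[OF covering_P, where f = "\<lambda>_. eB b" and T = "Sph n" and a = x0
        and ?g1.0 = "\<lambda>x. k (1, x)" and ?g2.0 = "\<lambda>_. k (1, x0)" and x = x])
    show "continuous_on (Sph n) (\<lambda>x. k (1, x))"
      by (rule continuous_on_compose2[OF k(1)]) (auto intro!: continuous_intros)
    show "connected (Sph n)" using n by (intro connected_Sph) auto
    show eq: "eB b = P (k (1, x))" if "x \<in> Sph n" for x
      using k(4)[of "(1, x)"] that h(3) by auto
    show "eB b = P (k (1, x0))" if "x \<in> Sph n" for x by (rule eq[OF x0])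
    show "(\<lambda>_. eB b) \<in> Sph n \<rightarrow> S" proof -
      have "k (1, x0) \<in> C" using k(2) x0 by auto
      then show ?thesis using P_in eq[OF x0] by auto
    qed
  qed (use k x0 x in auto)
  then show "\<exists>K c. continuous_on ({0..1::real} \<times> Sph n) K \<and> K ` ({0..1} \<times> Sph n) \<subseteq> C \<and>
        (\<forall>x\<in>Sph n. K (0, x) = f x \<and> K (1, x) = c)"
    using k by (intro exI[of _ k] exI[of _ "k (1, x0)"]) (auto simp: image_subset_iff Pi_iff)
qed

lemma null_spheres_C:
  assumes "aspherical B" "simply_connected_sp E"
  shows "null_spheres n C"
proof -
  consider "n = 0" | "n = 1" | "n \<ge> 2" by linarith
  then show ?thesis
    using null_spheres_0[OF path_connected_C] null_spheres_1[OF simply_connected_C[OF assms(2)]]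
      null_spheres_ge_2[OF assms(1)] by cases auto
qed

end

section \<open>Contracting the total space cell by cell\<close>

text \<open>Bottom, top and side of the prism form an n-sphere, on which \<Phi>, the constant
  \<open>y0\<close> and \<open>b\<close> fit together. Filling the prism amounts to contracting this
  sphere in \<open>C\<close>.\<close>

lemma prism_extension:
  fixes C :: "'v::metric_space set"
  assumes NS: "null_spheres n C" and y0: "y0 \<in> C"
    and Phi: "continuous_on (dball_set n) \<Phi>" "\<Phi> ` dball_set n \<subseteq> C"
    and b: "continuous_on ({0..1} \<times> bsphere_set n) b" "b ` ({0..1} \<times> bsphere_set n) \<subseteq> C"
      "\<And>u. u \<in> bsphere_set n \<Longrightarrow> b (0, u) = \<Phi> u" "\<And>u. u \<in> bsphere_set n \<Longrightarrow> b (1, u) = y0"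
  obtains G :: "real \<times> (nat \<Rightarrow> real) \<Rightarrow> 'v" where
    "continuous_on ({0..1} \<times> dball_set n) G" "G ` ({0..1} \<times> dball_set n) \<subseteq> C"
    "\<And>u. u \<in> dball_set n \<Longrightarrow> G (0, u) = \<Phi> u" "\<And>u. u \<in> dball_set n \<Longrightarrow> G (1, u) = y0"
    "\<And>t u. t \<in> {0..1} \<Longrightarrow> u \<in> bsphere_set n \<Longrightarrow> G (t, u) = b (t, u)"
proof -
  let ?D = "dball_set n" and ?B = "bsphere_set n" and ?I = "{0..1::real}"
  define nn :: "(nat \<Rightarrow> real) \<Rightarrow> real" where "nn u = L2_set u {..<n}" for u
  have nn0: "0 \<le> nn u" for u by (simp add: nn_def L2_set_nonneg)
  have nn_sq: "nn u ^ 2 = (\<Sum>i<n. u i ^ 2)" for u by (simp add: nn_def L2_set_def sum_nonneg)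
  have D: "u \<in> ?D \<longleftrightarrow> (\<forall>i\<ge>n. u i = 0) \<and> nn u \<le> 1" for u
    by (simp add: dball_set_def nn_def L2_set_def)
  have B: "u \<in> ?B \<longleftrightarrow> (\<forall>i\<ge>n. u i = 0) \<and> nn u = 1" for u
    by (simp add: bsphere_set_def nn_def L2_set_def)
  have nn_scale: "nn (\<lambda>i. if i < n then u i / r else w i) = nn u / r" if "r > 0" for u w and r :: real
  proof -
    have "nn (\<lambda>i. if i < n then u i / r else w i) = L2_set (\<lambda>i. u i * (1 / r)) {..<n}"
      unfolding nn_def by (intro L2_set_cong) auto
    also have "\<dots> = nn u * (1 / r)" unfolding nn_def using that by (intro L2_set_left_distrib[symmetric]) auto
    finally show ?thesis by simp
  qed
  have nn_cont: "continuous_on A nn" "continuous_on A' (\<lambda>z. nn (snd z))" for A and A' :: "(real \<times> (nat \<Rightarrow> real)) set"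
    unfolding nn_def L2_set_def by (intro continuous_intros)+
  have BD: "?B \<subseteq> ?D" by (auto simp: dball_split)
  \<comment> \<open>The three prescriptions glued on the boundary of the prism; by the hypotheses on
    \<open>b\<close> they agree along both rims.\<close>
  define F0 where "F0 = (\<lambda>(t::real, u). if t \<le> 0 then \<Phi> u else if t \<ge> 1 then y0 else b (t, u))"
  define X0 where "X0 = {0} \<times> ?D \<union> ({1} \<times> ?D \<union> ?I \<times> ?B)"
  have F0_cont: "continuous_on X0 F0"
    unfolding X0_def
  proof (intro continuous_on_closed_Un)
    have "continuous_on ({0::real} \<times> ?D) (\<lambda>z. \<Phi> (snd z))"
      by (rule continuous_on_compose2[OF Phi(1)]) (auto intro!: continuous_intros)
    then show "continuous_on ({0} \<times> ?D) F0" by (rule continuous_on_eq) (auto simp: F0_def)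
    show "continuous_on ({1} \<times> ?D) F0"
      by (rule continuous_on_eq[of _ "\<lambda>_. y0"]) (auto simp: F0_def)
    show "continuous_on (?I \<times> ?B) F0"
      using b(1) by (rule continuous_on_eq) (auto simp: F0_def b(3,4) order_antisym_conv)
  qed (auto intro!: closed_Times closed_Un closed_dball closed_bsphere)
  have F0_C: "F0 z \<in> C" if "z \<in> X0" for z
    using that y0 Phi(2) b(2) BD unfolding X0_def F0_def by (auto simp: image_subset_iff)
  \<comment> \<open>The gauge whose unit sphere is the boundary of the cylinder of height [-1,1]
    over the ball, with coordinate n as height. Dividing by it projects the round sphere radially
    onto that boundary, and \<open>\<rho>\<close> then rescales the height to [0,1].\<close>
  define M where "M w = max \<bar>w n\<bar> (nn w)" for w
  have Sph: "w \<in> Sph n \<longleftrightarrow> (\<forall>i>n. w i = 0) \<and> nn w ^ 2 + w n ^ 2 = 1" for w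
    by (simp add: Sph_def nn_sq lessThan_Suc_atMost[symmetric] Suc_le_eq)
  have Mpos: "M w > 0" if "w \<in> Sph n" for w
  proof (rule ccontr)
    assume "\<not> M w > 0"
    then have "w n = 0" "nn w = 0" using nn0[of w] by (auto simp: M_def max_def split: if_splits)
    then show False using that by (simp add: Sph)
  qed
  define \<rho> where "\<rho> w = ((1 + w n / M w) / 2, \<lambda>i. if i < n then w i / M w else 0)" for w
  have rho_cont: "continuous_on (Sph n) \<rho>"
  proof -
    have Mc: "continuous_on (Sph n) M" unfolding M_def by (intro continuous_intros nn_cont)
    have "continuous_on (Sph n) (\<lambda>w. if i < n then w i / M w else 0)" for i
      using Mpos by (cases "i < n") (force intro!: continuous_intros Mc)+
    then show ?thesis unfolding \<rho>_def
      using Mpos by (intro continuous_on_Pair continuous_on_coordinatewise_then_product) (force intro!: continuous_intros Mc)+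
  qed
  have rho_X0: "\<rho> w \<in> X0" if w: "w \<in> Sph n" for w
  proof -
    note M = Mpos[OF w]
    let ?u = "\<lambda>i. if i < n then w i / M w else 0"
    have nu: "nn ?u = nn w / M w" by (rule nn_scale[OF M])
    consider "M w = nn w" | "M w = \<bar>w n\<bar>" unfolding M_def max_def by presburger
    then show ?thesis
    proof cases
      case 1
      have "?u \<in> ?B" using M nu 1 by (simp add: B)
      moreover have "\<bar>w n / M w\<bar> \<le> 1" using M by (simp add: abs_divide) (simp add: M_def)
      then have "w n / M w \<le> 1" "- 1 \<le> w n / M w" unfolding abs_le_iff by linarith+
      ultimately show ?thesis unfolding \<rho>_def X0_def by auto
    next
      case 2
      have "nn w / M w \<le> 1" using M by simp (simp add: M_def)
      then have "?u \<in> ?D" using nu by (simp add: D)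
      moreover have "w n / M w = 1 \<or> w n / M w = -1" using M 2 by (auto simp: abs_if field_simps split: if_splits)
      ultimately show ?thesis unfolding \<rho>_def X0_def by auto
    qed
  qed
  have "continuous_on (Sph n) (\<lambda>w. F0 (\<rho> w))"
    by (rule continuous_on_compose2[OF F0_cont rho_cont]) (use rho_X0 in auto)
  moreover have "(\<lambda>w. F0 (\<rho> w)) ` Sph n \<subseteq> C" using F0_C[OF rho_X0] by blast
  ultimately have "\<exists>K c. continuous_on (?I \<times> Sph n) K \<and> K ` (?I \<times> Sph n) \<subseteq> C \<and>
        (\<forall>w\<in>Sph n. K (0, w) = F0 (\<rho> w) \<and> K (1, w) = c)"
    using NS[unfolded null_spheres_def, THEN spec, of "\<lambda>w. F0 (\<rho> w)"] by simp
  then obtain K c where K: "continuous_on (?I \<times> Sph n) K" "K ` (?I \<times> Sph n) \<subseteq> C"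
    "\<And>w. w \<in> Sph n \<Longrightarrow> K (0, w) = F0 (\<rho> w)" "\<And>w. w \<in> Sph n \<Longrightarrow> K (1, w) = c"
    by auto
  \<comment> \<open>The prism is a ball for the gauge \<open>N\<close>: the null-homotopy of the boundary sphere is spread over the
    shell \<open>N \<ge> 1/2\<close>, and its constant end fills the core.\<close>
  define N where "N z = max \<bar>2 * fst z - 1\<bar> (nn (snd z))" for z :: "real \<times> (nat \<Rightarrow> real)"
  define R where "R z = sqrt ((2 * fst z - 1)^2 + nn (snd z) ^ 2)" for z :: "real \<times> (nat \<Rightarrow> real)"
  \<comment> \<open>The direction of z seen from the centre of the prism, normalised to the round
    sphere. On the boundary of the prism it is a right inverse of \<open>\<rho>\<close>, which is
    shown in \<open>G_bd\<close>.\<close>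
  define dir where "dir z = (\<lambda>i. if i < n then snd z i / R z else if i = n then (2 * fst z - 1) / R z else 0)"
    for z :: "real \<times> (nat \<Rightarrow> real)"
  have N_cont: "continuous_on A N" for A unfolding N_def by (intro continuous_intros nn_cont)
  have R_cont: "continuous_on A R" for A unfolding R_def by (intro continuous_intros nn_cont)
  have Rpos: "R z > 0" if "N z \<ge> 1/2" for z
  proof -
    have "2 * fst z - 1 \<noteq> 0 \<or> nn (snd z) \<noteq> 0" using that by (auto simp: N_def max_def split: if_splits)
    then show ?thesis unfolding R_def by (auto simp: sum_power2_gt_zero_iff)
  qed
  have dir_n: "dir z n = (2 * fst z - 1) / R z" for z by (simp add: dir_def)
  have dir_nn: "nn (dir z) = nn (snd z) / R z" if "N z \<ge> 1/2" for z
    unfolding dir_def by (rule nn_scale[OF Rpos[OF that]])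
  have dir_Sph: "dir z \<in> Sph n" if z: "N z \<ge> 1/2" for z
  proof -
    have "nn (dir z) ^ 2 + dir z n ^ 2 = ((2 * fst z - 1)^2 + nn (snd z) ^ 2) / R z ^ 2"
      by (simp add: dir_n dir_nn[OF z] power_divide add_divide_distrib)
    also have "(2 * fst z - 1)^2 + nn (snd z) ^ 2 = R z ^ 2" by (simp add: R_def)
    finally have "nn (dir z) ^ 2 + dir z n ^ 2 = 1" using Rpos[OF z] by simp
    then show ?thesis by (simp add: Sph dir_def)
  qed
  let ?A = "(?I \<times> ?D) \<inter> {z. N z \<le> 1/2}" and ?A' = "(?I \<times> ?D) \<inter> {z. N z \<ge> 1/2}"
  have dir_cont: "continuous_on ?A' dir"
  proof (rule continuous_on_coordinatewise_then_product)
    show "continuous_on ?A' (\<lambda>z. dir z i)" for i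
      unfolding dir_def using Rpos
      by (cases "i < n"; cases "i = n") (force intro!: continuous_intros R_cont)+
  qed
  \<comment> \<open>The homotopy time 2 - 2 N z is 0 on the boundary, where the prescribed values
    must appear, and 1 on the shell N = 1/2, where it meets the constant core.\<close>
  define G where "G z = (if N z \<le> 1/2 then c else K (2 - 2 * N z, dir z))" for z
  have N1: "N z \<le> 1" if "z \<in> ?I \<times> ?D" for z using that by (auto simp: N_def D abs_le_iff)
  have cK: "continuous_on ?A' (\<lambda>z. K (2 - 2 * N z, dir z))"
  proof (rule continuous_on_compose2[OF K(1)])
    show "continuous_on ?A' (\<lambda>z. (2 - 2 * N z, dir z))"
      by (intro continuous_on_Pair continuous_on_diff continuous_on_mult continuous_on_const N_cont dir_cont)
  qed (use N1 dir_Sph in auto)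
  have "continuous_on (?A \<union> ?A') G"
  proof (rule continuous_on_closed_Un)
    have cl: "closed (?I \<times> ?D)" by (intro closed_Times closed_dball) auto
    show "closed ?A" "closed ?A'"
      using cl by (auto intro!: closed_Int closed_Collect_le N_cont continuous_intros)
    show "continuous_on ?A G" by (rule continuous_on_eq[of _ "\<lambda>_. c"]) (auto simp: G_def)
    show "continuous_on ?A' G"
    proof (rule continuous_on_eq[OF cK])
      fix z assume z: "z \<in> ?A'"
      show "K (2 - 2 * N z, dir z) = G z"
      proof (cases "N z \<le> 1/2")
        case True
        then have "2 - 2 * N z = 1" using z by auto
        then have "K (2 - 2 * N z, dir z) = c" using K(4)[OF dir_Sph[of z]] z by simp
        then show ?thesis using True by (simp add: G_def)
      qed (simp add: G_def)
    qed
  qed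
  moreover have "?A \<union> ?A' = ?I \<times> ?D" by auto
  ultimately have G_cont: "continuous_on (?I \<times> ?D) G" by simp
  have G_C: "G z \<in> C" if z: "z \<in> ?I \<times> ?D" for z
  proof (cases "N z \<le> 1/2")
    case True
    obtain w where "w \<in> Sph n" using in_topspace_nsphere by blast
    then have "c = K (1, w)" "(1, w) \<in> ?I \<times> Sph n" using K(4) by auto
    then have "c \<in> C" using K(2) by blast
    then show ?thesis using True by (simp add: G_def)
  next
    case False
    then have "(2 - 2 * N z, dir z) \<in> ?I \<times> Sph n" using N1[OF z] dir_Sph[of z] by auto
    then show ?thesis using False K(2) by (auto simp: G_def)
  qed
  have G_bd: "G z = F0 z" if z: "z \<in> ?I \<times> ?D" and N: "N z = 1" for z
  proof -
    have N': "N z \<ge> 1/2" using N by simp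
    have R: "R z > 0" using Rpos[OF N'] .
    have "M (dir z) = max (\<bar>2 * fst z - 1\<bar> / R z) (nn (snd z) / R z)"
      using R by (simp add: M_def dir_nn[OF N'] dir_n abs_divide)
    also have "\<dots> = N z / R z" using R by (auto simp: N_def max_def divide_le_cancel)
    finally have M: "M (dir z) = 1 / R z" using N by simp
    have "\<rho> (dir z) = z"
    proof (rule prod_eqI)
      show "fst (\<rho> (dir z)) = fst z" using R by (simp add: \<rho>_def M dir_n)
      show "snd (\<rho> (dir z)) = snd z"
        using R z by (auto simp: \<rho>_def M fun_eq_iff D) (auto simp: dir_def)
    qed
    then show ?thesis using N K(3)[OF dir_Sph[OF N']] by (simp add: G_def)
  qed
  show thesis
  proof (rule that[OF G_cont])
    show "G ` (?I \<times> ?D) \<subseteq> C" using G_C by blast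
    show "G (0, u) = \<Phi> u" if "u \<in> ?D" for u
      using G_bd[of "(0, u)"] that by (auto simp: N_def D F0_def)
    show "G (1, u) = y0" if "u \<in> ?D" for u
      using G_bd[of "(1, u)"] that by (auto simp: N_def D F0_def)
    show "G (t, u) = b (t, u)" if "t \<in> ?I" "u \<in> ?B" for t u
    proof -
      have "N (t, u) = 1" using that by (auto simp: N_def B abs_le_iff)
      then have "G (t, u) = F0 (t, u)" using G_bd[of "(t, u)"] that BD by auto
      then show ?thesis using that b(3,4) by (auto simp: F0_def order_antisym_conv)
    qed
  qed
qed

text \<open>A sequence of values that stays away from the limit has no subsequence converging to it.
  The criterion suits lifted cells, where compactness of the ball makes cell coordinates converge
  only along a subsequence.\<close>

lemma continuous_on_subseqI:
  fixes f :: "'a::metric_space \<Rightarrow> 'b::metric_space"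
  assumes "\<And>x y. y \<in> S \<Longrightarrow> (\<And>n. x n \<in> S) \<Longrightarrow> x \<longlonglongrightarrow> y \<Longrightarrow> \<exists>r. strict_mono (r::nat \<Rightarrow> nat) \<and> (\<lambda>n. f (x (r n))) \<longlonglongrightarrow> f y"
  shows "continuous_on S f"
  unfolding continuous_on_sequentially
proof (intro allI ballI impI)
  fix x a assume a: "a \<in> S" and x: "(\<forall>n. x n \<in> S) \<and> x \<longlonglongrightarrow> a"
  show "(f \<circ> x) \<longlonglongrightarrow> f a"
  proof (rule ccontr)
    assume "\<not> (f \<circ> x) \<longlonglongrightarrow> f a"
    then obtain e where e: "e > 0" "\<not> (\<forall>\<^sub>F n in sequentially. dist (f (x n)) (f a) < e)"
      unfolding tendsto_iff by auto
    then have "infinite {n. dist (f (x n)) (f a) \<ge> e}"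
      by (simp add: eventually_cofinite[symmetric] cofinite_eq_sequentially not_less[symmetric])
    then obtain s :: "nat \<Rightarrow> nat" where s: "strict_mono s" "\<And>n. dist (f (x (s n))) (f a) \<ge> e"
      using infinite_enumerate by (metis mem_Collect_eq)
    have "(\<lambda>n. x (s n)) \<longlonglongrightarrow> a" using LIMSEQ_subseq_LIMSEQ[OF conjunct2[OF x] s(1)] by (simp add: o_def)
    then obtain r where r: "strict_mono r" "(\<lambda>n. f (x (s (r n)))) \<longlonglongrightarrow> f a"
      using assms[OF a, of "\<lambda>n. x (s n)"] x by auto
    then have "\<forall>\<^sub>F n in sequentially. dist (f (x (s (r n)))) (f a) < e" using e(1) by (auto simp: tendsto_iff)
    then obtain n where "dist (f (x (s (r n)))) (f a) < e" by (auto simp: eventually_sequentially)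
    then show False using s(2)[of "r n"] by linarith
  qed
qed

text \<open>Only the preimage of \<open>K\<close> is moved, but it may move through all of
  \<open>C\<close>. This is what makes an induction over cells possible: the preimage of a
  subcomplex, a discrete fibre for instance, is in general not contractible in itself.\<close>

definition contracts :: "'v::metric_space set \<Rightarrow> ('v \<Rightarrow> 'w) \<Rightarrow> 'v \<Rightarrow> 'w set \<Rightarrow> (real \<times> 'v \<Rightarrow> 'v) \<Rightarrow> bool" where
  "contracts C P y0 K g \<longleftrightarrow> continuous_on ({0..1} \<times> (C \<inter> P -` K)) g \<and> g ` ({0..1} \<times> (C \<inter> P -` K)) \<subseteq> C \<and>
     (\<forall>x\<in>C \<inter> P -` K. g (0, x) = x \<and> g (1, x) = y0)"

text \<open>The preimage of the closed cell consists of the lifts of \<phi>, one for each point over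
  the centre of the cell. On each lift the contraction is already given over the boundary sphere and
  extends by \<open>prism_extension\<close>.\<close>

lemma contracts_attach_cell:
  fixes P :: "'v::real_normed_vector \<Rightarrow> 'w::real_normed_vector"
  assumes cov: "covering_space C P S" and NS: "null_spheres n C" and y0: "y0 \<in> C"
    and K: "closed K"
    and phi: "continuous_on (dball_set n) \<phi>" "\<phi> ` dball_set n \<subseteq> S" "inj_on \<phi> (obball_set n)"
      "\<phi> ` bsphere_set n \<subseteq> K" "\<phi> ` obball_set n \<inter> K = {}"
    and g: "contracts C P y0 K g"
  shows "\<exists>g'. contracts C P y0 (K \<union> \<phi> ` dball_set n) g'"
proof -
  let ?D = "dball_set n" and ?I = "{0..1::real}" and ?z = "\<lambda>_::nat. 0::real"
  define fib where "fib = {a \<in> C. P a = \<phi> ?z}"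
  have gc: "continuous_on (?I \<times> (C \<inter> P -` K)) g" and gC: "g ` (?I \<times> (C \<inter> P -` K)) \<subseteq> C"
    and g01: "\<And>x. x \<in> C \<Longrightarrow> P x \<in> K \<Longrightarrow> g (0, x) = x \<and> g (1, x) = y0"
    using g by (auto simp: contracts_def)
  have "\<exists>\<Phi>. continuous_on ?D \<Phi> \<and> \<Phi> ` ?D \<subseteq> C \<and> (\<forall>v\<in>?D. P (\<Phi> v) = \<phi> v) \<and> \<Phi> ?z = a"
    if "a \<in> fib" for a
    by (rule lift_dball[OF cov phi(1,2) zero_in_dball[of n], of a]) (use that in \<open>auto simp: fib_def\<close>)
  then have "\<exists>L. \<forall>a\<in>fib. continuous_on ?D (L a) \<and> L a ` ?D \<subseteq> C \<and> (\<forall>v\<in>?D. P (L a v) = \<phi> v) \<and> L a ?z = a"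
    by (intro bchoice) blast
  then obtain L where "\<forall>a\<in>fib. continuous_on ?D (L a) \<and> L a ` ?D \<subseteq> C \<and> (\<forall>v\<in>?D. P (L a v) = \<phi> v) \<and> L a ?z = a"
    by blast
  then have L: "\<And>a. a \<in> fib \<Longrightarrow> continuous_on ?D (L a)" "\<And>a v. a \<in> fib \<Longrightarrow> v \<in> ?D \<Longrightarrow> L a v \<in> C"
    "\<And>a v. a \<in> fib \<Longrightarrow> v \<in> ?D \<Longrightarrow> P (L a v) = \<phi> v" "\<And>a. a \<in> fib \<Longrightarrow> L a ?z = a"
    by (auto simp: image_subset_iff)
  have uniq: "\<Phi> v = L a v" if "a \<in> fib" "continuous_on ?D \<Phi>" "\<Phi> ` ?D \<subseteq> C" "\<And>v. v \<in> ?D \<Longrightarrow> P (\<Phi> v) = \<phi> v"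
    "u \<in> ?D" "\<Phi> u = L a u" "v \<in> ?D" for \<Phi> a u v
    by (rule covering_space_lift_unique[OF cov, where f = \<phi> and T = ?D and a = u])
      (use that L phi connected_dball in auto)
  \<comment> \<open>The lift of \<phi> through x is the one indexed by its own value at the centre
    of the ball.\<close>
  have lifts: "\<exists>a\<in>fib. L a u = x" if u: "u \<in> ?D" and x: "x \<in> C" "P x = \<phi> u" for u x
  proof -
    obtain \<Phi> where Phi: "continuous_on ?D \<Phi>" "\<Phi> ` ?D \<subseteq> C" "\<And>v. v \<in> ?D \<Longrightarrow> P (\<Phi> v) = \<phi> v" "\<Phi> u = x"
      by (rule lift_dball[OF cov phi(1,2) u x(1) x(2)[symmetric]]) blast
    let ?a = "\<Phi> ?z"
    have a: "?a \<in> fib" using Phi zero_in_dball[of n] by (auto simp: fib_def)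
    have "\<Phi> u = L ?a u" by (rule uniq[OF a Phi(1-3) zero_in_dball _ u]) (use L(4)[OF a] in auto)
    then show ?thesis using a Phi(4) by metis
  qed
  have bK: "L a u \<in> C \<inter> P -` K" if "a \<in> fib" "u \<in> bsphere_set n" for a u
    using L(2,3)[OF that(1)] that phi(4) by (auto simp: dball_split image_subset_iff)
  define isG where "isG a G \<longleftrightarrow> continuous_on (?I \<times> ?D) G \<and> G ` (?I \<times> ?D) \<subseteq> C \<and> (\<forall>u\<in>?D. G (0, u) = L a u \<and> G (1, u) = y0) \<and>
      (\<forall>t\<in>?I. \<forall>u\<in>bsphere_set n. G (t, u) = g (t, L a u))" for a and G :: "real \<times> (nat \<Rightarrow> real) \<Rightarrow> 'v"
  have "\<exists>G. isG a G" if a: "a \<in> fib" for a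
  proof -
    have "continuous_on (?I \<times> bsphere_set n) (\<lambda>z. L a (snd z))"
      by (rule continuous_on_compose2[OF L(1)[OF a]]) (auto intro!: continuous_intros simp: dball_split)
    then have c: "continuous_on (?I \<times> bsphere_set n) (\<lambda>z. g (fst z, L a (snd z)))"
      by (intro continuous_on_compose2[OF gc] continuous_intros) (use bK[OF a] in auto)
    have i: "(\<lambda>z. g (fst z, L a (snd z))) ` (?I \<times> bsphere_set n) \<subseteq> C"
    proof -
      have "(t, L a u) \<in> ?I \<times> (C \<inter> P -` K)" if "t \<in> ?I" "u \<in> bsphere_set n" for t u
        using bK[OF a that(2)] that by auto
      then show ?thesis using gC by (auto simp: image_subset_iff)
    qed
    show ?thesis unfolding isG_def
      by (rule prism_extension[OF NS y0 L(1)[OF a] _ c i]) (use L(2)[OF a] g01 bK[OF a] in auto)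
  qed
  then obtain G where "\<forall>a\<in>fib. isG a (G a)" using bchoice[of fib isG] by blast
  then have G: "\<And>a. a \<in> fib \<Longrightarrow> continuous_on (?I \<times> ?D) (G a)"
    "\<And>a t u. a \<in> fib \<Longrightarrow> t \<in> ?I \<Longrightarrow> u \<in> ?D \<Longrightarrow> G a (t, u) \<in> C"
    "\<And>a u. a \<in> fib \<Longrightarrow> u \<in> ?D \<Longrightarrow> G a (0, u) = L a u \<and> G a (1, u) = y0"
    "\<And>a t u. a \<in> fib \<Longrightarrow> t \<in> ?I \<Longrightarrow> u \<in> bsphere_set n \<Longrightarrow> G a (t, u) = g (t, L a u)"
    unfolding isG_def by (auto simp: image_subset_iff)
  \<comment> \<open>A point over the boundary may lie on several lifted cells. \<open>g'\<close>
    consults this choice only off the preimage of \<open>K\<close>, where cell and coordinate are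
    unique; that is the content of \<open>key\<close>.\<close>
  define sel where "sel x = (SOME au. fst au \<in> fib \<and> snd au \<in> ?D \<and> L (fst au) (snd au) = x)" for x
  define g' where "g' z = (if P (snd z) \<in> K then g z else G (fst (sel (snd z))) (fst z, snd (sel (snd z))))" for z
  have key: "g' (t, L a u) = G a (t, u)" if a: "a \<in> fib" and u: "u \<in> ?D" and t: "t \<in> ?I" for t a u
  proof (cases "P (L a u) \<in> K")
    case True
    then have "u \<notin> obball_set n" using L(3)[OF a u] phi(5) by auto
    then have "u \<in> bsphere_set n" using u by (auto simp: dball_split)
    then show ?thesis using True G(4)[OF a t] by (simp add: g'_def)
  next
    case False
    obtain a' u' where au: "sel (L a u) = (a', u')" by (cases "sel (L a u)")
    have "fst (sel (L a u)) \<in> fib \<and> snd (sel (L a u)) \<in> ?D \<and> L (fst (sel (L a u))) (snd (sel (L a u))) = L a u"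
      unfolding sel_def by (rule someI[of _ "(a, u)"]) (use a u in auto)
    then have s: "a' \<in> fib" "u' \<in> ?D" "L a' u' = L a u" using au by auto
    have phi_eq: "\<phi> u' = \<phi> u" using L(3)[OF a u] L(3)[OF s(1,2)] s(3) by simp
    have "\<phi> u \<notin> K" using False L(3)[OF a u] by simp
    then have "u \<in> obball_set n" "u' \<in> obball_set n"
      using u s(2) phi(4) phi_eq by (auto simp: dball_split image_subset_iff)
    then have "u' = u" using phi(3) phi_eq by (auto dest: inj_onD)
    have "L a' ?z = L a ?z"
      by (rule uniq[OF a L(1)[OF s(1)] _ _ u _ zero_in_dball]) (use L s \<open>u' = u\<close> in auto)
    then have "a' = a" using L(4) a s(1) by simp
    then show ?thesis using False \<open>u' = u\<close> au by (simp add: g'_def)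
  qed
  let ?Z = "?I \<times> (C \<inter> P -` (\<phi> ` ?D))" and ?W = "?I \<times> (C \<inter> P -` K)"
  have rep: "\<exists>a\<in>fib. \<exists>u\<in>?D. x = L a u" if "x \<in> C" "P x \<in> \<phi> ` ?D" for x
    using that lifts by fastforce
  \<comment> \<open>A convergent sequence in the preimage of the cell has a subsequence whose cell coordinates converge;
    it then eventually runs on one lift of \<open>\<phi>\<close>, because \<open>P\<close> is injective near the limit. No local
    finiteness of the lifted cells is needed.\<close>
  have cont_Z: "continuous_on ?Z g'"
  proof (rule continuous_on_subseqI)
    fix y and z :: "nat \<Rightarrow> real \<times> 'v" assume y: "y \<in> ?Z" and z: "\<And>k. z k \<in> ?Z" and lim: "z \<longlonglongrightarrow> y"
    have "\<exists>a u. a \<in> fib \<and> u \<in> ?D \<and> snd (z k) = L a u" for k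
      using rep[of "snd (z k)"] z[of k] by (auto simp: mem_Times_iff)
    then obtain a u where au: "\<And>k. a k \<in> fib" "\<And>k. u k \<in> ?D" "\<And>k. snd (z k) = L (a k) (u k)" by metis
    obtain u0 r where r: "u0 \<in> ?D" "strict_mono r" "(u \<circ> r) \<longlonglongrightarrow> u0"
      using compact_dball au(2) unfolding compact_def by metis
    have yC: "snd y \<in> C" and t_in: "fst y \<in> ?I" using y by (auto simp: mem_Times_iff)
    have zr: "(z \<circ> r) \<longlonglongrightarrow> y" using LIMSEQ_subseq_LIMSEQ[OF lim r(2)] .
    have sr: "(\<lambda>k. snd (z (r k))) \<longlonglongrightarrow> snd y" and fr: "(\<lambda>k. fst (z (r k))) \<longlonglongrightarrow> fst y"
      using tendsto_snd[OF zr] tendsto_fst[OF zr] by (simp_all add: o_def)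
    have zC: "snd (z k) \<in> C" for k using z[of k] by (auto simp: mem_Times_iff)
    have "(\<lambda>k. P (snd (z (r k)))) \<longlonglongrightarrow> P (snd y)"
      by (rule continuous_on_tendsto_compose[OF covering_space_imp_continuous[OF cov] sr yC]) (use zC in auto)
    moreover have "(\<lambda>k. \<phi> ((u \<circ> r) k)) \<longlonglongrightarrow> \<phi> u0"
      by (rule continuous_on_tendsto_compose[OF phi(1) r(3,1)]) (use au in auto)
    moreover have "P (snd (z (r k))) = \<phi> ((u \<circ> r) k)" for k using au L(3) by auto
    ultimately have Py: "P (snd y) = \<phi> u0" by (metis (mono_tags, lifting) LIMSEQ_unique tendsto_cong eventually_sequentiallyI)
    obtain b where b: "b \<in> fib" "L b u0 = snd y" using lifts[OF r(1) yC Py] by blast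
    have Lb: "(\<lambda>k. L b (u (r k))) \<longlonglongrightarrow> snd y"
      using continuous_on_tendsto_compose[OF L(1)[OF b(1)] r(3,1)] au b(2) by (auto simp: o_def)
    obtain V T q where V: "snd y \<in> V" "openin (top_of_set C) V" "homeomorphism V T P q"
      by (rule covering_space_local_homeomorphism[OF cov yC])
    then obtain V' where V': "open V'" "V = C \<inter> V'" by (auto simp: openin_open)
    have "\<forall>\<^sub>F k in sequentially. L b (u (r k)) \<in> V'" "\<forall>\<^sub>F k in sequentially. snd (z (r k)) \<in> V'"
      using topological_tendstoD[OF Lb V'(1)] topological_tendstoD[OF sr V'(1)] V V' by auto
    then have ev: "\<forall>\<^sub>F k in sequentially. snd (z (r k)) = L b (u (r k))"
    proof eventually_elim
      case (elim k)
      have "L b (u (r k)) \<in> V" "snd (z (r k)) \<in> V" using elim V'(2) zC L(2)[OF b(1) au(2)] by auto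
      moreover have "P (L b (u (r k))) = P (snd (z (r k)))" using L(3) b(1) au by auto
      ultimately show ?case using V(3) unfolding homeomorphism_def by metis
    qed
    have "(\<lambda>k. (fst (z (r k)), u (r k))) \<longlonglongrightarrow> (fst y, u0)"
      using r(3) by (intro tendsto_Pair fr) (simp add: o_def)
    then have "(\<lambda>k. G b (fst (z (r k)), u (r k))) \<longlonglongrightarrow> G b (fst y, u0)"
      by (rule continuous_on_tendsto_compose[OF G(1)[OF b(1)]]) (use r(1) t_in au z in \<open>auto simp: mem_Times_iff\<close>)
    moreover have "G b (fst y, u0) = g' y" using key[OF b(1) r(1) t_in] b(2) by simp
    moreover have "\<forall>\<^sub>F k in sequentially. g' (z (r k)) = G b (fst (z (r k)), u (r k))"
      using ev
    proof eventually_elim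
      case (elim k)
      have "fst (z (r k)) \<in> ?I" using z[of "r k"] by (auto simp: mem_Times_iff)
      then show ?case using key[OF b(1) au(2)[of "r k"], of "fst (z (r k))"] elim by (metis prod.collapse)
    qed
    ultimately have "(\<lambda>k. g' (z (r k))) \<longlonglongrightarrow> g' y" by (simp add: tendsto_cong)
    then show "\<exists>r. strict_mono r \<and> (\<lambda>n. g' (z (r n))) \<longlonglongrightarrow> g' y" using r(2) by blast
  qed
  have cont_W: "continuous_on ?W g'"
    using gc by (rule continuous_on_eq) (auto simp: g'_def)
  let ?X = "?I \<times> (C \<inter> P -` (K \<union> \<phi> ` ?D))"
  have X: "?X = ?W \<union> ?Z" by auto
  have clD: "closed (\<phi> ` ?D)" by (intro compact_imp_closed compact_continuous_image phi(1) compact_dball)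
  have cl: "closedin (top_of_set ?X) (?I \<times> (C \<inter> P -` K'))" if "closed K'" "K' \<subseteq> K \<union> \<phi> ` ?D" for K'
  proof -
    have cP: "continuous_on ?X (\<lambda>z. P (snd z))"
      by (rule continuous_on_compose2[OF covering_space_imp_continuous[OF cov]]) (auto intro!: continuous_intros)
    have "closedin (top_of_set ?X) (?X \<inter> (\<lambda>z. P (snd z)) -` K')"
      using continuous_closedin_preimage[OF cP that(1)] .
    moreover have "?X \<inter> (\<lambda>z. P (snd z)) -` K' = ?I \<times> (C \<inter> P -` K')" using that(2) by auto
    ultimately show ?thesis by simp
  qed
  have "continuous_on (?W \<union> ?Z) g'"
    by (rule continuous_on_Un_local) (use cl[OF K] cl[OF clD] X cont_W cont_Z in auto)
  then have "continuous_on ?X g'" using X by simp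
  moreover have "g' ` ?X \<subseteq> C"
  proof (rule image_subsetI)
    fix z assume z: "z \<in> ?X"
    show "g' z \<in> C"
    proof (cases "P (snd z) \<in> K")
      case True
      then have "z \<in> ?W" using z by (auto simp: mem_Times_iff)
      then show ?thesis using True gC by (auto simp: g'_def)
    next
      case False
      then obtain a u where "a \<in> fib" "u \<in> ?D" "snd z = L a u" using rep[of "snd z"] z by (auto simp: mem_Times_iff)
      then show ?thesis using key[of a u "fst z"] G(2) z by (metis mem_Times_iff prod.collapse)
    qed
  qed
  moreover have "g' (0, x) = x \<and> g' (1, x) = y0" if x: "x \<in> C" "P x \<in> K \<union> \<phi> ` ?D" for x
  proof (cases "P x \<in> K")
    case True
    then show ?thesis using g01 x by (auto simp: g'_def)
  next
    case False
    then obtain a u where "a \<in> fib" "u \<in> ?D" "x = L a u" using rep[of x] x by auto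
    then show ?thesis using key[of a u 0] key[of a u 1] G(3)[of a u] by auto
  qed
  ultimately have "contracts C P y0 (K \<union> \<phi> ` ?D) g'" unfolding contracts_def by auto
  then show ?thesis by blast
qed

text \<open>The body of the existential in \<open>finite_CW\<close>, named so that the cell data can
  be fixed once and taken apart by \<open>CW_cellsD\<close>.\<close>

definition CW_cells :: "'b topology \<Rightarrow> nat set \<Rightarrow> (nat \<Rightarrow> nat) \<Rightarrow> (nat \<Rightarrow> (nat \<Rightarrow> real) \<Rightarrow> 'b) \<Rightarrow> bool" where
  "CW_cells B I dm \<phi> \<longleftrightarrow> finite I \<and>
       (\<forall>i\<in>I. continuous_map (subtopology (Euclidean_space (dm i)) (dball_set (dm i))) B (\<phi> i) \<and>
          homeomorphic_map (subtopology (Euclidean_space (dm i)) (obball_set (dm i)))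
             (subtopology B (\<phi> i ` obball_set (dm i))) (\<phi> i) \<and>
          \<phi> i ` bsphere_set (dm i) \<subseteq> (\<Union>j\<in>{j\<in>I. dm j < dm i}. \<phi> j ` obball_set (dm j))) \<and>
       (\<forall>i\<in>I. \<forall>j\<in>I. i \<noteq> j \<longrightarrow> \<phi> i ` obball_set (dm i) \<inter> \<phi> j ` obball_set (dm j) = {}) \<and>
       topspace B = (\<Union>i\<in>I. \<phi> i ` obball_set (dm i))"

lemma finite_CW_cells: "finite_CW B \<Longrightarrow> \<exists>I dm \<phi>. CW_cells B I dm \<phi>"
  unfolding finite_CW_def CW_cells_def by (erule conjunct2)

lemma CW_cellsD:
  assumes "CW_cells B I dm \<phi>"
  shows "finite I" "topspace B = (\<Union>i\<in>I. \<phi> i ` obball_set (dm i))"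
    and "\<And>i. i \<in> I \<Longrightarrow> continuous_map (subtopology (Euclidean_space (dm i)) (dball_set (dm i))) B (\<phi> i)"
      "\<And>i. i \<in> I \<Longrightarrow> homeomorphic_map (subtopology (Euclidean_space (dm i)) (obball_set (dm i)))
             (subtopology B (\<phi> i ` obball_set (dm i))) (\<phi> i)"
      "\<And>i. i \<in> I \<Longrightarrow> \<phi> i ` bsphere_set (dm i) \<subseteq> (\<Union>j\<in>{j\<in>I. dm j < dm i}. \<phi> j ` obball_set (dm j))"
      "\<And>i j. i \<in> I \<Longrightarrow> j \<in> I \<Longrightarrow> i \<noteq> j \<Longrightarrow> \<phi> i ` obball_set (dm i) \<inter> \<phi> j ` obball_set (dm j) = {}"
  using assms unfolding CW_cells_def by simp_all

lemma finite_CW_compact: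
  assumes "finite_CW B" shows "compact_space B"
proof -
  obtain I dm \<phi> where cells: "CW_cells B I dm \<phi>" using finite_CW_cells[OF assms] by blast
  note I = CW_cellsD(1)[OF cells] and top = CW_cellsD(2)[OF cells] and \<phi> = CW_cellsD(3-)[OF cells]
  have "compactin B (\<phi> i ` dball_set (dm i))" if "i \<in> I" for i
    using \<phi>(1)[OF that] unfolding subtopology_dball
    by (intro image_compactin[of "top_of_set (dball_set (dm i))"]) (auto simp: compactin_subtopology compact_dball)
  then have c: "compactin B (\<Union>i\<in>I. \<phi> i ` dball_set (dm i))" using I by (intro compactin_Union) auto
  moreover have "(\<Union>i\<in>I. \<phi> i ` dball_set (dm i)) = topspace B"
    using compactin_subset_topspace[OF c] unfolding top by (auto simp: dball_split)
  ultimately show ?thesis by (simp add: compact_space_def)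
qed

section \<open>Contractibility of the cover and uniform contractions to a fibre\<close>

context embedded
begin

text \<open>Induction on the size of a set of cells that contains with each cell all cells of lower
  dimension. A cell of largest dimension can be taken out of such a set, and
  \<open>contracts_attach_cell\<close> puts it back.\<close>

lemma contraction:
  assumes CW: "finite_CW B" and asph: "aspherical B" and sc: "simply_connected_sp E" and y0: "y0 \<in> C"
  obtains g where "continuous_on ({0..1::real} \<times> C) g" "g ` ({0..1} \<times> C) \<subseteq> C"
    "\<And>x. x \<in> C \<Longrightarrow> g (0, x) = x" "\<And>x. x \<in> C \<Longrightarrow> g (1, x) = y0"
proof -
  obtain I dm \<phi> where cells: "CW_cells B I dm \<phi>" using finite_CW_cells[OF CW] by blast
  note I = CW_cellsD(1)[OF cells] and top = CW_cellsD(2)[OF cells] and \<phi> = CW_cellsD(3-)[OF cells]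
  define \<psi> where "\<psi> i = eB \<circ> \<phi> i" for i
  have psi_cont: "continuous_on (dball_set (dm i)) (\<psi> i)" "\<psi> i ` dball_set (dm i) \<subseteq> S" if "i \<in> I" for i
  proof -
    have "continuous_map (top_of_set (dball_set (dm i))) (top_of_set S) (\<psi> i)"
      unfolding \<psi>_def using continuous_map_compose[OF \<phi>(1)[OF that] cont_eB] by (simp add: subtopology_dball)
    then show "continuous_on (dball_set (dm i)) (\<psi> i)" "\<psi> i ` dball_set (dm i) \<subseteq> S"
      by (auto simp: continuous_map_in_subtopology)
  qed
  have phiB: "\<phi> i ` obball_set (dm i) \<subseteq> topspace B" if "i \<in> I" for i using that top by blast
  have psi_inj: "inj_on (\<psi> i) (obball_set (dm i))" if "i \<in> I" for i
    unfolding \<psi>_def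
  proof (rule comp_inj_on)
    show "inj_on (\<phi> i) (obball_set (dm i))"
      using homeomorphic_imp_injective_map[OF \<phi>(2)[OF that]] by (simp add: subtopology_obball)
    show "inj_on eB (\<phi> i ` obball_set (dm i))" by (rule inj_on_subset[OF inj_B phiB[OF that]])
  qed
  have psi_bd: "\<psi> i ` bsphere_set (dm i) \<subseteq> (\<Union>j\<in>{j\<in>I. dm j < dm i}. \<psi> j ` obball_set (dm j))" if "i \<in> I" for i
  proof -
    have "\<psi> i ` bsphere_set (dm i) = eB ` (\<phi> i ` bsphere_set (dm i))" by (simp add: \<psi>_def image_comp)
    also have "\<dots> \<subseteq> eB ` (\<Union>j\<in>{j\<in>I. dm j < dm i}. \<phi> j ` obball_set (dm j))"
      by (rule image_mono[OF \<phi>(3)[OF that]])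
    also have "\<dots> = (\<Union>j\<in>{j\<in>I. dm j < dm i}. \<psi> j ` obball_set (dm j))" by (auto simp: \<psi>_def)
    finally show ?thesis .
  qed
  have psi_disj: "\<psi> i ` obball_set (dm i) \<inter> \<psi> j ` obball_set (dm j) = {}" if "i \<in> I" "j \<in> I" "i \<noteq> j" for i j
  proof -
    have "\<psi> i ` obball_set (dm i) \<inter> \<psi> j ` obball_set (dm j) = eB ` (\<phi> i ` obball_set (dm i)) \<inter> eB ` (\<phi> j ` obball_set (dm j))"
      by (simp add: \<psi>_def image_comp)
    also have "\<dots> = eB ` (\<phi> i ` obball_set (dm i) \<inter> \<phi> j ` obball_set (dm j))"
      by (rule inj_on_image_Int[OF inj_B phiB phiB, symmetric]) (use that in auto)
    finally show ?thesis using \<phi>(4)[OF that] by simp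
  qed
  define K where "K J = (\<Union>j\<in>J. \<psi> j ` dball_set (dm j))" for J
  define down where "down J \<longleftrightarrow> J \<subseteq> I \<and> (\<forall>j\<in>J. \<forall>i\<in>I. dm i < dm j \<longrightarrow> i \<in> J)" for J
  \<comment> \<open>For such a set the closed cells and the open cells have the same union.
    Disjointness of open cells thus separates the next open cell from the part already
    treated.\<close>
  have K_open: "K J = (\<Union>j\<in>J. \<psi> j ` obball_set (dm j))" if "down J" for J
  proof (intro equalityI subsetI)
    fix x assume "x \<in> K J"
    then obtain j where j: "j \<in> J" "x \<in> \<psi> j ` obball_set (dm j) \<or> x \<in> \<psi> j ` bsphere_set (dm j)"
      by (auto simp: K_def dball_split)
    have "j \<in> I" using j that by (auto simp: down_def)
    then show "x \<in> (\<Union>j\<in>J. \<psi> j ` obball_set (dm j))"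
      using j psi_bd[of j] that unfolding down_def by blast
  qed (auto simp: K_def dball_split)
  have "\<exists>g. contracts C P y0 (K J) g" if "down J" for J
    using that
  proof (induction "card J" arbitrary: J)
    case 0
    then have "finite J" using I finite_subset[of J I] by (auto simp: down_def)
    with 0 have "J = {}" by simp
    then have "contracts C P y0 (K J) (\<lambda>_. y0)" by (auto simp: contracts_def K_def)
    then show ?case by blast
  next
    case (Suc k)
    have fJ: "finite J" "J \<noteq> {}" using Suc(2) card.infinite[of J] by fastforce+
    have "finite (dm ` J)" "dm ` J \<noteq> {}" using fJ by auto
    from Max_in[OF this] obtain m where m: "m \<in> J" "dm m = Max (dm ` J)" by auto
    then have mx: "dm j \<le> dm m" if "j \<in> J" for j using that fJ by simp
    let ?J = "J - {m}"
    have mI: "m \<in> I" using m Suc(3) by (auto simp: down_def)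
    have dJ: "down ?J" unfolding down_def
    proof (intro conjI ballI impI)
      show "?J \<subseteq> I" using Suc(3) by (auto simp: down_def)
      fix j i assume j: "j \<in> ?J" "i \<in> I" "dm i < dm j"
      then have "i \<in> J" using Suc(3) by (auto simp: down_def)
      moreover have "i \<noteq> m" using mx[of j] j by auto
      ultimately show "i \<in> ?J" by simp
    qed
    have "k = card ?J" using Suc(2) m fJ by simp
    then obtain g where g: "contracts C P y0 (K ?J) g" using Suc(1)[OF _ dJ] by blast
    have "\<exists>g'. contracts C P y0 (K ?J \<union> \<psi> m ` dball_set (dm m)) g'"
    proof (rule contracts_attach_cell[OF covering_P null_spheres_C[OF asph sc] y0 _ psi_cont[OF mI] psi_inj[OF mI] _ _ g])
      show "closed (K ?J)"
      proof -
        have "compact (\<psi> j ` dball_set (dm j))" if "j \<in> ?J" for j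
          by (rule compact_continuous_image[OF psi_cont(1) compact_dball]) (use that dJ[unfolded down_def] in blast)
        then show ?thesis unfolding K_def using fJ by (intro compact_imp_closed compact_UN) auto
      qed
      show "\<psi> m ` bsphere_set (dm m) \<subseteq> K ?J"
        unfolding K_open[OF dJ] using psi_bd[OF mI] Suc(3) m by (fastforce simp: down_def)
      show "\<psi> m ` obball_set (dm m) \<inter> K ?J = {}"
      proof -
        have "\<psi> m ` obball_set (dm m) \<inter> \<psi> j ` obball_set (dm j) = {}" if "j \<in> ?J" for j
          by (rule psi_disj[OF mI]) (use that dJ[unfolded down_def] in blast)+
        then show ?thesis unfolding K_open[OF dJ] by blast
      qed
    qed
    moreover have "K ?J \<union> \<psi> m ` dball_set (dm m) = K J" using m by (auto simp: K_def)
    ultimately show ?case by simp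
  qed
  moreover have dI: "down I" by (auto simp: down_def)
  moreover have "K I = S"
  proof -
    have "K I = eB ` (\<Union>i\<in>I. \<phi> i ` obball_set (dm i))" unfolding K_open[OF dI] by (auto simp: \<psi>_def)
    then show ?thesis by (simp add: S_def top)
  qed
  ultimately obtain g where "contracts C P y0 S g" by metis
  moreover have "C \<inter> P -` S = C" using P_in by auto
  ultimately show thesis using that[of g] by (simp add: contracts_def)
qed

text \<open>The inverse deck transformation carries a ball about y into the ball of the same radius
  about \<open>y0\<close>, where the one contraction is bounded by compactness, and the deck
  transformation carries the bound back. So \<open>R'\<close> is the same for all y.\<close>

lemma uniform_contractions:
  assumes CW: "finite_CW B" and asph: "aspherical B" and sc: "simply_connected_sp E" and y0: "y0 \<in> C"
  obtains \<sigma> :: "'v \<Rightarrow> real \<times> 'v \<Rightarrow> 'v" where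
    "\<And>y. y \<in> C \<Longrightarrow> P y = P y0 \<Longrightarrow> continuous_on ({0..1} \<times> C) (\<sigma> y)"
    "\<And>y t x. y \<in> C \<Longrightarrow> P y = P y0 \<Longrightarrow> t \<in> {0..1} \<Longrightarrow> x \<in> C \<Longrightarrow> \<sigma> y (t, x) \<in> C"
    "\<And>y x. y \<in> C \<Longrightarrow> P y = P y0 \<Longrightarrow> x \<in> C \<Longrightarrow> \<sigma> y (0, x) = x"
    "\<And>y x. y \<in> C \<Longrightarrow> P y = P y0 \<Longrightarrow> x \<in> C \<Longrightarrow> \<sigma> y (1, x) = y"
    "\<And>R. \<exists>R'. \<forall>y\<in>C. P y = P y0 \<longrightarrow> (\<forall>x\<in>C. \<forall>t\<in>{0..1}. dist x y \<le> R \<longrightarrow> dist (\<sigma> y (t, x)) y \<le> R')"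
proof -
  obtain g where g: "continuous_on ({0..1::real} \<times> C) g" "g ` ({0..1} \<times> C) \<subseteq> C"
    "\<And>x. x \<in> C \<Longrightarrow> g (0, x) = x" "\<And>x. x \<in> C \<Longrightarrow> g (1, x) = y0"
    by (rule contraction[OF assms]) blast
  define isdeck where "isdeck y h h' \<longleftrightarrow> continuous_on C h \<and> h \<in> C \<rightarrow> C \<and> continuous_on C h' \<and> h' \<in> C \<rightarrow> C \<and>
     (\<forall>x\<in>C. h (h' x) = x) \<and> h y0 = y \<and> h' y = y0 \<and>
     (\<forall>x\<in>C. \<forall>z\<in>C. dist (h x) (h z) \<le> dist x z) \<and> (\<forall>x\<in>C. \<forall>z\<in>C. dist (h' x) (h' z) \<le> dist x z)" for y h h'
  have "\<exists>h h'. isdeck y h h'" if "y \<in> C" "P y = P y0" for y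
    by (rule deck_transformation[OF sc y0 that(1) that(2)[symmetric]]) (unfold isdeck_def, blast)
  then obtain h h' where hh: "\<And>y. y \<in> C \<Longrightarrow> P y = P y0 \<Longrightarrow> isdeck y (h y) (h' y)" by metis
  define \<sigma> where "\<sigma> y z = h y (g (fst z, h' y (snd z)))" for y z
  show thesis
  proof (rule that[of \<sigma>])
    fix y assume y: "y \<in> C" "P y = P y0"
    note d = hh[OF y, unfolded isdeck_def]
    have "continuous_on ({0..1::real} \<times> C) (\<lambda>z. h' y (snd z))"
      by (rule continuous_on_compose2[of C "h' y"]) (use d in \<open>auto intro!: continuous_intros\<close>)
    then have "continuous_on ({0..1} \<times> C) (\<lambda>z. g (fst z, h' y (snd z)))"
      by (intro continuous_on_compose2[OF g(1)] continuous_intros) (use d in auto)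
    then show "continuous_on ({0..1} \<times> C) (\<sigma> y)"
      unfolding \<sigma>_def
    proof (rule continuous_on_compose2[of C "h y", rotated])
      have "(fst z, h' y (snd z)) \<in> {0..1} \<times> C" if "z \<in> {0..1} \<times> C" for z
        using that d by (auto simp: mem_Times_iff)
      then show "(\<lambda>z. g (fst z, h' y (snd z))) ` ({0..1} \<times> C) \<subseteq> C" using g(2) by blast
    qed (use d in auto)
    show "\<sigma> y (t, x) \<in> C" if "t \<in> {0..1}" "x \<in> C" for t x
      using d g(2) that by (auto simp: \<sigma>_def image_subset_iff Pi_iff)
    show "\<sigma> y (0, x) = x" "\<sigma> y (1, x) = y" if "x \<in> C" for x
      using d g(3,4) that by (auto simp: \<sigma>_def Pi_iff)
  next
    fix R
    have "compact ({0..1::real} \<times> (C \<inter> cball y0 R))"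
      by (intro compact_Times proper_C y0) auto
    then have "bounded (g ` ({0..1} \<times> (C \<inter> cball y0 R)))"
      by (intro compact_imp_bounded compact_continuous_image continuous_on_subset[OF g(1)]) auto
    then obtain R' where R': "\<And>z. z \<in> {0..1} \<times> (C \<inter> cball y0 R) \<Longrightarrow> dist y0 (g z) \<le> R'"
      using bounded_any_center[of _ y0] by (metis imageI)
    have "dist (\<sigma> y (t, x)) y \<le> R'" if y: "y \<in> C" "P y = P y0" and x: "x \<in> C" "t \<in> {0..1}" "dist x y \<le> R" for y x t
    proof -
      note d = hh[OF y, unfolded isdeck_def]
      have h'x: "h' y x \<in> C" using d x by auto
      have "dist (h' y x) (h' y y) \<le> dist x y" using d x y by blast
      then have "dist y0 (h' y x) \<le> R" using d x(3) by (simp add: dist_commute)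
      then have "dist y0 (g (t, h' y x)) \<le> R'" using h'x x by (intro R') auto
      moreover have "dist (h y (g (t, h' y x))) (h y y0) \<le> dist (g (t, h' y x)) y0"
      proof -
        have "g (t, h' y x) \<in> C" using g(2) h'x x(2) by (auto simp: image_subset_iff)
        then show ?thesis using d y0 by blast
      qed
      ultimately show ?thesis using d by (simp add: \<sigma>_def dist_commute)
    qed
    then show "\<exists>R'. \<forall>y\<in>C. P y = P y0 \<longrightarrow> (\<forall>x\<in>C. \<forall>t\<in>{0..1}. dist x y \<le> R \<longrightarrow> dist (\<sigma> y (t, x)) y \<le> R')"
      by blast
  qed
qed

end

section \<open>Interpolation along contractions\<close>

text \<open>The support of the weight \<open>u j\<close> is a disjoint union of pieces of diameter at most \<open>D\<close>, and \<open>l j\<close>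
  names the piece containing a given point.\<close>

definition colored :: "'y::metric_space set \<Rightarrow> real \<Rightarrow> nat \<Rightarrow> (nat \<Rightarrow> 'y \<Rightarrow> real) \<Rightarrow> (nat \<Rightarrow> 'y \<Rightarrow> 'l) \<Rightarrow> bool" where
  "colored Y D m u l \<longleftrightarrow> (\<forall>j<m. continuous_on Y (u j) \<and> (\<forall>y\<in>Y. 0 \<le> u j y \<and> u j y \<le> 1) \<and>
     (\<forall>y\<in>Y. u j y > 0 \<longrightarrow> (\<exists>W. openin (top_of_set Y) W \<and> y \<in> W \<and> (\<forall>z\<in>W. l j z = l j y))) \<and>
     (\<forall>y\<in>Y. \<forall>z\<in>Y. u j y > 0 \<and> u j z > 0 \<and> l j y = l j z \<longrightarrow> dist y z \<le> D)) \<and>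
   (\<forall>y\<in>Y. \<exists>j<m. u j y = 1)"

lemma coloredD:
  assumes "colored Y D m u l"
  shows "\<And>j. j < m \<Longrightarrow> continuous_on Y (u j)"
    "\<And>j y. j < m \<Longrightarrow> y \<in> Y \<Longrightarrow> 0 \<le> u j y \<and> u j y \<le> 1"
    "\<And>j y. j < m \<Longrightarrow> y \<in> Y \<Longrightarrow> u j y > 0 \<Longrightarrow> \<exists>W. openin (top_of_set Y) W \<and> y \<in> W \<and> (\<forall>z\<in>W. l j z = l j y)"
    "\<And>j y z. j < m \<Longrightarrow> y \<in> Y \<Longrightarrow> z \<in> Y \<Longrightarrow> u j y > 0 \<Longrightarrow> u j z > 0 \<Longrightarrow> l j y = l j z \<Longrightarrow> dist y z \<le> D"
    "\<And>y. y \<in> Y \<Longrightarrow> \<exists>j<m. u j y = 1"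
  using assms unfolding colored_def by blast+

lemma coloredI:
  assumes "\<And>j. j < m \<Longrightarrow> continuous_on Y (u j)"
    "\<And>j y. j < m \<Longrightarrow> y \<in> Y \<Longrightarrow> 0 \<le> u j y \<and> u j y \<le> 1"
    "\<And>j y. j < m \<Longrightarrow> y \<in> Y \<Longrightarrow> u j y > 0 \<Longrightarrow> \<exists>W. openin (top_of_set Y) W \<and> y \<in> W \<and> (\<forall>z\<in>W. l j z = l j y)"
    "\<And>j y z. j < m \<Longrightarrow> y \<in> Y \<Longrightarrow> z \<in> Y \<Longrightarrow> u j y > 0 \<Longrightarrow> u j z > 0 \<Longrightarrow> l j y = l j z \<Longrightarrow> dist y z \<le> D"
    "\<And>y. y \<in> Y \<Longrightarrow> \<exists>j<m. u j y = 1"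
  shows "colored Y D m u l"
  unfolding colored_def
proof (intro conjI allI impI ballI)
  fix j y assume j: "j < m" and y: "y \<in> Y"
  show "0 \<le> u j y" "u j y \<le> 1" using assms(2)[OF j y] by auto
  show "\<exists>W. openin (top_of_set Y) W \<and> y \<in> W \<and> (\<forall>z\<in>W. l j z = l j y)" if "u j y > 0"
    by (rule assms(3)[OF j y that])
  show "dist y z \<le> D" if "z \<in> Y" "0 < u j y \<and> 0 < u j z \<and> l j y = l j z" for z
    using assms(4)[OF j y that(1)] that(2) by blast
qed (rule assms(1) assms(5), assumption)+

lemma colored_subset:
  assumes c: "colored Y D m u l" and sub: "Y' \<subseteq> Y"
  shows "colored Y' D m u l"
proof (rule coloredI)
  fix j y assume j: "j < m" and y: "y \<in> Y'" "u j y > 0"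
  obtain W where W: "openin (top_of_set Y) W" "y \<in> W" "\<forall>z\<in>W. l j z = l j y"
    using coloredD(3)[OF c j _ y(2)] y(1) sub by blast
  have "openin (top_of_set Y') (Y' \<inter> W)"
    using W(1) sub by (auto simp: openin_open)
  then show "\<exists>W. openin (top_of_set Y') W \<and> y \<in> W \<and> (\<forall>z\<in>W. l j z = l j y)"
    using W y by (intro exI[of _ "Y' \<inter> W"] conjI ballI) blast+
next
  show "continuous_on Y' (u j)" if "j < m" for j
    using coloredD(1)[OF c that] sub by (rule continuous_on_subset)
next
  fix j y z assume "j < m" "y \<in> Y'" "z \<in> Y'" "u j y > 0" "u j z > 0" "l j y = l j z"
  then show "dist y z \<le> D" using coloredD(4)[OF c, of j y z] sub by blast
next
  fix j y assume "j < m" "y \<in> Y'"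
  then show "0 \<le> u j y \<and> u j y \<le> 1" using coloredD(2)[OF c, of j y] sub by blast
next
  fix y assume "y \<in> Y'"
  then show "\<exists>j<m. u j y = 1" using coloredD(5)[OF c, of y] sub by blast
qed

text \<open>Meant for the product of the neighbourhood with the half-line, over which the coarse
  homotopy is approximated. A pair of indices is coded as quotient and remainder of j by k; the
  product metric is bounded by the sum of the two distances.\<close>

lemma colored_prod:
  assumes c: "colored Y D m u l" and c': "colored Z D' k v l'"
  shows "colored (Y \<times> Z) (D + D') (m * k) (\<lambda>j x. u (j div k) (fst x) * v (j mod k) (snd x))
     (\<lambda>j x. (l (j div k) (fst x), l' (j mod k) (snd x)))"
proof (rule coloredI)
  fix j assume "j < m * k"
  then have j: "j div k < m" "j mod k < k"
    by (auto simp: less_mult_imp_div_less) (metis less_nat_zero_code mod_less_divisor mult_0_right neq0_conv)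
  note A = coloredD[OF c] and A' = coloredD[OF c']
  show "continuous_on (Y \<times> Z) (\<lambda>x. u (j div k) (fst x) * v (j mod k) (snd x))"
    using A(1)[OF j(1)] A'(1)[OF j(2)]
    by (intro continuous_on_mult continuous_on_compose2[of Y "u (j div k)" _ fst] continuous_on_compose2[of Z "v (j mod k)" _ snd])
      (auto intro: continuous_intros)
  {
    fix x assume x: "x \<in> Y \<times> Z"
    then have xx: "fst x \<in> Y" "snd x \<in> Z" by auto
    show "0 \<le> u (j div k) (fst x) * v (j mod k) (snd x) \<and> u (j div k) (fst x) * v (j mod k) (snd x) \<le> 1"
      using A(2)[OF j(1) xx(1)] A'(2)[OF j(2) xx(2)] by (simp add: mult_le_one)
  }
  have pos: "u (j div k) (fst x) > 0" "v (j mod k) (snd x) > 0"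
    if "x \<in> Y \<times> Z" "u (j div k) (fst x) * v (j mod k) (snd x) > 0" for x
    using A(2)[OF j(1), of "fst x"] A'(2)[OF j(2), of "snd x"] that by (auto simp: zero_less_mult_iff)
  {
    fix x assume x: "x \<in> Y \<times> Z" "u (j div k) (fst x) * v (j mod k) (snd x) > 0"
    then have xx: "fst x \<in> Y" "snd x \<in> Z" by auto
    obtain W where W: "openin (top_of_set Y) W" "fst x \<in> W" "\<forall>z\<in>W. l (j div k) z = l (j div k) (fst x)"
      using A(3)[OF j(1) xx(1) pos(1)[OF x]] by blast
    obtain W' where W': "openin (top_of_set Z) W'" "snd x \<in> W'" "\<forall>z\<in>W'. l' (j mod k) z = l' (j mod k) (snd x)"
      using A'(3)[OF j(2) xx(2) pos(2)[OF x]] by blast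
    show "\<exists>W. openin (top_of_set (Y \<times> Z)) W \<and> x \<in> W \<and>
        (\<forall>z\<in>W. (l (j div k) (fst z), l' (j mod k) (snd z)) = (l (j div k) (fst x), l' (j mod k) (snd x)))"
    proof (intro exI conjI ballI)
      show "openin (top_of_set (Y \<times> Z)) (W \<times> W')" by (rule openin_Times[OF W(1) W'(1)])
      show "x \<in> W \<times> W'" using W(2) W'(2) by (simp add: mem_Times_iff)
      show "(l (j div k) (fst z), l' (j mod k) (snd z)) = (l (j div k) (fst x), l' (j mod k) (snd x))"
        if "z \<in> W \<times> W'" for z
        using that W(3) W'(3) by (metis mem_Times_iff)
    qed
  }
  {
    fix x z assume x: "x \<in> Y \<times> Z" and z: "z \<in> Y \<times> Z"
      and ux: "u (j div k) (fst x) * v (j mod k) (snd x) > 0" and uz: "u (j div k) (fst z) * v (j mod k) (snd z) > 0"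
      and eq: "(l (j div k) (fst x), l' (j mod k) (snd x)) = (l (j div k) (fst z), l' (j mod k) (snd z))"
    have "dist (fst x) (fst z) \<le> D"
      using A(4)[OF j(1) _ _ pos(1)[OF x ux] pos(1)[OF z uz]] x z eq by auto
    moreover have "dist (snd x) (snd z) \<le> D'"
      using A'(4)[OF j(2) _ _ pos(2)[OF x ux] pos(2)[OF z uz]] x z eq by auto
    moreover have "dist x z \<le> dist (fst x) (fst z) + dist (snd x) (snd z)"
      unfolding dist_prod_def by (rule sqrt_sum_squares_le_sum) auto
    ultimately show "dist x z \<le> D + D'" by linarith
  }
next
  fix x assume "x \<in> Y \<times> Z"
  then obtain i i' where i: "i < m" "u i (fst x) = 1" "i' < k" "v i' (snd x) = 1"
    using coloredD(5)[OF c, of "fst x"] coloredD(5)[OF c', of "snd x"] by (auto simp: mem_Times_iff)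
  have "i * k + i' < i * k + k" using i by simp
  also have "\<dots> = Suc i * k" by simp
  also have "\<dots> \<le> m * k" using i by (intro mult_right_mono) auto
  finally show "\<exists>j<m * k. u (j div k) (fst x) * v (j mod k) (snd x) = 1"
    using i by (intro exI[of _ "i * k + i'"]) auto
qed

section \<open>Colouring the real line with two weights\<close>

lemma floor_locally_constant:
  fixes f :: "real \<Rightarrow> real"
  assumes "f x \<notin> \<int>" "continuous_on UNIV f"
  obtains e where "e > 0" "\<And>z. dist z x < e \<Longrightarrow> \<lfloor>f z\<rfloor> = \<lfloor>f x\<rfloor>"
proof -
  have "isCont f x" using assms(2) by (simp add: continuous_on_eq_continuous_at)
  then have "(f \<longlongrightarrow> f x) (nhds x)" by (simp add: isCont_def tendsto_nhds_iff)
  then have "\<forall>\<^sub>F z in nhds x. \<lfloor>f z\<rfloor> = \<lfloor>f x\<rfloor>" by (rule eventually_floor_eq[OF _ assms(1)])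
  then show thesis using that by (auto simp: eventually_nhds_metric)
qed

lemma dist_le_of_floor_eq:
  fixes y z c :: real
  assumes "\<lfloor>y / pi + c\<rfloor> = \<lfloor>z / pi + c\<rfloor>" shows "dist y z \<le> pi"
proof -
  have "\<bar>(y / pi + c) - (z / pi + c)\<bar> < 1" using assms by linarith
  then have "\<bar>y - z\<bar> / pi < 1" by (simp flip: diff_divide_distrib)
  then show ?thesis by (simp add: dist_real_def field_simps)
qed

text \<open>The set where such a weight is positive has components of length \<pi>. Since the
  squares of sine and cosine add up to 1, one of them is at least 1/2, and the factor 2 raises the
  corresponding weight to 1.\<close>

definition trig_weight :: "nat \<Rightarrow> real \<Rightarrow> real" where
  "trig_weight j t = min 1 (2 * (if j = 0 then cos t else sin t)^2)"

text \<open>Numbers the components: the floor jumps exactly at the zeros of the matching weight,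
  hence the shift by 1/2 for the cosine.\<close>

definition trig_label :: "nat \<Rightarrow> real \<Rightarrow> int" where
  "trig_label j t = \<lfloor>t / pi + (if j = 0 then 1/2 else 0)\<rfloor>"

lemma colored_reals: "colored Y pi 2 trig_weight trig_label"
proof (rule coloredI)
  fix j :: nat and y assume j: "j < 2" and y: "y \<in> Y" "trig_weight j y > 0"
  have "y / pi + (if j = 0 then 1/2 else 0) \<notin> \<int>"
  proof
    assume "y / pi + (if j = 0 then 1/2 else 0) \<in> \<int>"
    then obtain i :: int where i: "y / pi + (if j = 0 then 1/2 else 0) = of_int i" by (auto elim: Ints_cases)
    show False
    proof (cases "j = 0")
      case True
      then have "y = of_int (i - 1) * pi + pi / 2" using i by (simp add: field_simps)
      then have "cos y = 0" using cos_zero_iff_int2 by blast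
      then show ?thesis using y True by (simp add: trig_weight_def)
    next
      case False
      then have "y = of_int i * pi" using i by (simp add: field_simps)
      then have "sin y = 0" using sin_zero_iff_int2 by blast
      then show ?thesis using y False by (simp add: trig_weight_def)
    qed
  qed
  moreover have "continuous_on UNIV (\<lambda>t. t / pi + (if j = 0 then 1/2 else 0))" by (intro continuous_intros) auto
  ultimately obtain e where e: "e > 0" "\<And>z. dist z y < e \<Longrightarrow> trig_label j z = trig_label j y"
    unfolding trig_label_def by (rule floor_locally_constant) blast
  then show "\<exists>W. openin (top_of_set Y) W \<and> y \<in> W \<and> (\<forall>z\<in>W. trig_label j z = trig_label j y)"
  proof (intro exI conjI ballI)
    show "openin (top_of_set Y) (Y \<inter> ball y e)" by (simp add: openin_open_Int)
    show "y \<in> Y \<inter> ball y e" using y e(1) by simp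
    show "trig_label j z = trig_label j y" if "z \<in> Y \<inter> ball y e" for z
      by (rule e(2)) (use that in \<open>simp add: dist_commute\<close>)
  qed
next
  fix j :: nat and y z assume "trig_label j y = trig_label j z"
  then show "dist y z \<le> pi" unfolding trig_label_def by (rule dist_le_of_floor_eq)
next
  fix y :: real
  have "cos y ^ 2 \<ge> 1/2 \<or> sin y ^ 2 \<ge> 1/2" using sin_cos_squared_add[of y] by linarith
  then have "trig_weight 0 y = 1 \<or> trig_weight 1 y = 1" by (auto simp: trig_weight_def min_def)
  then show "\<exists>j<2. trig_weight j y = 1" by (metis one_less_numeral_iff semiring_norm(76) zero_less_numeral)
next
  show "continuous_on Y (trig_weight j)" for j
    unfolding trig_weight_def by (cases "j = 0") (auto intro!: continuous_intros)
qed (auto simp: trig_weight_def)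

section \<open>Deforming maps along a family of contractions\<close>

lemma continuous_on_locally:
  fixes f :: "'a::metric_space \<Rightarrow> 'b::topological_space"
  assumes "\<And>x. x \<in> S \<Longrightarrow> \<exists>T. openin (top_of_set S) T \<and> x \<in> T \<and> continuous_on T f"
  shows "continuous_on S f"
  unfolding continuous_on_eq_continuous_within
proof
  fix x assume x: "x \<in> S"
  obtain T where T: "openin (top_of_set S) T" "x \<in> T" "continuous_on T f" using assms[OF x] by blast
  then obtain O' where O': "open O'" "T = S \<inter> O'" by (auto simp: openin_open)
  have "at x within S = at x within T" using O' T(2) by (intro at_within_nhd[of x O']) auto
  then show "continuous (at x within S) f" using T(2,3) by (simp add: continuous_on_eq_continuous_within)
qed

text \<open>By the last clause the join takes over each point y only values that one of its parts
  takes over y. Distance bounds for the parts therefore pass to the join without any computation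
  with the time parameter.\<close>

lemma homotopy_join:
  fixes Y :: "'y::metric_space set"
  assumes k: "continuous_on ({0..1::real} \<times> Y) k1" "continuous_on ({0..1::real} \<times> Y) k2"
    and eq: "\<And>y. y \<in> Y \<Longrightarrow> k1 (1, y) = k2 (0, y)"
  shows "\<exists>k. continuous_on ({0..1::real} \<times> Y) k \<and> (\<forall>y\<in>Y. k (0, y) = k1 (0, y) \<and> k (1, y) = k2 (1, y)) \<and>
     (\<forall>t\<in>{0..1}. \<forall>y\<in>Y. \<exists>s\<in>{0..1}. k (t, y) = k1 (s, y) \<or> k (t, y) = k2 (s, y))"
proof -
  define k where "k z = (if fst z \<le> 1/2 then k1 (2 * fst z, snd z) else k2 (2 * fst z - 1, snd z))" for z
  have eqX: "{0..1/2} \<times> Y \<union> {1/2..1} \<times> Y = {0..1::real} \<times> Y" by auto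
  have "continuous_on ({0..1/2} \<times> Y \<union> {1/2..1} \<times> Y) k"
  proof (rule continuous_on_Un_local)
    have "continuous_on ({0..1/2} \<times> Y) (\<lambda>z. k1 (2 * fst z, snd z))"
      by (rule continuous_on_compose2[OF k(1)]) (auto intro!: continuous_intros)
    then show "continuous_on ({0..1/2} \<times> Y) k" by (rule continuous_on_eq) (auto simp: k_def)
    have "continuous_on ({1/2..1} \<times> Y) (\<lambda>z. k2 (2 * fst z - 1, snd z))"
      by (rule continuous_on_compose2[OF k(2)]) (auto intro!: continuous_intros)
    then show "continuous_on ({1/2..1} \<times> Y) k"
    proof (rule continuous_on_eq)
      fix z assume z: "z \<in> {1/2..1::real} \<times> Y"
      show "k2 (2 * fst z - 1, snd z) = k z"
      proof (cases "fst z = 1/2")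
        case True
        then have "2 * fst z - 1 = 0" "2 * fst z = 1" by simp_all
        moreover have "k z = k1 (2 * fst z, snd z)" using True by (simp add: k_def)
        ultimately show ?thesis using eq[of "snd z"] z by (metis mem_Times_iff)
      next
        case False
        then show ?thesis using z by (auto simp: k_def)
      qed
    qed
    have "{0..1/2} \<times> Y = ({0..1} \<times> Y) \<inter> ({0..1/2::real} \<times> UNIV)"
      "{1/2..1} \<times> Y = ({0..1} \<times> Y) \<inter> ({1/2..1::real} \<times> UNIV)" by auto
    then show "closedin (top_of_set ({0..1/2} \<times> Y \<union> {1/2..1} \<times> Y)) ({0..1/2::real} \<times> Y)"
      "closedin (top_of_set ({0..1/2} \<times> Y \<union> {1/2..1} \<times> Y)) ({1/2..1::real} \<times> Y)"
      unfolding eqX by (metis closedin_closed_Int closed_Times closed_UNIV closed_real_atLeastAtMost)+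
  qed
  moreover have "\<exists>s\<in>{0..1}. k (t, y) = k1 (s, y) \<or> k (t, y) = k2 (s, y)" if t: "t \<in> {0..1}" for t y
  proof (cases "t \<le> 1/2")
    case True
    then show ?thesis using t by (intro bexI[of _ "2 * t"]) (auto simp: k_def)
  next
    case False
    then show ?thesis using t by (intro bexI[of _ "2 * t - 1"]) (auto simp: k_def)
  qed
  moreover have "k (0, y) = k1 (0, y) \<and> k (1, y) = k2 (1, y)" for y by (simp add: k_def)
  ultimately show ?thesis unfolding eqX by blast
qed

text \<open>What the interpolation needs, for two instances: the cover with one fibre as set of
  targets, and the half-line with all its points as targets. The bound is uniform in the target
  y.\<close>

locale contractions =
  fixes C :: "'v::metric_space set" and Z :: "'v set" and \<sigma> :: "'v \<Rightarrow> real \<times> 'v \<Rightarrow> 'v" and D0 :: real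
  assumes Z: "Z \<subseteq> C" and near_Z: "\<And>x. x \<in> C \<Longrightarrow> \<exists>y\<in>Z. dist x y \<le> D0"
    and \<sigma>_cont: "\<And>y. y \<in> Z \<Longrightarrow> continuous_on ({0..1} \<times> C) (\<sigma> y)"
    and \<sigma>_in: "\<And>y t x. y \<in> Z \<Longrightarrow> t \<in> {0..1} \<Longrightarrow> x \<in> C \<Longrightarrow> \<sigma> y (t, x) \<in> C"
    and \<sigma>_0: "\<And>y x. y \<in> Z \<Longrightarrow> x \<in> C \<Longrightarrow> \<sigma> y (0, x) = x"
    and \<sigma>_1: "\<And>y x. y \<in> Z \<Longrightarrow> x \<in> C \<Longrightarrow> \<sigma> y (1, x) = y"
    and \<sigma>_bound: "\<And>R. \<exists>R'. \<forall>y\<in>Z. \<forall>x\<in>C. \<forall>t\<in>{0..1}. dist x y \<le> R \<longrightarrow> dist (\<sigma> y (t, x)) y \<le> R'"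
begin

text \<open>Successive pushes at a single point of the source: \<open>w j\<close> is the target of
  push number j and \<open>\<mu> j\<close> the time for which it acts.\<close>

primrec steps :: "(nat \<Rightarrow> 'v) \<Rightarrow> (nat \<Rightarrow> real) \<Rightarrow> 'v \<Rightarrow> nat \<Rightarrow> 'v" where
  "steps w \<mu> c 0 = c"
| "steps w \<mu> c (Suc j) = \<sigma> (w j) (\<mu> j, steps w \<mu> c j)"

lemma steps_in: "(\<And>j. j < m \<Longrightarrow> w j \<in> Z \<and> \<mu> j \<in> {0..1}) \<Longrightarrow> c \<in> C \<Longrightarrow> steps w \<mu> c m \<in> C"
  by (induction m) (auto intro!: \<sigma>_in)

lemma steps_0:
  assumes "\<And>j. j < m \<Longrightarrow> w j \<in> Z \<and> \<mu> j = 0" "c \<in> C" shows "steps w \<mu> c m = c"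
  using assms by (induction m) (auto simp: \<sigma>_0)

lemma steps_indep:
  assumes "\<And>j. j < m \<Longrightarrow> w j \<in> Z \<and> \<mu> j \<in> {0..1}" "c \<in> C" "c' \<in> C" "\<exists>j<m. \<mu> j = 1"
  shows "steps w \<mu> c m = steps w \<mu> c' m"
  using assms
proof (induction m)
  case (Suc m)
  have in_C: "steps w \<mu> c m \<in> C" "steps w \<mu> c' m \<in> C" using Suc.prems by (auto intro!: steps_in)
  show ?case
  proof (cases "\<mu> m = 1")
    case True
    then show ?thesis using \<sigma>_1 in_C Suc.prems(1)[of m] by simp
  next
    case False
    then have "\<exists>j<m. \<mu> j = 1" using Suc.prems(4) less_antisym by blast
    then show ?thesis using Suc by simp
  qed
qed simp

text \<open>Every push renews the bound through \<open>\<sigma>_bound\<close>, so the final bound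
  depends on the number m of pushes. A push of time 0 does nothing, hence only targets with positive
  time have to be near x.\<close>

lemma steps_bound:
  "\<exists>K'. \<forall>w \<mu> c x. c \<in> C \<longrightarrow> dist c x \<le> K \<longrightarrow>
     (\<forall>j<m. w j \<in> Z \<and> \<mu> j \<in> {0..1} \<and> (\<mu> j > 0 \<longrightarrow> dist (w j) x \<le> K1)) \<longrightarrow> dist (steps w \<mu> c m) x \<le> K'"
proof (induction m)
  case 0
  show ?case by auto
next
  case (Suc m)
  then obtain K' where K': "\<And>w \<mu> c x. c \<in> C \<Longrightarrow> dist c x \<le> K \<Longrightarrow>
     (\<forall>j<m. w j \<in> Z \<and> \<mu> j \<in> {0..1} \<and> (\<mu> j > 0 \<longrightarrow> dist (w j) x \<le> K1)) \<Longrightarrow> dist (steps w \<mu> c m) x \<le> K'"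
    by blast
  obtain R' where R': "\<And>y x t. y \<in> Z \<Longrightarrow> x \<in> C \<Longrightarrow> t \<in> {0..1} \<Longrightarrow> dist x y \<le> K' + K1 \<Longrightarrow> dist (\<sigma> y (t, x)) y \<le> R'"
    using \<sigma>_bound[of "K' + K1"] by blast
  have "dist (steps w \<mu> c (Suc m)) x \<le> max K' (R' + K1)"
    if c: "c \<in> C" "dist c x \<le> K" and w: "\<forall>j<Suc m. w j \<in> Z \<and> \<mu> j \<in> {0..1} \<and> (\<mu> j > 0 \<longrightarrow> dist (w j) x \<le> K1)"
    for w \<mu> c x
  proof -
    have s: "steps w \<mu> c m \<in> C" using c w by (auto intro!: steps_in)
    have d: "dist (steps w \<mu> c m) x \<le> K'" using c w by (intro K') auto
    have wm: "w m \<in> Z" "\<mu> m \<in> {0..1}" "\<mu> m > 0 \<Longrightarrow> dist (w m) x \<le> K1" using w by auto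
    show ?thesis
    proof (cases "\<mu> m = 0")
      case True
      then show ?thesis using \<sigma>_0[OF wm(1) s] d by simp
    next
      case False
      then have K1: "dist (w m) x \<le> K1" using wm by auto
      have "dist (steps w \<mu> c m) (w m) \<le> K' + K1"
        using dist_triangle2[of "steps w \<mu> c m" "w m" x] d K1 by linarith
      then have "dist (\<sigma> (w m) (\<mu> m, steps w \<mu> c m)) (w m) \<le> R'" by (rule R'[OF wm(1) s wm(2)])
      then have "dist (\<sigma> (w m) (\<mu> m, steps w \<mu> c m)) x \<le> R' + K1"
        using dist_triangle[of "\<sigma> (w m) (\<mu> m, steps w \<mu> c m)" x "w m"] K1 by linarith
      then show ?thesis by simp
    qed
  qed
  then show ?case by blast
qed

text \<open>An operator on maps that has forgotten its argument at time 1. Continuity of f is asked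
  in the first clause only, because \<open>approximation\<close> feeds the discontinuous
  \<open>G\<close> itself to the operator.\<close>

definition deforms :: "'y::metric_space set \<Rightarrow> ('y \<Rightarrow> 'v) \<Rightarrow> (('y \<Rightarrow> 'v) \<Rightarrow> real \<times> 'y \<Rightarrow> 'v) \<Rightarrow> bool" where
  "deforms Y G A \<longleftrightarrow> (\<forall>f. continuous_on Y f \<and> f ` Y \<subseteq> C \<longrightarrow> continuous_on ({0..1} \<times> Y) (A f)) \<and>
     (\<forall>f t y. f ` Y \<subseteq> C \<and> t \<in> {0..1} \<and> y \<in> Y \<longrightarrow> A f (t, y) \<in> C) \<and>
     (\<forall>f y. f ` Y \<subseteq> C \<and> y \<in> Y \<longrightarrow> A f (0, y) = f y) \<and>
     (\<forall>f g y. f ` Y \<subseteq> C \<and> g ` Y \<subseteq> C \<and> y \<in> Y \<longrightarrow> A f (1, y) = A g (1, y)) \<and>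
     (\<forall>K. \<exists>K'. \<forall>f t y. f ` Y \<subseteq> C \<longrightarrow> t \<in> {0..1} \<longrightarrow> y \<in> Y \<longrightarrow> dist (f y) (G y) \<le> K \<longrightarrow> dist (A f (t, y)) (G y) \<le> K')"

lemma deformsD:
  assumes "deforms Y G A"
  shows "\<And>f. continuous_on Y f \<Longrightarrow> f ` Y \<subseteq> C \<Longrightarrow> continuous_on ({0..1} \<times> Y) (A f)"
    "\<And>f t y. f ` Y \<subseteq> C \<Longrightarrow> t \<in> {0..1} \<Longrightarrow> y \<in> Y \<Longrightarrow> A f (t, y) \<in> C"
    "\<And>f y. f ` Y \<subseteq> C \<Longrightarrow> y \<in> Y \<Longrightarrow> A f (0, y) = f y"
    "\<And>f g y. f ` Y \<subseteq> C \<Longrightarrow> g ` Y \<subseteq> C \<Longrightarrow> y \<in> Y \<Longrightarrow> A f (1, y) = A g (1, y)"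
    "\<And>K. \<exists>K'. \<forall>f t y. f ` Y \<subseteq> C \<longrightarrow> t \<in> {0..1} \<longrightarrow> y \<in> Y \<longrightarrow> dist (f y) (G y) \<le> K \<longrightarrow> dist (A f (t, y)) (G y) \<le> K'"
  using assms unfolding deforms_def by blast+

lemma deformsI:
  assumes "\<And>f. continuous_on Y f \<Longrightarrow> f ` Y \<subseteq> C \<Longrightarrow> continuous_on ({0..1} \<times> Y) (A f)"
    "\<And>f t y. f ` Y \<subseteq> C \<Longrightarrow> t \<in> {0..1} \<Longrightarrow> y \<in> Y \<Longrightarrow> A f (t, y) \<in> C"
    "\<And>f y. f ` Y \<subseteq> C \<Longrightarrow> y \<in> Y \<Longrightarrow> A f (0, y) = f y"
    "\<And>f g y. f ` Y \<subseteq> C \<Longrightarrow> g ` Y \<subseteq> C \<Longrightarrow> y \<in> Y \<Longrightarrow> A f (1, y) = A g (1, y)"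
    "\<And>K. \<exists>K'. \<forall>f t y. f ` Y \<subseteq> C \<longrightarrow> t \<in> {0..1} \<longrightarrow> y \<in> Y \<longrightarrow> dist (f y) (G y) \<le> K \<longrightarrow> dist (A f (t, y)) (G y) \<le> K'"
  shows "deforms Y G A"
  unfolding deforms_def by (intro conjI allI impI; (elim conjE)?; rule assms; assumption)

text \<open>On one piece of the support of \<open>u j\<close> the target is constant, a point of
  \<open>Z\<close> near the value of \<open>G\<close> at a sample point of the piece. Since the
  piece has diameter at most D, the target is near \<open>G\<close> throughout.\<close>

lemma deform:
  fixes Y :: "'y::metric_space set"
  assumes col: "colored Y D m u l"
    and G: "\<And>y. y \<in> Y \<Longrightarrow> G y \<in> C" "\<And>y z. y \<in> Y \<Longrightarrow> z \<in> Y \<Longrightarrow> dist y z \<le> D \<Longrightarrow> dist (G y) (G z) \<le> D1"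
  shows "\<exists>A. deforms Y G A"
proof (cases "Y = {}")
  case True
  then show ?thesis by (intro exI[of _ "\<lambda>_ _. undefined"] deformsI) auto
next
  case False
  then obtain z0 where z0: "z0 \<in> Z" using G(1) near_Z by blast
  note c = coloredD[OF col]
  define nz where "nz x = (SOME y. y \<in> Z \<and> dist x y \<le> D0)" for x
  have nz: "nz x \<in> Z" "dist x (nz x) \<le> D0" if "x \<in> C" for x
    using someI_ex[of "\<lambda>y. y \<in> Z \<and> dist x y \<le> D0"] near_Z[OF that] unfolding nz_def by blast+
  define rep where "rep j a = (SOME z. z \<in> Y \<and> u j z > 0 \<and> l j z = a)" for j a
  \<comment> \<open>A label carried by no point of positive weight gets the default target
    \<open>z0\<close>; the corresponding push has time 0.\<close>
  define w where "w j y = (if \<exists>z\<in>Y. u j z > 0 \<and> l j z = l j y then nz (G (rep j (l j y))) else z0)" for j y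
  have rep: "rep j a \<in> Y \<and> u j (rep j a) > 0 \<and> l j (rep j a) = a" if "\<exists>z\<in>Y. u j z > 0 \<and> l j z = a" for j a
    unfolding rep_def using someI_ex[of "\<lambda>z. z \<in> Y \<and> u j z > 0 \<and> l j z = a"] that by blast
  have wZ: "w j y \<in> Z" for j y
    unfolding w_def using rep[of j "l j y"] nz G(1) z0 by auto
  have w_near: "dist (w j y) (G y) \<le> D0 + D1" if "j < m" "y \<in> Y" "u j y > 0" for j y
  proof -
    have ex: "\<exists>z\<in>Y. u j z > 0 \<and> l j z = l j y" using that by blast
    note r = rep[OF ex]
    have "dist (rep j (l j y)) y \<le> D" using c(4)[OF that(1) _ that(2)] r that by blast
    then have "dist (G (rep j (l j y))) (G y) \<le> D1" using G(2) r that by blast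
    moreover have "dist (G (rep j (l j y))) (w j y) \<le> D0" using ex nz(2) G(1) r by (simp add: w_def)
    ultimately show ?thesis using dist_triangle3[of "w j y" "G y" "G (rep j (l j y))"] by linarith
  qed
  have w_loc: "w j z = w j y" if "l j z = l j y" for j y z by (simp only: w_def that)
  \<comment> \<open>Cutting off at \<open>1/2\<close> makes \<open>\<mu> j\<close> vanish near the zeros of \<open>u j\<close>, where \<open>w j\<close> is discontinuous.\<close>
  define \<mu> where "\<mu> j y = max 0 (2 * u j y - 1)" for j y
  have mu01: "\<mu> j y \<in> {0..1}" if "j < m" "y \<in> Y" for j y using c(2)[OF that] by (auto simp: \<mu>_def)
  define A where "A f z = steps (\<lambda>j. w j (snd z)) (\<lambda>j. fst z * \<mu> j (snd z)) (f (snd z)) m" for f z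
  have tmu: "t * \<mu> j y \<in> {0..1}" if "t \<in> {0..1}" "j < m" "y \<in> Y" for t j y
    using mu01[OF that(2,3)] that(1) by (auto intro: mult_le_one)
  have "deforms Y G A"
  proof (rule deformsI)
    fix f assume f: "continuous_on Y f" "f ` Y \<subseteq> C"
    let ?s = "\<lambda>z. steps (\<lambda>j. w j (snd z)) (\<lambda>j. fst z * \<mu> j (snd z)) (f (snd z))"
    let ?X = "{0..1::real} \<times> Y"
    have s_in: "?s z j \<in> C" if "z \<in> ?X" "j \<le> m" for z j
      using that f(2) by (intro steps_in) (auto simp: wZ simp del: atLeastAtMost_iff intro!: tmu)
    have "continuous_on ?X (\<lambda>z. ?s z j)" if "j \<le> m" for j
      using that
    proof (induction j)
      case 0
      show ?case by (auto intro!: continuous_on_compose2[OF f(1)] continuous_intros)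
    next
      case (Suc j)
      then have IH: "continuous_on ?X (\<lambda>z. ?s z j)" and j: "j < m" by auto
      have cu: "continuous_on ?X (\<lambda>z. u j (snd z))"
        by (rule continuous_on_compose2[OF c(1)[OF j]]) (auto intro!: continuous_intros)
      have cmu: "continuous_on ?X (\<lambda>z. fst z * \<mu> j (snd z))"
        unfolding \<mu>_def by (intro continuous_intros cu)
      show ?case
      proof (rule continuous_on_locally)
        fix x assume x: "x \<in> ?X"
        show "\<exists>T. openin (top_of_set ?X) T \<and> x \<in> T \<and> continuous_on T (\<lambda>z. ?s z (Suc j))"
        \<comment> \<open>Where the weight is positive the target is locally constant. Where it is 0
          it stays below 1/2 nearby, and there the push does nothing.\<close>
        proof (cases "u j (snd x) > 0")
          case True
          obtain W where W: "openin (top_of_set Y) W" "snd x \<in> W" "\<forall>z\<in>W. l j z = l j (snd x)"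
            using c(3)[OF j mem_Times_iff[THEN iffD1, THEN conjunct2, OF x] True] by blast
          have WY: "W \<subseteq> Y" using W(1) openin_imp_subset by blast
          have "openin (top_of_set ?X) ({0..1} \<times> W)" by (intro openin_Times W(1)) auto
          moreover have "continuous_on ({0..1} \<times> W) (\<lambda>z. \<sigma> (w j (snd x)) (fst z * \<mu> j (snd z), ?s z j))"
          proof (rule continuous_on_compose2[OF \<sigma>_cont[OF wZ]])
            have sub: "{0..1} \<times> W \<subseteq> ?X" using WY by auto
            show "continuous_on ({0..1} \<times> W) (\<lambda>z. (fst z * \<mu> j (snd z), ?s z j))"
              using continuous_on_subset[OF cmu sub] continuous_on_subset[OF IH sub] by (rule continuous_on_Pair)
            show "(\<lambda>z. (fst z * \<mu> j (snd z), ?s z j)) ` ({0..1} \<times> W) \<subseteq> {0..1} \<times> C"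
            proof (rule image_subsetI)
              fix z assume "z \<in> {0..1::real} \<times> W"
              then have z: "z \<in> ?X" "fst z \<in> {0..1}" "snd z \<in> Y" using sub by (auto simp: mem_Times_iff)
              show "(fst z * \<mu> j (snd z), ?s z j) \<in> {0..1} \<times> C"
                using s_in[OF z(1), of j] tmu[OF z(2) j z(3)] j by simp
            qed
          qed
          then have "continuous_on ({0..1} \<times> W) (\<lambda>z. ?s z (Suc j))"
          proof (rule continuous_on_eq)
            fix z assume z: "z \<in> {0..1::real} \<times> W"
            then have "w j (snd z) = w j (snd x)" using W(3) by (intro w_loc) auto
            then show "\<sigma> (w j (snd x)) (fst z * \<mu> j (snd z), ?s z j) = ?s z (Suc j)" by simp
          qed
          moreover have "x \<in> {0..1} \<times> W" using x W by (auto simp: mem_Times_iff)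
          ultimately show ?thesis by blast
        next
          case False
          let ?T = "?X \<inter> (\<lambda>z. u j (snd z)) -` {..<1/2}"
          have "openin (top_of_set ?X) ?T" by (rule continuous_openin_preimage_gen[OF cu]) auto
          moreover have "continuous_on ?T (\<lambda>z. ?s z (Suc j))"
          proof (rule continuous_on_eq)
            show "continuous_on ?T (\<lambda>z. ?s z j)" using IH by (rule continuous_on_subset) auto
            fix z assume z: "z \<in> ?T"
            then have "\<mu> j (snd z) = 0" by (auto simp: \<mu>_def)
            then show "?s z j = ?s z (Suc j)" using \<sigma>_0[OF wZ s_in[of z j]] z j by auto
          qed
          ultimately show ?thesis using x False by (intro exI[of _ ?T]) auto
        qed
      qed
    qed
    from this[of m] show "continuous_on ?X (A f)" unfolding A_def by simp
  next
    fix f t y assume f: "f ` Y \<subseteq> C" and t: "t \<in> {0..1::real}" and y: "y \<in> Y"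
    show "A f (t, y) \<in> C" unfolding A_def using f t y
      by (intro steps_in) (auto simp: wZ simp del: atLeastAtMost_iff intro!: tmu)
  next
    fix f y assume f: "f ` Y \<subseteq> C" and y: "y \<in> Y"
    show "A f (0, y) = f y" unfolding A_def using f y wZ by (subst steps_0) auto
  next
    fix f g y assume f: "f ` Y \<subseteq> C" "g ` Y \<subseteq> C" and y: "y \<in> Y"
    obtain j where j: "j < m" "u j y = 1" using c(5)[OF y] by blast
    then have "\<exists>j<m. fst (1::real, y) * \<mu> j (snd (1::real, y)) = 1" by (intro exI[of _ j]) (simp add: \<mu>_def)
    then show "A f (1, y) = A g (1, y)" unfolding A_def using f y
      by (intro steps_indep) (auto simp: wZ simp del: atLeastAtMost_iff intro!: tmu mu01)
  next
    fix K
    obtain K' where K': "\<And>w \<mu> c x. c \<in> C \<Longrightarrow> dist c x \<le> K \<Longrightarrow>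
     (\<forall>j<m. w j \<in> Z \<and> \<mu> j \<in> {0..1} \<and> (\<mu> j > 0 \<longrightarrow> dist (w j) x \<le> D0 + D1)) \<Longrightarrow> dist (steps w \<mu> c m) x \<le> K'"
      using steps_bound[of K m "D0 + D1"] by blast
    have "dist (A f (t, y)) (G y) \<le> K'"
      if f: "f ` Y \<subseteq> C" "t \<in> {0..1}" "y \<in> Y" "dist (f y) (G y) \<le> K" for f t y
      unfolding A_def
    proof (rule K')
      show "\<forall>j<m. w j (snd (t, y)) \<in> Z \<and> fst (t, y) * \<mu> j (snd (t, y)) \<in> {0..1} \<and>
          (0 < fst (t, y) * \<mu> j (snd (t, y)) \<longrightarrow> dist (w j (snd (t, y))) (G y) \<le> D0 + D1)"
      proof (intro allI impI conjI)
        fix j assume j: "j < m"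
        show "w j (snd (t, y)) \<in> Z" by (rule wZ)
        show "fst (t, y) * \<mu> j (snd (t, y)) \<in> {0..1}" using tmu[OF f(2) j f(3)] by simp
        assume "0 < fst (t, y) * \<mu> j (snd (t, y))"
        then have "\<mu> j y \<noteq> 0" by auto
        then have "u j y > 0" by (auto simp: \<mu>_def max_def split: if_splits)
        then show "dist (w j (snd (t, y))) (G y) \<le> D0 + D1" using w_near[OF j f(3)] by simp
      qed
    qed (use f in auto)
    then show "\<exists>K'. \<forall>f t y. f ` Y \<subseteq> C \<longrightarrow> t \<in> {0..1} \<longrightarrow> y \<in> Y \<longrightarrow> dist (f y) (G y) \<le> K \<longrightarrow> dist (A f (t, y)) (G y) \<le> K'"
      by blast
  qed
  then show ?thesis by blast
qed

text \<open>The operator is applied to a constant map, so its end is continuous. That end is the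
  same as for \<open>G\<close>, whose own deformation starts at distance 0 from \<open>G\<close> and
  hence stays close to it.\<close>

lemma approximation:
  assumes col: "colored Y D m u l"
    and G: "\<And>y. y \<in> Y \<Longrightarrow> G y \<in> C" "\<And>y z. y \<in> Y \<Longrightarrow> z \<in> Y \<Longrightarrow> dist y z \<le> D \<Longrightarrow> dist (G y) (G z) \<le> D1"
  obtains F K where "continuous_on Y F" "\<And>y. y \<in> Y \<Longrightarrow> F y \<in> C" "\<And>y. y \<in> Y \<Longrightarrow> dist (F y) (G y) \<le> K"
proof (cases "Y = {}")
  case True
  then show thesis using that by auto
next
  case False
  then obtain c0 where c0: "c0 \<in> C" using G(1) by blast
  have "\<exists>A. deforms Y G A" by (rule deform[OF col G])
  then obtain A where dA: "deforms Y G A" by blast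
  note A = deformsD[OF dA]
  obtain K where K: "\<And>f t y. f ` Y \<subseteq> C \<Longrightarrow> t \<in> {0..1} \<Longrightarrow> y \<in> Y \<Longrightarrow> dist (f y) (G y) \<le> 0 \<Longrightarrow> dist (A f (t, y)) (G y) \<le> K"
    using A(5)[of 0] by blast
  let ?F = "\<lambda>y. A (\<lambda>_. c0) (1, y)"
  show thesis
  proof (rule that[of ?F K])
    show "continuous_on Y ?F"
      by (rule continuous_on_compose2[OF A(1)]) (use c0 in \<open>auto intro!: continuous_intros\<close>)
    show "?F y \<in> C" if "y \<in> Y" for y using A(2)[of "\<lambda>_. c0" 1 y] c0 that by auto
    show "dist (?F y) (G y) \<le> K" if "y \<in> Y" for y
    proof -
      have GC: "G ` Y \<subseteq> C" using G(1) by blast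
      have "?F y = A G (1, y)" by (rule A(4)) (use c0 GC that in auto)
      then show ?thesis using K[OF GC, of 1 y] that by simp
    qed
  qed
qed

text \<open>f and g are both deformed to the common end map, and the second deformation is run
  backwards.\<close>

lemma homotopic_close:
  assumes col: "colored Y D m u l"
    and G: "\<And>y. y \<in> Y \<Longrightarrow> G y \<in> C" "\<And>y z. y \<in> Y \<Longrightarrow> z \<in> Y \<Longrightarrow> dist y z \<le> D \<Longrightarrow> dist (G y) (G z) \<le> D1"
    and f: "continuous_on Y f" "\<And>y. y \<in> Y \<Longrightarrow> f y \<in> C" "\<And>y. y \<in> Y \<Longrightarrow> dist (f y) (G y) \<le> K"
    and g: "continuous_on Y g" "\<And>y. y \<in> Y \<Longrightarrow> g y \<in> C" "\<And>y. y \<in> Y \<Longrightarrow> dist (g y) (G y) \<le> K"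
  obtains h K' where "continuous_on ({0..1::real} \<times> Y) h" "\<And>t y. t \<in> {0..1} \<Longrightarrow> y \<in> Y \<Longrightarrow> h (t, y) \<in> C"
    "\<And>y. y \<in> Y \<Longrightarrow> h (0, y) = f y" "\<And>y. y \<in> Y \<Longrightarrow> h (1, y) = g y"
    "\<And>t y. t \<in> {0..1} \<Longrightarrow> y \<in> Y \<Longrightarrow> dist (h (t, y)) (G y) \<le> K'"
proof -
  have "\<exists>A. deforms Y G A" by (rule deform[OF col G])
  then obtain A where dA: "deforms Y G A" by blast
  note A = deformsD[OF dA]
  obtain K' where K': "\<And>f t y. f ` Y \<subseteq> C \<Longrightarrow> t \<in> {0..1} \<Longrightarrow> y \<in> Y \<Longrightarrow> dist (f y) (G y) \<le> K \<Longrightarrow> dist (A f (t, y)) (G y) \<le> K'"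
    using A(5)[of K] by blast
  have fC: "f ` Y \<subseteq> C" "g ` Y \<subseteq> C" using f g by auto
  have c1: "continuous_on ({0..1} \<times> Y) (A f)" and c2: "continuous_on ({0..1} \<times> Y) (\<lambda>z. A g (1 - fst z, snd z))"
    using A(1)[OF f(1) fC(1)]
    by (auto intro!: continuous_on_compose2[OF A(1)[OF g(1) fC(2)]] continuous_intros)
  obtain h where h: "continuous_on ({0..1::real} \<times> Y) h" "\<And>y. y \<in> Y \<Longrightarrow> h (0, y) = A f (0, y)"
    "\<And>y. y \<in> Y \<Longrightarrow> h (1, y) = A g (0, y)"
    "\<And>t y. t \<in> {0..1} \<Longrightarrow> y \<in> Y \<Longrightarrow> \<exists>s\<in>{0..1}. h (t, y) = A f (s, y) \<or> h (t, y) = A g (1 - s, y)"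
    using homotopy_join[OF c1 c2] A(4)[OF fC] by force
  show thesis
  proof (rule that[OF h(1)])
    fix t :: real and y assume t: "t \<in> {0..1}" and y: "y \<in> Y"
    obtain s where s: "s \<in> {0..1}" "1 - s \<in> {0..1}" "h (t, y) = A f (s, y) \<or> h (t, y) = A g (1 - s, y)"
      using h(4)[OF t y] by auto
    show "h (t, y) \<in> C" using A(2)[OF fC(1) s(1) y] A(2)[OF fC(2) s(2) y] s(3) by auto
    show "dist (h (t, y)) (G y) \<le> K'"
      using K'[OF fC(1) s(1) y f(3)[OF y]] K'[OF fC(2) s(2) y g(3)[OF y]] s(3) by auto
  qed (use h(2,3) A(3) fC in auto)
qed

end

lemma contractions_halfline: "contractions {0..} {0..} (\<lambda>y z. (1 - fst z) * snd z + fst z * y) (0::real)"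
proof
  fix R
  have "dist ((1 - t) * x + t * y) y \<le> R" if "t \<in> {0..1}" "dist x y \<le> R" for t x y :: real
  proof -
    have "(1 - t) * x + t * y - y = (1 - t) * (x - y)" by (simp add: algebra_simps)
    then have "dist ((1 - t) * x + t * y) y = (1 - t) * \<bar>x - y\<bar>" using that by (simp add: dist_real_def abs_mult)
    also have "\<dots> \<le> \<bar>x - y\<bar>" using that by (simp add: mult_left_le_one_le)
    finally show ?thesis using that by (simp add: dist_real_def)
  qed
  then show "\<exists>R'. \<forall>y\<in>{0..}. \<forall>x\<in>{0..}. \<forall>t\<in>{0..1::real}. dist x y \<le> R \<longrightarrow>
      dist ((1 - fst (t, x)) * snd (t, x) + fst (t, x) * y) y \<le> R'" by (intro exI[of _ R]) auto
qed (auto intro!: continuous_intros exI[of _ "_::real"] simp: dist_real_def)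

section \<open>From coarse to proper deformations\<close>

text \<open>Properness is expressed by bounded sets about a base point; since closed balls of the
  cover are compact, it converts to \<open>properly_deformable\<close>. Time is the first
  coordinate, as in the homotopy lemmas.\<close>

definition proper_deformation ::
  "'v::metric_space set \<Rightarrow> 'v set \<Rightarrow> 'v \<Rightarrow> ('v \<Rightarrow> real) \<Rightarrow> (real \<Rightarrow> 'v) \<Rightarrow> (real \<times> 'v \<Rightarrow> 'v) \<Rightarrow> bool" where
  "proper_deformation C N x0 r \<alpha> h \<longleftrightarrow>
     continuous_on N r \<and> (\<forall>x\<in>N. 0 \<le> r x) \<and> (\<forall>\<rho>. \<exists>R. \<forall>x\<in>N. r x \<le> \<rho> \<longrightarrow> dist x0 x \<le> R) \<and>
     continuous_on {0..} \<alpha> \<and> (\<forall>t\<ge>0. \<alpha> t \<in> C) \<and> (\<forall>\<rho>. \<exists>b. \<forall>t\<ge>0. dist x0 (\<alpha> t) \<le> \<rho> \<longrightarrow> t \<le> b) \<and>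
     continuous_on ({0..1} \<times> N) h \<and> (\<forall>t\<in>{0..1}. \<forall>x\<in>N. h (t, x) \<in> C) \<and>
     (\<forall>x\<in>N. h (0, x) = \<alpha> (r x) \<and> h (1, x) = x) \<and>
     (\<forall>\<rho>. \<exists>R. \<forall>t\<in>{0..1}. \<forall>x\<in>N. dist x0 (h (t, x)) \<le> \<rho> \<longrightarrow> dist x0 x \<le> R)"

lemma proper_deformationD:
  assumes "proper_deformation C N x0 r \<alpha> h"
  shows "continuous_on N r" "\<And>x. x \<in> N \<Longrightarrow> 0 \<le> r x" "\<And>\<rho>. \<exists>R. \<forall>x\<in>N. r x \<le> \<rho> \<longrightarrow> dist x0 x \<le> R"
    "continuous_on {0..} \<alpha>" "\<And>t. 0 \<le> t \<Longrightarrow> \<alpha> t \<in> C" "\<And>\<rho>. \<exists>b. \<forall>t\<ge>0. dist x0 (\<alpha> t) \<le> \<rho> \<longrightarrow> t \<le> b"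
    "continuous_on ({0..1} \<times> N) h" "\<And>t x. t \<in> {0..1} \<Longrightarrow> x \<in> N \<Longrightarrow> h (t, x) \<in> C"
    "\<And>x. x \<in> N \<Longrightarrow> h (0, x) = \<alpha> (r x)" "\<And>x. x \<in> N \<Longrightarrow> h (1, x) = x"
    "\<And>\<rho>. \<exists>R. \<forall>t\<in>{0..1}. \<forall>x\<in>N. dist x0 (h (t, x)) \<le> \<rho> \<longrightarrow> dist x0 x \<le> R"
  using assms unfolding proper_deformation_def by blast+

context contractions
begin

text \<open>The coarse data are pulled back along the discontinuous \<pi>, which moves points by at
  most 2 and so adds at most 4 to distances. The homotopy has three parts: from \<alpha>' \<circ> r'
  to the bottom of \<open>F\<close>, upwards along \<open>F\<close>, and from its top to the
  inclusion. Each part stays close to data whose properness is known.\<close>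

lemma deformation:
  fixes \<pi> :: "'v \<Rightarrow> 'v" and \<alpha> :: "real \<Rightarrow> 'v" and j q :: "'v \<Rightarrow> real" and H :: "'v \<Rightarrow> real \<Rightarrow> 'v"
  assumes col: "colored C D m u l" and x0: "x0 \<in> C"
    and N: "N \<subseteq> C" "\<And>x. x \<in> N \<Longrightarrow> \<pi> x \<in> A" "\<And>x. x \<in> N \<Longrightarrow> dist x (\<pi> x) \<le> 2" and AC: "A \<subseteq> C"
    and \<alpha>: "\<And>t. 0 \<le> t \<Longrightarrow> \<alpha> t \<in> C"
      "\<And>r. \<exists>S. \<forall>s\<ge>0. \<forall>t\<ge>0. \<bar>s - t\<bar> \<le> r \<longrightarrow> dist (\<alpha> s) (\<alpha> t) \<le> S"
      "\<And>r. \<exists>b. \<forall>t\<ge>0. dist x0 (\<alpha> t) \<le> r \<longrightarrow> t \<le> b"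
    and j: "\<And>a. a \<in> A \<Longrightarrow> 0 \<le> j a"
      "\<And>r. \<exists>S. \<forall>a\<in>A. \<forall>a'\<in>A. dist a a' \<le> r \<longrightarrow> \<bar>j a - j a'\<bar> \<le> S"
    and q: "\<And>a. a \<in> A \<Longrightarrow> 0 \<le> q a"
      "\<And>r. \<exists>S. \<forall>a\<in>A. \<forall>a'\<in>A. dist a a' \<le> r \<longrightarrow> \<bar>q a - q a'\<bar> \<le> S"
    and H: "\<And>a t. a \<in> A \<Longrightarrow> 0 \<le> t \<Longrightarrow> t \<le> q a \<Longrightarrow> H a t \<in> C"
      "\<And>r. \<exists>S. \<forall>a\<in>A. \<forall>a'\<in>A. \<forall>t t'. 0 \<le> t \<longrightarrow> t \<le> q a \<longrightarrow> 0 \<le> t' \<longrightarrow> t' \<le> q a' \<longrightarrow>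
         dist a a' \<le> r \<longrightarrow> \<bar>t - t'\<bar> \<le> r \<longrightarrow> dist (H a t) (H a' t') \<le> S"
      "\<And>a. a \<in> A \<Longrightarrow> H a 0 = \<alpha> (j a)" "\<And>a. a \<in> A \<Longrightarrow> H a (q a) = a"
      "\<And>r. \<exists>R. \<forall>a\<in>A. \<forall>t. 0 \<le> t \<longrightarrow> t \<le> q a \<longrightarrow> dist x0 (H a t) \<le> r \<longrightarrow> dist x0 a \<le> R"
  shows "\<exists>r' \<alpha>' h. proper_deformation C N x0 r' \<alpha>' h"
proof -
  interpret R: contractions "{0..}" "{0..}" "\<lambda>y z. (1 - fst z) * snd z + fst z * y" "0::real"
    by (rule contractions_halfline)
  note colN = colored_subset[OF col N(1)]
  note colR = colored_reals[of "{0..}"]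
  note colNR = colored_prod[OF colN colR]
  have \<pi>_dist: "dist (\<pi> x) (\<pi> y) \<le> r + 4" if "x \<in> N" "y \<in> N" "dist x y \<le> r" for x y r
    using dist_triangle[of "\<pi> x" "\<pi> y" x] dist_triangle[of x "\<pi> y" y] N(3)[OF that(1)] N(3)[OF that(2)] that(3)
    by (simp add: dist_commute)
  have \<pi>_x0: "dist x0 x \<le> r + 2" if "x \<in> N" "dist x0 (\<pi> x) \<le> r" for x r
    using dist_triangle[of x0 x "\<pi> x"] N(3)[OF that(1)] that(2) by (simp add: dist_commute)
  obtain Sj where Sj: "\<And>a a'. a \<in> A \<Longrightarrow> a' \<in> A \<Longrightarrow> dist a a' \<le> D + 4 \<Longrightarrow> \<bar>j a - j a'\<bar> \<le> Sj"
    using j(2)[of "D + 4"] by blast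
  have j'1: "j (\<pi> x) \<in> {0..}" if "x \<in> N" for x using j(1)[OF N(2)[OF that]] by simp
  have j'2: "dist (j (\<pi> x)) (j (\<pi> y)) \<le> Sj" if "x \<in> N" "y \<in> N" "dist x y \<le> D" for x y
    using Sj[OF N(2) N(2) \<pi>_dist, OF that(1,2) that] by (simp add: dist_real_def)
  obtain r' Kr where r': "continuous_on N r'" "\<And>x. x \<in> N \<Longrightarrow> r' x \<in> {0..}" "\<And>x. x \<in> N \<Longrightarrow> dist (r' x) (j (\<pi> x)) \<le> Kr"
    by (rule R.approximation[OF colN j'1 j'2]) blast+
  obtain Sq where Sq: "\<And>a a'. a \<in> A \<Longrightarrow> a' \<in> A \<Longrightarrow> dist a a' \<le> D + pi + 4 \<Longrightarrow> \<bar>q a - q a'\<bar> \<le> Sq"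
    using q(2)[of "D + pi + 4"] by blast
  have q': "q (\<pi> x) \<in> {0..}" if "x \<in> N" for x using q(1)[OF N(2)[OF that]] by simp
  have q'': "dist (q (\<pi> x)) (q (\<pi> y)) \<le> Sq" if "x \<in> N" "y \<in> N" "dist x y \<le> D + pi" for x y
    using Sq[OF N(2) N(2) \<pi>_dist, OF that(1,2) that(1,2,3)] by (simp add: dist_real_def)
  have q3: "dist (q (\<pi> x)) (q (\<pi> y)) \<le> Sq" if "x \<in> N" "y \<in> N" "dist x y \<le> D" for x y
    using q''[OF that(1,2)] that(3) pi_gt_zero by linarith
  obtain \<tau>0 Kq where \<tau>0: "continuous_on N \<tau>0" "\<And>x. x \<in> N \<Longrightarrow> \<tau>0 x \<in> {0..}" "\<And>x. x \<in> N \<Longrightarrow> dist (\<tau>0 x) (q (\<pi> x)) \<le> Kq"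
    by (rule R.approximation[OF colN q' q3]) blast+
  \<comment> \<open>A continuous height above q \<circ> \<pi>: the approximation of q \<circ> \<pi>,
    raised by its error.\<close>
  define \<tau> where "\<tau> x = \<tau>0 x + Kq" for x
  have \<tau>: "continuous_on N \<tau>" "q (\<pi> x) \<le> \<tau> x" "0 \<le> \<tau> x" if "x \<in> N" for x
    using \<tau>0(1) \<tau>0(3)[OF that] q'[OF that] unfolding \<tau>_def
    by (auto intro!: continuous_intros simp: dist_real_def abs_le_iff)
  obtain S\<alpha> where S\<alpha>: "\<And>s t. 0 \<le> s \<Longrightarrow> 0 \<le> t \<Longrightarrow> \<bar>s - t\<bar> \<le> pi \<Longrightarrow> dist (\<alpha> s) (\<alpha> t) \<le> S\<alpha>"
    using \<alpha>(2)[of pi] by blast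
  have \<alpha>C1: "\<alpha> t \<in> C" if "t \<in> {0..}" for t using \<alpha>(1) that by simp
  have \<alpha>C2: "dist (\<alpha> t) (\<alpha> s) \<le> S\<alpha>" if "t \<in> {0..}" "s \<in> {0..}" "dist t s \<le> pi" for t s
    using S\<alpha> that by (simp add: dist_real_def)
  obtain \<alpha>' K\<alpha> where \<alpha>': "continuous_on {0..} \<alpha>'" "\<And>t. t \<in> {0..} \<Longrightarrow> \<alpha>' t \<in> C" "\<And>t. t \<in> {0..} \<Longrightarrow> dist (\<alpha>' t) (\<alpha> t) \<le> K\<alpha>"
    by (rule approximation[OF colR \<alpha>C1 \<alpha>C2]) blast+
  \<comment> \<open>Above the height q the homotopy is frozen at its end. This extends it to N
    \<times> [0,\<infinity>), so that nothing has to be approximated over a region with a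
    discontinuous upper boundary.\<close>
  define H' where "H' = (\<lambda>z. H (\<pi> (fst z)) (min (snd z) (q (\<pi> (fst z)))))"
  have H'C: "H' z \<in> C" if "z \<in> N \<times> {0..}" for z
    using that q' N(2) unfolding H'_def by (intro H(1)) (auto simp: mem_Times_iff min_def)
  \<comment> \<open>The radius allows for \<pi>, which adds 4, and for the truncation at q, which
    itself varies by at most \<open>Sq\<close>.\<close>
  obtain SH where SH: "\<And>a a' t t'. a \<in> A \<Longrightarrow> a' \<in> A \<Longrightarrow> 0 \<le> t \<Longrightarrow> t \<le> q a \<Longrightarrow> 0 \<le> t' \<Longrightarrow> t' \<le> q a' \<Longrightarrow>
         dist a a' \<le> max (D + pi + 4) Sq \<Longrightarrow> \<bar>t - t'\<bar> \<le> max (D + pi + 4) Sq \<Longrightarrow> dist (H a t) (H a' t') \<le> SH"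
    using H(2)[of "max (D + pi + 4) Sq"] by blast
  have H'_dist: "dist (H' z) (H' z') \<le> SH" if z: "z \<in> N \<times> {0..}" "z' \<in> N \<times> {0..}" "dist z z' \<le> D + pi" for z z'
  proof -
    have zN: "fst z \<in> N" "fst z' \<in> N" "0 \<le> snd z" "0 \<le> snd z'" using z by (auto simp: mem_Times_iff)
    have d: "dist (fst z) (fst z') \<le> D + pi" "\<bar>snd z - snd z'\<bar> \<le> D + pi"
      using dist_fst_le[of z z'] dist_snd_le[of z z'] z(3) by (auto simp: dist_real_def)
    have dq: "\<bar>q (\<pi> (fst z)) - q (\<pi> (fst z'))\<bar> \<le> Sq" using q''[OF zN(1,2) d(1)] by (simp add: dist_real_def)
    show ?thesis unfolding H'_def
    proof (rule SH)
      show "dist (\<pi> (fst z)) (\<pi> (fst z')) \<le> max (D + pi + 4) Sq" using \<pi>_dist[OF zN(1,2) d(1)] by simp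
      show "\<bar>min (snd z) (q (\<pi> (fst z))) - min (snd z') (q (\<pi> (fst z')))\<bar> \<le> max (D + pi + 4) Sq"
        using d(2) dq by (auto simp: min_def max_def abs_le_iff)
    qed (use zN N(2) q' in \<open>auto simp: min_def\<close>)
  qed
  obtain F KF where F: "continuous_on (N \<times> {0..}) F" "\<And>z. z \<in> N \<times> {0..} \<Longrightarrow> F z \<in> C"
    "\<And>z. z \<in> N \<times> {0..} \<Longrightarrow> dist (F z) (H' z) \<le> KF"
    by (rule approximation[OF colNR H'C H'_dist]) blast+
  obtain S1 where S1: "\<And>s t. 0 \<le> s \<Longrightarrow> 0 \<le> t \<Longrightarrow> \<bar>s - t\<bar> \<le> max Sj Kr \<Longrightarrow> dist (\<alpha> s) (\<alpha> t) \<le> S1"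
    using \<alpha>(2)[of "max Sj Kr"] by blast
  have F0: "dist (F (x, 0)) (\<alpha> (j (\<pi> x))) \<le> KF" if "x \<in> N" for x
    using F(3)[of "(x, 0)"] that q'[OF that] H(3)[OF N(2)[OF that]] by (simp add: H'_def)
  have F\<tau>: "dist (F (x, \<tau> x)) (\<pi> x) \<le> KF" if "x \<in> N" for x
    using F(3)[of "(x, \<tau> x)"] that \<tau>[OF that] H(4)[OF N(2)[OF that]] by (simp add: H'_def min_absorb2)
  \<comment> \<open>Both ends are close to \<alpha> \<circ> j \<circ> \<pi>, which is also H' at
    height 0.\<close>
  obtain h1 K1 where h1: "continuous_on ({0..1::real} \<times> N) h1" "\<And>t x. t \<in> {0..1} \<Longrightarrow> x \<in> N \<Longrightarrow> h1 (t, x) \<in> C"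
    "\<And>x. x \<in> N \<Longrightarrow> h1 (0, x) = \<alpha>' (r' x)" "\<And>x. x \<in> N \<Longrightarrow> h1 (1, x) = F (x, 0)"
    "\<And>t x. t \<in> {0..1} \<Longrightarrow> x \<in> N \<Longrightarrow> dist (h1 (t, x)) (\<alpha> (j (\<pi> x))) \<le> K1"
  proof (rule homotopic_close[OF colN, where G = "\<lambda>x. \<alpha> (j (\<pi> x))" and f = "\<lambda>x. \<alpha>' (r' x)" and g = "\<lambda>x. F (x, 0)"
        and K = "max (K\<alpha> + S1) KF" and ?D1.0 = S1])
    show "continuous_on N (\<lambda>x. \<alpha>' (r' x))" by (rule continuous_on_compose2[OF \<alpha>'(1) r'(1)]) (use r'(2) in auto)
    show "continuous_on N (\<lambda>x. F (x, 0))"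
      by (rule continuous_on_compose2[OF F(1)]) (auto intro!: continuous_intros)
    fix x assume x: "x \<in> N"
    show "\<alpha> (j (\<pi> x)) \<in> C" using \<alpha>C1[OF j'1[OF x]] .
    show "\<alpha>' (r' x) \<in> C" using \<alpha>'(2) r'(2) x by auto
    show "F (x, 0) \<in> C" using F(2) x by auto
    have "dist (\<alpha> (r' x)) (\<alpha> (j (\<pi> x))) \<le> S1"
      using r'(2,3)[OF x] j'1[OF x] by (intro S1) (auto simp: dist_real_def)
    then show "dist (\<alpha>' (r' x)) (\<alpha> (j (\<pi> x))) \<le> max (K\<alpha> + S1) KF"
      using dist_triangle[of "\<alpha>' (r' x)" "\<alpha> (j (\<pi> x))" "\<alpha> (r' x)"] \<alpha>'(3)[OF r'(2)[OF x]] by linarith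
    show "dist (F (x, 0)) (\<alpha> (j (\<pi> x))) \<le> max (K\<alpha> + S1) KF" using F0[OF x] by simp
    fix y assume y: "y \<in> N" "dist x y \<le> D"
    show "dist (\<alpha> (j (\<pi> x))) (\<alpha> (j (\<pi> y))) \<le> S1"
      using j'1[OF x] j'1[OF y(1)] j'2[OF x y] by (intro S1) (auto simp: dist_real_def)
  qed blast
  \<comment> \<open>At height \<tau> the map H' has reached \<pi> x, so the top of \<open>F\<close>
    and the inclusion are both close to \<pi>.\<close>
  obtain h3 K3 where h3: "continuous_on ({0..1::real} \<times> N) h3" "\<And>t x. t \<in> {0..1} \<Longrightarrow> x \<in> N \<Longrightarrow> h3 (t, x) \<in> C"
    "\<And>x. x \<in> N \<Longrightarrow> h3 (0, x) = F (x, \<tau> x)" "\<And>x. x \<in> N \<Longrightarrow> h3 (1, x) = x"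
    "\<And>t x. t \<in> {0..1} \<Longrightarrow> x \<in> N \<Longrightarrow> dist (h3 (t, x)) (\<pi> x) \<le> K3"
  proof (rule homotopic_close[OF colN, where G = \<pi> and f = "\<lambda>x. F (x, \<tau> x)" and g = "\<lambda>x. x"
        and K = "max 2 KF" and ?D1.0 = "D + 4"])
    show "continuous_on N (\<lambda>x. F (x, \<tau> x))"
    proof (cases "N = {}")
      case False
      then have "continuous_on N (\<lambda>x. (x, \<tau> x))" using \<tau>(1) by (auto intro!: continuous_intros)
      then show ?thesis by (rule continuous_on_compose2[OF F(1)]) (use \<tau>(3) in auto)
    qed simp
    fix x assume x: "x \<in> N"
    show "\<pi> x \<in> C" using N(2)[OF x] AC by blast
    show "F (x, \<tau> x) \<in> C" using F(2) x \<tau>(3)[OF x] by auto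
    show "x \<in> C" using x N(1) by blast
    show "dist (F (x, \<tau> x)) (\<pi> x) \<le> max 2 KF" using F\<tau>[OF x] by simp
    show "dist x (\<pi> x) \<le> max 2 KF" using N(3)[OF x] by simp
    show "dist (\<pi> x) (\<pi> y) \<le> D + 4" if "y \<in> N" "dist x y \<le> D" for y using \<pi>_dist[OF x that] .
  qed (auto intro: continuous_intros)
  define h2 where "h2 = (\<lambda>(t::real, x). F (x, t * \<tau> x))"
  have h2c: "continuous_on ({0..1} \<times> N) h2"
  proof (cases "N = {}")
    case False
    then have "continuous_on N \<tau>" using \<tau>(1) by blast
    then have "continuous_on ({0..1::real} \<times> N) (\<lambda>z. \<tau> (snd z))"
      by (rule continuous_on_compose2) (auto intro!: continuous_intros)
    then have "continuous_on ({0..1::real} \<times> N) (\<lambda>z. (snd z, fst z * \<tau> (snd z)))"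
      by (intro continuous_intros)
    then show ?thesis unfolding h2_def split_beta
      by (rule continuous_on_compose2[OF F(1)]) (use \<tau>(3) in auto)
  qed simp
  have h2C: "h2 (t, x) \<in> C" "dist (h2 (t, x)) (H' (x, t * \<tau> x)) \<le> KF" if "t \<in> {0..1}" "x \<in> N" for t x
    using F(2,3)[of "(x, t * \<tau> x)"] that \<tau>(3)[OF that(2)] by (auto simp: h2_def)
  obtain k where k: "continuous_on ({0..1::real} \<times> N) k" "\<And>x. x \<in> N \<Longrightarrow> k (0, x) = h1 (0, x) \<and> k (1, x) = h2 (1, x)"
     "\<And>t x. t \<in> {0..1} \<Longrightarrow> x \<in> N \<Longrightarrow> \<exists>s\<in>{0..1}. k (t, x) = h1 (s, x) \<or> k (t, x) = h2 (s, x)"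
    using homotopy_join[OF h1(1) h2c] h1(4) by (auto simp: h2_def)
  obtain h where h: "continuous_on ({0..1::real} \<times> N) h" "\<And>x. x \<in> N \<Longrightarrow> h (0, x) = k (0, x) \<and> h (1, x) = h3 (1, x)"
     "\<And>t x. t \<in> {0..1} \<Longrightarrow> x \<in> N \<Longrightarrow> \<exists>s\<in>{0..1}. h (t, x) = k (s, x) \<or> h (t, x) = h3 (s, x)"
    using homotopy_join[OF k(1) h3(1)] k(2) h3(3) by (auto simp: h2_def)
  have h_cases: "\<exists>s\<in>{0..1}. h (t, x) = h1 (s, x) \<or> h (t, x) = h2 (s, x) \<or> h (t, x) = h3 (s, x)"
    if "t \<in> {0..1}" "x \<in> N" for t x
    using h(3)[OF that] k(3)[OF _ that(2)] by metis
  \<comment> \<open>Properness of \<open>H\<close> over \<open>A\<close> turns into properness over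
    \<open>N\<close>; the bound grows by 2, the distance from x to \<pi> x.\<close>
  have HR: "\<exists>R. \<forall>x\<in>N. \<forall>t. 0 \<le> t \<longrightarrow> t \<le> q (\<pi> x) \<longrightarrow> dist x0 (H (\<pi> x) t) \<le> r \<longrightarrow> dist x0 x \<le> R" for r
  proof -
    obtain R where R: "\<And>a t. a \<in> A \<Longrightarrow> 0 \<le> t \<Longrightarrow> t \<le> q a \<Longrightarrow> dist x0 (H a t) \<le> r \<Longrightarrow> dist x0 a \<le> R"
      using H(5)[of r] by blast
    show ?thesis using R[OF N(2)] \<pi>_x0 by (intro exI[of _ "R + 2"]) blast
  qed
  have H0: "H (\<pi> x) 0 = \<alpha> (j (\<pi> x))" if "x \<in> N" for x using H(3)[OF N(2)[OF that]] .
  show ?thesis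
    unfolding proper_deformation_def
  proof (intro exI[of _ r'] exI[of _ \<alpha>'] exI[of _ h] conjI ballI allI impI)
    show "continuous_on N r'" "continuous_on {0..} \<alpha>'" "continuous_on ({0..1} \<times> N) h" by fact+
    show "0 \<le> r' x" if "x \<in> N" for x using r'(2)[OF that] by simp
    show "\<alpha>' t \<in> C" if "0 \<le> t" for t using \<alpha>'(2) that by simp
    show "h (t, x) \<in> C" if "t \<in> {0..1}" "x \<in> N" for t x
      using h_cases[OF that] h1(2) h2C(1) h3(2) that(2) by metis
    show "h (0, x) = \<alpha>' (r' x)" "h (1, x) = x" if "x \<in> N" for x
      using h(2)[OF that] k(2)[OF that] h1(3)[OF that] h3(4)[OF that] by auto
    fix \<rho>
    \<comment> \<open>A bound on r' x bounds \<alpha> (j (\<pi> x)), which is the value of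
      \<open>H\<close> at height 0, and \<open>HR\<close> applies.\<close>
    show "\<exists>R. \<forall>x\<in>N. r' x \<le> \<rho> \<longrightarrow> dist x0 x \<le> R"
    proof -
      obtain S where S: "\<And>s t. 0 \<le> s \<Longrightarrow> 0 \<le> t \<Longrightarrow> \<bar>s - t\<bar> \<le> \<rho> + Kr \<Longrightarrow> dist (\<alpha> s) (\<alpha> t) \<le> S"
        using \<alpha>(2)[of "\<rho> + Kr"] by blast
      obtain R where R: "\<And>x t. x \<in> N \<Longrightarrow> 0 \<le> t \<Longrightarrow> t \<le> q (\<pi> x) \<Longrightarrow> dist x0 (H (\<pi> x) t) \<le> dist x0 (\<alpha> 0) + S \<Longrightarrow> dist x0 x \<le> R"
        using HR[of "dist x0 (\<alpha> 0) + S"] by blast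
      have "dist x0 x \<le> R" if x: "x \<in> N" "r' x \<le> \<rho>" for x
      proof (rule R[OF x(1), of 0])
        have "dist (\<alpha> 0) (\<alpha> (j (\<pi> x))) \<le> S"
          using r'(3)[OF x(1)] x(2) j'1[OF x(1)] by (intro S) (auto simp: dist_real_def)
        then show "dist x0 (H (\<pi> x) 0) \<le> dist x0 (\<alpha> 0) + S"
          using dist_triangle[of x0 "\<alpha> (j (\<pi> x))" "\<alpha> 0"] H0[OF x(1)] by simp
      qed (use q'[OF x(1)] in auto)
      then show ?thesis by blast
    qed
    show "\<exists>b. \<forall>t\<ge>0. dist x0 (\<alpha>' t) \<le> \<rho> \<longrightarrow> t \<le> b"
    proof -
      obtain b where b: "\<And>t. 0 \<le> t \<Longrightarrow> dist x0 (\<alpha> t) \<le> \<rho> + K\<alpha> \<Longrightarrow> t \<le> b" using \<alpha>(3)[of "\<rho> + K\<alpha>"] by blast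
      have "t \<le> b" if "0 \<le> t" "dist x0 (\<alpha>' t) \<le> \<rho>" for t
        using b[OF that(1)] dist_triangle[of x0 "\<alpha> t" "\<alpha>' t"] \<alpha>'(3)[of t] that by simp
      then show ?thesis by blast
    qed
    show "\<exists>R. \<forall>t\<in>{0..1}. \<forall>x\<in>N. dist x0 (h (t, x)) \<le> \<rho> \<longrightarrow> dist x0 x \<le> R"
    proof -
      obtain R1 where R1: "\<And>x t. x \<in> N \<Longrightarrow> 0 \<le> t \<Longrightarrow> t \<le> q (\<pi> x) \<Longrightarrow> dist x0 (H (\<pi> x) t) \<le> \<rho> + K1 \<Longrightarrow> dist x0 x \<le> R1"
        using HR[of "\<rho> + K1"] by blast
      obtain R2 where R2: "\<And>x t. x \<in> N \<Longrightarrow> 0 \<le> t \<Longrightarrow> t \<le> q (\<pi> x) \<Longrightarrow> dist x0 (H (\<pi> x) t) \<le> \<rho> + KF \<Longrightarrow> dist x0 x \<le> R2"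
        using HR[of "\<rho> + KF"] by blast
      have "dist x0 x \<le> max (max R1 R2) (\<rho> + K3 + 2)" if tx: "t \<in> {0..1}" "x \<in> N" "dist x0 (h (t, x)) \<le> \<rho>" for t x
      proof -
        obtain s where s: "s \<in> {0..1}" "h (t, x) = h1 (s, x) \<or> h (t, x) = h2 (s, x) \<or> h (t, x) = h3 (s, x)"
          using h_cases[OF tx(1,2)] by blast
        note q0 = q'[OF tx(2)]
        consider "h (t, x) = h1 (s, x)" | "h (t, x) = h2 (s, x)" | "h (t, x) = h3 (s, x)" using s(2) by blast
        then show ?thesis
        proof cases
          case 1
          then have "dist x0 (H (\<pi> x) 0) \<le> \<rho> + K1"
            using dist_triangle[of x0 "\<alpha> (j (\<pi> x))" "h (t, x)"] h1(5)[OF s(1) tx(2)] tx(3) H0[OF tx(2)] by simp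
          then have "dist x0 x \<le> R1" using q0 by (intro R1[OF tx(2), of 0]) auto
          then show ?thesis by simp
        next
          case 2
          let ?t = "min (s * \<tau> x) (q (\<pi> x))"
          have "dist x0 (H (\<pi> x) ?t) \<le> \<rho> + KF"
            using dist_triangle[of x0 "H' (x, s * \<tau> x)" "h (t, x)"] h2C(2)[OF s(1) tx(2)] tx(3) 2 by (simp add: H'_def)
          then have "dist x0 x \<le> R2" using q0 s(1) \<tau>(3)[OF tx(2)] by (intro R2[OF tx(2), of ?t]) auto
          then show ?thesis by simp
        next
          case 3
          then have "dist x0 (\<pi> x) \<le> \<rho> + K3"
            using dist_triangle[of x0 "\<pi> x" "h (t, x)"] h3(5)[OF s(1) tx(2)] tx(3) by simp
          then show ?thesis using \<pi>_x0[OF tx(2)] by fastforce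
        qed
      qed
      then show ?thesis by blast
    qed
  qed
qed

end

section \<open>Properness criteria and bounded sets\<close>

lemma tproperI:
  assumes f: "continuous_map X Y f" and "Hausdorff_space Y"
    and L: "\<And>K. compactin Y K \<Longrightarrow> \<exists>L. compactin X L \<and> {x \<in> topspace X. f x \<in> K} \<subseteq> L"
  shows "tproper X Y f"
  unfolding tproper_def
proof (intro conjI allI impI f)
  fix K assume K: "compactin Y K"
  then obtain L where "compactin X L" "{x \<in> topspace X. f x \<in> K} \<subseteq> L" using L by blast
  moreover have "closedin X {x \<in> topspace X. f x \<in> K}"
    using closedin_continuous_map_preimage[OF f] compactin_imp_closedin[OF assms(2) K] by blast
  ultimately show "compactin X {x \<in> topspace X. f x \<in> K}" by (rule closed_compactin)
qed

lemma Hausdorff_Rplus: "Hausdorff_space Rplus_top"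
  by (simp add: Rplus_top_def Hausdorff_space_subtopology)


lemma compactin_Rplus_bounded:
  assumes "compactin Rplus_top K" obtains b where "\<And>t. t \<in> K \<Longrightarrow> t \<le> b"
proof -
  have "bounded K" using assms by (auto simp: Rplus_top_def compactin_subtopology compact_imp_bounded)
  then show thesis using that by (metis bounded_iff real_norm_def abs_le_D1)
qed

text \<open>Control for every real radius and with non-strict bounds; passing to |r| + 1 meets the
  strict, positive form of the definition.\<close>

lemma controlledD:
  assumes "controlled M d N e f"
  obtains S where "\<And>x x'. x \<in> M \<Longrightarrow> x' \<in> M \<Longrightarrow> d x x' \<le> r \<Longrightarrow> e (f x) (f x') \<le> S"
proof -
  have "\<bar>r\<bar> + 1 > 0" by linarith
  then obtain S where S: "\<forall>x\<in>M. \<forall>x'\<in>M. d x x' < \<bar>r\<bar> + 1 \<longrightarrow> e (f x) (f x') < S"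
    using assms unfolding controlled_def by meson
  have "e (f x) (f x') \<le> S" if "x \<in> M" "x' \<in> M" "d x x' \<le> r" for x x'
  proof -
    have "d x x' < \<bar>r\<bar> + 1" using that(3) by linarith
    then show ?thesis using S that(1,2) less_imp_le by blast
  qed
  with that show thesis by blast
qed

context lifted_geodesic
begin

lemma mbdd_ball: "mbdd (topspace E) dE {y \<in> topspace E. dE x y \<le> r}"
  unfolding mbdd_def by auto

text \<open>The definition of boundedness allows a centre outside the space, where nothing is known about
  \<open>dE\<close>. Since a coarse homotopy ends at the identity, its properness with respect to this weaker
  notion of boundedness nevertheless implies metric properness.\<close>

lemma coarse_homotopy_proper:
  assumes A: "A \<subseteq> topspace E"
    and H: "coarse (Iq A q) (supdist dE) (topspace E) dE H"
    and q: "\<And>a. a \<in> A \<Longrightarrow> 0 \<le> q a" and Hq: "\<And>a. a \<in> A \<Longrightarrow> H (a, q a) = a"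
    and x: "x \<in> topspace E"
  obtains R where "\<And>a t. a \<in> A \<Longrightarrow> 0 \<le> t \<Longrightarrow> t \<le> q a \<Longrightarrow> dE x (H (a, t)) \<le> r \<Longrightarrow> dE x a \<le> R"
proof -
  have c: "controlled (Iq A q) (supdist dE) (topspace E) dE H" and m: "mproper (Iq A q) (supdist dE) (topspace E) dE H"
    using H by (auto simp: coarse_def)
  have HE: "H z \<in> topspace E" if "z \<in> Iq A q" for z using c that by (auto simp: controlled_def)
  have pre: "\<exists>z b. \<forall>y\<in>{z \<in> Iq A q. H z \<in> S}. supdist dE z y \<le> b" if "mbdd (topspace E) dE S" for S
    using m that unfolding mproper_def mbdd_def by blast
  obtain z1 b1 where z1: "\<And>y. y \<in> Iq A q \<Longrightarrow> H y \<in> {y \<in> topspace E. dE x y \<le> r} \<Longrightarrow> supdist dE z1 y \<le> b1"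
    using pre[OF mbdd_ball] by blast
  \<comment> \<open>This set counts as bounded even if \<open>fst z1\<close> lies outside the space,
    so properness can be used again, now at the end (a, q a) of the track, which is mapped to a.
    From the new centre only the real coordinate is used: it bounds q a, and control then compares H
    (a, t) with a.\<close>
  let ?T = "{y \<in> topspace E. dE (fst z1) y \<le> b1}"
  obtain z2 b2 where z2: "\<And>y. y \<in> Iq A q \<Longrightarrow> H y \<in> ?T \<Longrightarrow> supdist dE z2 y \<le> b2"
    using pre[OF mbdd_ball] by blast
  let ?c = "\<bar>snd z2\<bar> + \<bar>b2\<bar>"
  obtain S where S: "\<And>z z'. z \<in> Iq A q \<Longrightarrow> z' \<in> Iq A q \<Longrightarrow> supdist dE z z' \<le> ?c \<Longrightarrow> dE (H z) (H z') \<le> S"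
    using controlledD[OF c, of ?c] by blast
  show thesis
  proof (rule that[of "r + S"])
    fix a t assume a: "a \<in> A" and t: "0 \<le> t" "t \<le> q a" and d: "dE x (H (a, t)) \<le> r"
    have aE: "a \<in> topspace E" using a A by blast
    have I: "(a, t) \<in> Iq A q" "(a, q a) \<in> Iq A q" using a t q[OF a] by (auto simp: Iq_def)
    have "supdist dE z1 (a, t) \<le> b1" using z1[OF I(1)] d HE[OF I(1)] by simp
    then have "a \<in> ?T" using aE by (simp add: supdist_def)
    then have "supdist dE z2 (a, q a) \<le> b2" using z2[OF I(2)] Hq[OF a] by simp
    then have "\<bar>snd z2 - q a\<bar> \<le> b2" by (simp add: supdist_def)
    then have "q a \<le> ?c" by linarith
    then have "supdist dE (a, t) (a, q a) \<le> ?c" using t q[OF a] by (auto simp: supdist_def dE_refl[OF aE])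
    then have "dE (H (a, t)) a \<le> S" using S[OF I] Hq[OF a] by simp
    then show "dE x a \<le> r + S" using dE_triangle[OF x HE[OF I(1)] aE] d by linarith
  qed
qed

lemma Hausdorff_E: "Hausdorff_space E"
  using ME.Hausdorff_space_mtopology mtopology_E by simp

lemma compactin_E_bounded:
  assumes "compactin E K" "x \<in> topspace E" obtains \<rho> where "\<And>y. y \<in> K \<Longrightarrow> dE x y \<le> \<rho>"
proof -
  have "ME.mbounded (insert x K)"
    using ME.compactin_imp_mbounded[of K] assms ME.mbounded_insert by (simp add: mtopology_E)
  then obtain \<rho> where "\<And>y z. y \<in> insert x K \<Longrightarrow> z \<in> insert x K \<Longrightarrow> dd y z \<le> \<rho>"
    unfolding ME.mbounded_alt by blast
  then show thesis using that[of \<rho>] compactin_subset_topspace[OF assms(1)] assms(2) by (force simp: dd_def)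
qed

text \<open>The radius 1 is an arbitrary choice. It puts the closure within distance 2 of
  \<open>A\<close>, which is the 2 in \<open>deformation\<close>.\<close>

definition nbhd :: "'a set \<Rightarrow> 'a set" where "nbhd A = (\<Union>a\<in>A. ME.mball a 1)"

lemma openin_nbhd: "openin E (nbhd A)"
  unfolding nbhd_def using ME.openin_mball mtopology_E by (intro openin_Union) auto

lemma subset_nbhd: "A \<subseteq> topspace E \<Longrightarrow> A \<subseteq> nbhd A"
  unfolding nbhd_def by auto

lemma closure_nbhd:
  assumes "x \<in> E closure_of (nbhd A)" obtains a where "a \<in> A" "dE x a \<le> 2"
proof -
  have x: "x \<in> topspace E" using assms by (meson in_closure_of)
  have "openin E (ME.mball x 1)" using ME.openin_mball mtopology_E by auto
  moreover have "x \<in> ME.mball x 1" using x by simp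
  ultimately obtain y where y: "y \<in> nbhd A" "y \<in> ME.mball x 1"
    using assms unfolding in_closure_of by blast
  then obtain a where a: "a \<in> A" "y \<in> ME.mball a 1" by (auto simp: nbhd_def)
  have "dd x a \<le> 2" using ME.triangle''[of x y a] ME.triangle[of x y a] a(2) y(2) ME.commute[of y a] by auto
  then show thesis using that[OF a(1)] a x by (auto simp: dd_def)
qed

end

section \<open>Coarsely categorical sets have properly categorical neighbourhoods\<close>

context embedded
begin

lemma colored_C: "\<exists>D m u (l :: nat \<Rightarrow> 'v \<Rightarrow> 'a set). colored C D m u l"
proof -
  obtain m D and u :: "nat \<Rightarrow> 'a \<Rightarrow> real" and l :: "nat \<Rightarrow> 'a \<Rightarrow> 'a set" where
    u: "\<And>j. j < m \<Longrightarrow> continuous_map E euclideanreal (u j)"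
    "\<And>j x. j < m \<Longrightarrow> x \<in> topspace E \<Longrightarrow> 0 \<le> u j x \<and> u j x \<le> 1"
    "\<And>j x. j < m \<Longrightarrow> x \<in> topspace E \<Longrightarrow> u j x > 0 \<Longrightarrow>
        \<exists>W. openin E W \<and> x \<in> W \<and> (\<forall>z\<in>W. l j z = l j x)"
    "\<And>j x y. j < m \<Longrightarrow> x \<in> topspace E \<Longrightarrow> y \<in> topspace E \<Longrightarrow> u j x > 0 \<Longrightarrow> u j y > 0 \<Longrightarrow>
        l j x = l j y \<Longrightarrow> dE x y \<le> D"
    "\<And>x. x \<in> topspace E \<Longrightarrow> \<exists>j<m. u j x = 1"
    by (rule coloring_E) blast
  have "colored C D m (\<lambda>j. u j \<circ> gE) (\<lambda>j. l j \<circ> gE)"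
  proof (rule coloredI)
    fix j assume j: "j < m"
    show "continuous_on C (u j \<circ> gE)" using continuous_map_compose[OF cont_gE u(1)[OF j]] by simp
    fix y assume y: "y \<in> C"
    show "0 \<le> (u j \<circ> gE) y \<and> (u j \<circ> gE) y \<le> 1" using u(2)[OF j E_rules(2)[OF y]] by simp
    {
      assume "0 < (u j \<circ> gE) y"
      then obtain W where W: "openin E W" "gE y \<in> W" "\<forall>z\<in>W. l j z = l j (gE y)"
        using u(3)[OF j E_rules(2)[OF y]] by auto
      show "\<exists>W. openin (top_of_set C) W \<and> y \<in> W \<and> (\<forall>z\<in>W. (l j \<circ> gE) z = (l j \<circ> gE) y)"
      proof (intro exI conjI ballI)
        show "openin (top_of_set C) (eE ` W)" using W(1) by (rule openin_C)
        show "y \<in> eE ` W" using W(2) y by (metis E_rules(4) imageI)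
        fix z assume "z \<in> eE ` W"
        then obtain w where "w \<in> W" "z = eE w" by blast
        then show "(l j \<circ> gE) z = (l j \<circ> gE) y" using W(3) openin_subset[OF W(1)] by (auto simp: subset_iff)
      qed
    }
    fix z assume "z \<in> C" "0 < (u j \<circ> gE) y" "0 < (u j \<circ> gE) z" "(l j \<circ> gE) y = (l j \<circ> gE) z"
    then show "dist y z \<le> D" using u(4)[OF j E_rules(2)[OF y] E_rules(2)] y by (simp add: dist_C)
  next
    fix y assume "y \<in> C"
    then show "\<exists>j<m. (u j \<circ> gE) y = 1" using u(5)[OF E_rules(2)] by simp
  qed
  then show ?thesis by blast
qed

text \<open>The closure of \<open>nbhd A\<close> is the closed neighbourhood to be deformed: its
  points are within 2 of \<open>A\<close>, so \<open>deformation\<close> applies to the copies of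
  the data under the embeddings, and the result is carried back to \<open>E\<close>.\<close>

lemma coarsely_categorical_imp_properly_categorical:
  assumes CW: "finite_CW B" and asph: "aspherical B" and sc: "simply_connected_sp E"
    and cat: "coarsely_categorical (topspace E) dE A"
  shows "properly_categorical E (nbhd A)"
proof -
  obtain \<alpha> j where AE: "A \<subseteq> topspace E" and \<alpha>: "coarse Rplus rdist (topspace E) dE \<alpha>" and j: "coarse A dE Rplus rdist j"
    and hom: "coarsely_homotopic A dE (topspace E) dE (\<alpha> \<circ> j) (\<lambda>x. x)"
    using cat unfolding coarsely_categorical_def by blast
  obtain q H where q: "coarse A dE Rplus rdist q" and H: "coarse (Iq A q) (supdist dE) (topspace E) dE H"
    and H01: "\<And>x. x \<in> A \<Longrightarrow> H (x, 0) = \<alpha> (j x) \<and> H (x, q x) = x"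
    using hom unfolding coarsely_homotopic_def by auto
  have \<alpha>E: "\<alpha> t \<in> topspace E" if "0 \<le> t" for t
    using \<alpha> that by (auto simp: coarse_def controlled_def Rplus_def)
  have q0: "0 \<le> q a" and j0: "0 \<le> j a" if "a \<in> A" for a
    using q j that by (auto simp: coarse_def controlled_def Rplus_def)
  have HE: "H (a, t) \<in> topspace E" if "a \<in> A" "0 \<le> t" "t \<le> q a" for a t
    using H that by (auto simp: coarse_def controlled_def Iq_def)
  \<comment> \<open>The map from the half-line supplies a base point even when \<open>A\<close> is
    empty.\<close>
  define e0 where "e0 = \<alpha> 0"
  have e0: "e0 \<in> topspace E" using \<alpha>E[of 0] by (simp add: e0_def)
  define x0 where "x0 = eE e0"
  have x0: "x0 \<in> C" using e0 by (simp add: x0_def)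
  obtain D0 where D0: "\<And>x s. x \<in> C \<Longrightarrow> s \<in> S \<Longrightarrow> \<exists>y\<in>C. P y = s \<and> dist x y \<le> D0"
    by (rule near_fibre_C) blast
  obtain \<sigma> :: "'v \<Rightarrow> real \<times> 'v \<Rightarrow> 'v" where \<sigma>:
    "\<And>y. y \<in> C \<Longrightarrow> P y = P x0 \<Longrightarrow> continuous_on ({0..1} \<times> C) (\<sigma> y)"
    "\<And>y t x. y \<in> C \<Longrightarrow> P y = P x0 \<Longrightarrow> t \<in> {0..1} \<Longrightarrow> x \<in> C \<Longrightarrow> \<sigma> y (t, x) \<in> C"
    "\<And>y x. y \<in> C \<Longrightarrow> P y = P x0 \<Longrightarrow> x \<in> C \<Longrightarrow> \<sigma> y (0, x) = x"
    "\<And>y x. y \<in> C \<Longrightarrow> P y = P x0 \<Longrightarrow> x \<in> C \<Longrightarrow> \<sigma> y (1, x) = y"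
    "\<And>R. \<exists>R'. \<forall>y\<in>C. P y = P x0 \<longrightarrow> (\<forall>x\<in>C. \<forall>t\<in>{0..1}. dist x y \<le> R \<longrightarrow> dist (\<sigma> y (t, x)) y \<le> R')"
    by (rule uniform_contractions[OF CW asph sc x0]) blast
  \<comment> \<open>The targets form the fibre through \<open>x0\<close>; by
    \<open>near_fibre_C\<close> it is coarsely dense in \<open>C\<close>.\<close>
  interpret contractions C "{y \<in> C. P y = P x0}" \<sigma> D0
  proof
    fix R
    obtain R' where "\<forall>y\<in>C. P y = P x0 \<longrightarrow> (\<forall>x\<in>C. \<forall>t\<in>{0..1}. dist x y \<le> R \<longrightarrow> dist (\<sigma> y (t, x)) y \<le> R')"
      using \<sigma>(5)[of R] by blast
    then show "\<exists>R'. \<forall>y\<in>{y \<in> C. P y = P x0}. \<forall>x\<in>C. \<forall>t\<in>{0..1}. dist x y \<le> R \<longrightarrow> dist (\<sigma> y (t, x)) y \<le> R'"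
      by (intro exI[of _ R']) blast
  next
    fix x assume "x \<in> C"
    then show "\<exists>y\<in>{y \<in> C. P y = P x0}. dist x y \<le> D0" using D0[OF _ P_in[OF x0]] by blast
  qed (use \<sigma>(1-4) in auto)
  obtain D m u and l :: "nat \<Rightarrow> 'v \<Rightarrow> 'a set" where col: "colored C D m u l" using colored_C by blast
  define N where "N = E closure_of (nbhd A)"
  have N_closed: "closedin E N" and NE: "N \<subseteq> topspace E"
    unfolding N_def by (auto simp: closure_of_subset_topspace)
  have "\<exists>a\<in>A. dE x a \<le> 2" if "x \<in> N" for x
    using closure_nbhd[of x A] that unfolding N_def by blast
  then obtain \<pi>' where \<pi>': "\<And>x. x \<in> N \<Longrightarrow> \<pi>' x \<in> A \<and> dE x (\<pi>' x) \<le> 2" by metis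
  define NC AC where "NC = eE ` N" and "AC = eE ` A"
  have NC: "gE x \<in> N" "x \<in> C" if "x \<in> NC" for x using that NE by (auto simp: NC_def)
  have AC: "gE x \<in> A" "x \<in> C" if "x \<in> AC" for x using that AE by (auto simp: AC_def)
  have aE: "a \<in> topspace E" if "a \<in> A" for a using that AE by blast
  have dx0: "dist x0 (eE y) = dE e0 y" if "y \<in> topspace E" for y using isoE[OF e0 that] by (simp add: x0_def)
  have "\<exists>r' \<alpha>' h. proper_deformation C NC x0 r' \<alpha>' h"
  proof (rule deformation[OF col x0, where \<pi> = "eE \<circ> \<pi>' \<circ> gE" and A = AC and \<alpha> = "eE \<circ> \<alpha>"
        and j = "j \<circ> gE" and q = "q \<circ> gE" and H = "\<lambda>a t. eE (H (gE a, t))"])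
    show "NC \<subseteq> C" "AC \<subseteq> C" using NC AC by blast+
    show "(eE \<circ> \<pi>' \<circ> gE) x \<in> AC" "dist x ((eE \<circ> \<pi>' \<circ> gE) x) \<le> 2" if "x \<in> NC" for x
      using \<pi>'[OF NC(1)[OF that]] NC[OF that] aE by (auto simp: AC_def dist_C)
    show "(eE \<circ> \<alpha>) t \<in> C" if "0 \<le> t" for t using \<alpha>E[OF that] by simp
    show "0 \<le> (j \<circ> gE) a" "0 \<le> (q \<circ> gE) a" if "a \<in> AC" for a using j0 q0 AC[OF that] by auto
    show "eE (H (gE a, t)) \<in> C" if "a \<in> AC" "0 \<le> t" "t \<le> (q \<circ> gE) a" for a t
      using HE[OF AC(1)] that by simp
    show "eE (H (gE a, 0)) = (eE \<circ> \<alpha>) ((j \<circ> gE) a)" "eE (H (gE a, (q \<circ> gE) a)) = a" if "a \<in> AC" for a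
      using H01[OF AC(1)[OF that]] AC(2)[OF that] by auto
  next
    fix r
    show "\<exists>S. \<forall>s\<ge>0. \<forall>t\<ge>0. \<bar>s - t\<bar> \<le> r \<longrightarrow> dist ((eE \<circ> \<alpha>) s) ((eE \<circ> \<alpha>) t) \<le> S"
    proof -
      have c: "controlled Rplus rdist (topspace E) dE \<alpha>" using \<alpha> by (simp add: coarse_def)
      obtain S where S: "\<And>s t. s \<in> Rplus \<Longrightarrow> t \<in> Rplus \<Longrightarrow> rdist s t \<le> r \<Longrightarrow> dE (\<alpha> s) (\<alpha> t) \<le> S"
        using controlledD[OF c, of r] by blast
      then show ?thesis using \<alpha>E by (intro exI[of _ S]) (auto simp: Rplus_def rdist_def isoE)
    qed
    show "\<exists>S. \<forall>a\<in>AC. \<forall>a'\<in>AC. dist a a' \<le> r \<longrightarrow> \<bar>(j \<circ> gE) a - (j \<circ> gE) a'\<bar> \<le> S"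
    proof -
      have c: "controlled A dE Rplus rdist j" using j by (simp add: coarse_def)
      obtain S where S: "\<And>s t. s \<in> A \<Longrightarrow> t \<in> A \<Longrightarrow> dE s t \<le> r \<Longrightarrow> rdist (j s) (j t) \<le> S"
        using controlledD[OF c, of r] by blast
      then show ?thesis using AC by (intro exI[of _ S]) (auto simp: rdist_def dist_C)
    qed
    show "\<exists>S. \<forall>a\<in>AC. \<forall>a'\<in>AC. dist a a' \<le> r \<longrightarrow> \<bar>(q \<circ> gE) a - (q \<circ> gE) a'\<bar> \<le> S"
    proof -
      have c: "controlled A dE Rplus rdist q" using q by (simp add: coarse_def)
      obtain S where S: "\<And>s t. s \<in> A \<Longrightarrow> t \<in> A \<Longrightarrow> dE s t \<le> r \<Longrightarrow> rdist (q s) (q t) \<le> S"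
        using controlledD[OF c, of r] by blast
      then show ?thesis using AC by (intro exI[of _ S]) (auto simp: rdist_def dist_C)
    qed
    show "\<exists>b. \<forall>t\<ge>0. dist x0 ((eE \<circ> \<alpha>) t) \<le> r \<longrightarrow> t \<le> b"
    proof -
      have "mproper Rplus rdist (topspace E) dE \<alpha>" using \<alpha> by (simp add: coarse_def)
      then have "mbdd Rplus rdist {t \<in> Rplus. \<alpha> t \<in> {y \<in> topspace E. dE e0 y \<le> r}}"
        using mbdd_ball unfolding mproper_def by blast
      then obtain s b where b: "\<And>t. t \<in> Rplus \<Longrightarrow> \<alpha> t \<in> {y \<in> topspace E. dE e0 y \<le> r} \<Longrightarrow> rdist s t \<le> b"
        unfolding mbdd_def by blast
      \<comment> \<open>The centre s may lie outside \<open>Rplus\<close>, but \<open>rdist\<close>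
        is a metric on all reals, so the bound is still usable.\<close>
      have "t \<le> s + b" if "0 \<le> t" "dist x0 ((eE \<circ> \<alpha>) t) \<le> r" for t
        using b[of t] that \<alpha>E[OF that(1)] by (auto simp: Rplus_def rdist_def dx0 abs_le_iff)
      then show ?thesis by blast
    qed
    show "\<exists>R. \<forall>a\<in>AC. \<forall>t. 0 \<le> t \<longrightarrow> t \<le> (q \<circ> gE) a \<longrightarrow> dist x0 (eE (H (gE a, t))) \<le> r \<longrightarrow> dist x0 a \<le> R"
    proof -
      have Hq: "H (a, q a) = a" if "a \<in> A" for a using H01[OF that] by simp
      obtain R where R: "\<And>a t. a \<in> A \<Longrightarrow> 0 \<le> t \<Longrightarrow> t \<le> q a \<Longrightarrow> dE e0 (H (a, t)) \<le> r \<Longrightarrow> dE e0 a \<le> R"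
        using coarse_homotopy_proper[OF AE H q0 Hq e0, of r] by blast
      have "dist x0 a \<le> R" if "a \<in> AC" "0 \<le> t" "t \<le> (q \<circ> gE) a" "dist x0 (eE (H (gE a, t))) \<le> r" for a t
        using R[OF AC(1)[OF that(1)] that(2)] that(3,4) HE[OF AC(1)[OF that(1)] that(2)]
          AC[OF that(1)] dx0[OF aE[OF AC(1)[OF that(1)]]] dx0 by simp
      then show ?thesis by blast
    qed
    show "\<exists>S. \<forall>a\<in>AC. \<forall>a'\<in>AC. \<forall>t t'. 0 \<le> t \<longrightarrow> t \<le> (q \<circ> gE) a \<longrightarrow> 0 \<le> t' \<longrightarrow> t' \<le> (q \<circ> gE) a' \<longrightarrow>
         dist a a' \<le> r \<longrightarrow> \<bar>t - t'\<bar> \<le> r \<longrightarrow> dist (eE (H (gE a, t))) (eE (H (gE a', t'))) \<le> S"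
    proof -
      have c: "controlled (Iq A q) (supdist dE) (topspace E) dE H" using H by (simp add: coarse_def)
      obtain S where S: "\<And>z z'. z \<in> Iq A q \<Longrightarrow> z' \<in> Iq A q \<Longrightarrow> supdist dE z z' \<le> r \<Longrightarrow> dE (H z) (H z') \<le> S"
        using controlledD[OF c, of r] by blast
      have "dist (eE (H (gE a, t))) (eE (H (gE a', t'))) \<le> S"
        if "a \<in> AC" "a' \<in> AC" "0 \<le> t" "t \<le> (q \<circ> gE) a" "0 \<le> t'" "t' \<le> (q \<circ> gE) a'" "dist a a' \<le> r" "\<bar>t - t'\<bar> \<le> r"
        for a a' t t'
      proof -
        have "dE (H (gE a, t)) (H (gE a', t')) \<le> S"
          using that AC by (intro S) (auto simp: Iq_def supdist_def dist_C)
        moreover have "H (gE a, t) \<in> topspace E" "H (gE a', t') \<in> topspace E"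
          using HE AC(1) that by auto
        ultimately show ?thesis by (simp add: isoE)
      qed
      then show ?thesis by blast
    qed
  qed
  then obtain r' \<alpha>' h where pd: "proper_deformation C NC x0 r' \<alpha>' h" by blast
  note r' = proper_deformationD(1-3)[OF pd] and \<alpha>' = proper_deformationD(4-6)[OF pd]
    and h = proper_deformationD(7-)[OF pd]
  have topN: "topspace (subtopology E N) = N" using NE by auto
  have eN: "continuous_map (subtopology E N) (top_of_set NC) eE"
    using cont_eE NE by (auto simp: continuous_map_in_subtopology NC_def intro: continuous_map_from_subtopology)
  have NC_I: "eE x \<in> NC" if "x \<in> N" for x using that by (simp add: NC_def)
  \<comment> \<open>Through this the properness of \<open>r' \<circ> eE\<close> and of
    \<open>HH\<close> reduces to distance bounds.\<close>
  have compN: "\<exists>L. compactin (subtopology E N) L \<and> {x \<in> N. dE e0 x \<le> R} \<subseteq> L" for R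
  proof -
    obtain K where K: "compactin E K" "ME.mcball e0 R \<subseteq> K" by (rule proper_E[OF e0])
    have "compactin E (K \<inter> N)" using K(1) N_closed by (rule compact_Int_closedin)
    then show ?thesis using K(2) NE e0
      by (intro exI[of _ "K \<inter> N"]) (auto simp: compactin_subtopology dd_def subset_iff)
  qed
  have r_proper: "tproper (subtopology E N) Rplus_top (r' \<circ> eE)"
  proof (rule tproperI[OF _ Hausdorff_Rplus])
    show "continuous_map (subtopology E N) Rplus_top (r' \<circ> eE)"
      unfolding Rplus_top_def
      by (rule continuous_map_compose[OF eN]) (use r'(1,2) in \<open>auto simp: continuous_map_in_subtopology\<close>)
    fix K assume "compactin Rplus_top K"
    then obtain b where b: "\<And>t. t \<in> K \<Longrightarrow> t \<le> b" by (rule compactin_Rplus_bounded) blast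
    obtain R where R: "\<And>x. x \<in> NC \<Longrightarrow> r' x \<le> b \<Longrightarrow> dist x0 x \<le> R" using r'(3)[of b] by blast
    have "{x \<in> topspace (subtopology E N). (r' \<circ> eE) x \<in> K} \<subseteq> {x \<in> N. dE e0 x \<le> R}"
      using R[OF NC_I] b NE by (auto simp: dx0 subset_iff simp flip: dx0)
    then show "\<exists>L. compactin (subtopology E N) L \<and> {x \<in> topspace (subtopology E N). (r' \<circ> eE) x \<in> K} \<subseteq> L"
      using compN[of R] by blast
  qed
  have \<alpha>_proper: "tproper Rplus_top E (gE \<circ> \<alpha>')"
  proof (rule tproperI[OF _ Hausdorff_E])
    show "continuous_map Rplus_top E (gE \<circ> \<alpha>')"
      unfolding Rplus_top_def
      by (rule continuous_map_compose[OF _ cont_gE]) (use \<alpha>'(1,2) in \<open>auto simp: continuous_map_in_subtopology\<close>)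
    fix K assume "compactin E K"
    then obtain \<rho> where \<rho>: "\<And>y. y \<in> K \<Longrightarrow> dE e0 y \<le> \<rho>" using compactin_E_bounded e0 by metis
    obtain b where b: "\<And>t. 0 \<le> t \<Longrightarrow> dist x0 (\<alpha>' t) \<le> \<rho> \<Longrightarrow> t \<le> b" using \<alpha>'(3)[of \<rho>] by blast
    have "t \<in> {0..b}" if "0 \<le> t" "gE (\<alpha>' t) \<in> K" for t
    proof -
      have "dist x0 (\<alpha>' t) = dE e0 (gE (\<alpha>' t))" using dx0[OF E_rules(2)[OF \<alpha>'(2)[OF that(1)]]] \<alpha>'(2)[OF that(1)] by simp
      then show ?thesis using b[OF that(1)] \<rho>[OF that(2)] that(1) by simp
    qed
    then show "\<exists>L. compactin Rplus_top L \<and> {t \<in> topspace Rplus_top. (gE \<circ> \<alpha>') t \<in> K} \<subseteq> L"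
      by (intro exI[of _ "{0..b}"]) (auto simp: Rplus_top_def compactin_subtopology)
  qed
  \<comment> \<open>The factors are swapped, since \<open>properly_deformable\<close> has time as
    second coordinate.\<close>
  define HH where "HH z = gE (h (snd z, eE (fst z)))" for z
  have H_proper: "tproper (prod_topology (subtopology E N) (top_of_set {0..(1::real)})) E HH"
  proof (rule tproperI[OF _ Hausdorff_E])
    let ?X = "prod_topology (subtopology E N) (top_of_set {0..(1::real)})"
    have c1: "continuous_map ?X (top_of_set NC) (\<lambda>z. eE (fst z))"
      using continuous_map_compose[OF continuous_map_fst eN] by (simp add: o_def)
    have c2: "continuous_map ?X (top_of_set ({0..1} \<times> NC)) (\<lambda>z. (snd z, eE (fst z)))"
      using continuous_map_pairedI[OF continuous_map_snd c1] by (simp add: prod_topology_subtopology subtopology_subtopology Times_Int_Times)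
    have c3: "continuous_map (top_of_set ({0..1} \<times> NC)) (top_of_set C) h"
      using h(1,2) by (auto simp: continuous_map_in_subtopology)
    show "continuous_map ?X E HH"
      using continuous_map_compose[OF continuous_map_compose[OF c2 c3] cont_gE] by (simp add: HH_def[abs_def] o_def)
    fix K assume "compactin E K"
    then obtain \<rho> where \<rho>: "\<And>y. y \<in> K \<Longrightarrow> dE e0 y \<le> \<rho>" using compactin_E_bounded e0 by metis
    obtain R where R: "\<And>t x. t \<in> {0..1} \<Longrightarrow> x \<in> NC \<Longrightarrow> dist x0 (h (t, x)) \<le> \<rho> \<Longrightarrow> dist x0 x \<le> R" using h(5)[of \<rho>] by blast
    obtain L where L: "compactin (subtopology E N) L" "{x \<in> N. dE e0 x \<le> R} \<subseteq> L" using compN[of R] by blast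
    have "x \<in> L" if x: "x \<in> N" and t: "t \<in> {0..1}" and K: "HH (x, t) \<in> K" for x t
    proof -
      have hC: "h (t, eE x) \<in> C" by (rule h(2)[OF t NC_I[OF x]])
      have "dist x0 (h (t, eE x)) = dE e0 (gE (h (t, eE x)))" using dx0[OF E_rules(2)[OF hC]] hC by simp
      then have "dist x0 (eE x) \<le> R" using \<rho>[OF K] by (intro R[OF t NC_I[OF x]]) (simp add: HH_def)
      then have "dE e0 x \<le> R" using dx0[of x] x NE by auto
      then show ?thesis using L(2) x by blast
    qed
    moreover have "compactin ?X (L \<times> {0..1})" using L(1) by (simp add: compactin_Times compactin_subtopology)
    ultimately show "\<exists>L. compactin ?X L \<and> {z \<in> topspace ?X. HH z \<in> K} \<subseteq> L"
      by (intro exI[of _ "L \<times> {0..1}"]) auto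
  qed
  have "properly_deformable E N"
    unfolding properly_deformable_def
  proof (intro conjI exI[of _ "r' \<circ> eE"] exI[of _ "gE \<circ> \<alpha>'"] exI[of _ HH] ballI)
    show "closedin E N" by fact
    show "HH (x, 0) = (gE \<circ> \<alpha>') ((r' \<circ> eE) x)" "HH (x, 1) = x" if "x \<in> N" for x
      using h(3,4)[OF NC_I[OF that]] that NE by (auto simp: HH_def)
  qed (fact r_proper \<alpha>_proper H_proper)+
  moreover have "nbhd A \<subseteq> E interior_of N"
    unfolding N_def by (intro interior_of_maximal openin_nbhd closure_of_subset openin_subset)
  ultimately show ?thesis unfolding properly_categorical_def using N_closed by blast
qed

end

section \<open>Comparison of the two categories\<close>

theorem theorem3p4:
  fixes B :: "'b topology" and dB :: "'b \<Rightarrow> 'b \<Rightarrow> real"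
    and E :: "'a topology" and p :: "'a \<Rightarrow> 'b" and dE :: "'a \<Rightarrow> 'a \<Rightarrow> real"
  assumes "finite_CW B" and "path_connected_space B" and "aspherical B"
    and "geodesic_metric (topspace B) dB"
    and "Metric_space.mtopology (topspace B) dB = B"
    and "covering_map E B p" and "simply_connected_sp E"
    and "lifted_metric E p dB dE"
  shows "p_cat E \<le> c_cat (topspace E) dE"
proof -
  interpret lifted_geodesic B dB E p dE
    using assms finite_CW_compact by unfold_locales (auto simp: simply_connected_sp_def)
  have main: "properly_categorical E (nbhd A)" if A: "coarsely_categorical (topspace E) dE A" for A
  proof -
    \<comment> \<open>A base point for the embeddings; again the map from the half-line provides it,
      whatever \<open>A\<close> is.\<close>
    obtain x where x: "x \<in> topspace E"
      using A by (auto simp: coarsely_categorical_def coarse_def controlled_def Rplus_def)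
    interpret embedded B dB E p dE "ME.kuratowski x" "MB.kuratowski (p x)"
      using ME.dist_kuratowski[OF x] MB.dist_kuratowski[OF p_in[OF x]]
      by unfold_locales (auto simp: dd_def)
    show ?thesis by (rule coarsely_categorical_imp_properly_categorical[OF assms(1,3,7) A])
  qed
  \<comment> \<open>Thickening replaces an arbitrary cover by coarsely categorical sets with an open
    one that has the same number of members.\<close>
  have "\<exists>V. (\<forall>i\<le>k. openin E (V i) \<and> properly_categorical E (V i)) \<and> topspace E = (\<Union>i\<le>k. V i)"
    if U: "\<forall>i\<le>k. coarsely_categorical (topspace E) dE (U i)" "topspace E = (\<Union>i\<le>k. U i)" for k :: nat and U
  proof (intro exI[of _ "\<lambda>i. nbhd (U i)"] conjI)
    show "\<forall>i\<le>k. openin E (nbhd (U i)) \<and> properly_categorical E (nbhd (U i))"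
      using U(1) main openin_nbhd by blast
    have "U i \<subseteq> nbhd (U i)" if "i \<le> k" for i
      using U(1) that by (intro subset_nbhd) (auto simp: coarsely_categorical_def)
    then have "topspace E \<subseteq> (\<Union>i\<le>k. nbhd (U i))" unfolding U(2) by (intro UN_mono) auto
    moreover have "(\<Union>i\<le>k. nbhd (U i)) \<subseteq> topspace E" by (intro UN_least openin_subset openin_nbhd)
    ultimately show "topspace E = (\<Union>i\<le>k. nbhd (U i))" by (rule equalityI)
  qed
  note cover = this
  show ?thesis
    unfolding p_cat_def c_cat_def
  \<comment> \<open>Every k admissible for \<open>c_cat\<close> is admissible for
    \<open>p_cat\<close>; if there is none, the right-hand side is \<infinity>.\<close>
  proof (intro Inf_superset_mono subsetI)
    fix e assume "e \<in> {enat k | k. \<exists>U. (\<forall>i\<le>k. coarsely_categorical (topspace E) dE (U i)) \<and>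
      topspace E = (\<Union>i\<le>k. U i)}"
    then obtain k U where "e = enat k" "\<forall>i\<le>k. coarsely_categorical (topspace E) dE (U i)"
      "topspace E = (\<Union>i\<le>k. U i)" by auto
    with cover[of k U] show "e \<in> {enat n | n. \<exists>V. (\<forall>i\<le>n. openin E (V i) \<and> properly_categorical E (V i)) \<and>
      topspace E = (\<Union>i\<le>n. V i)}" by simp
  qed
qed

end
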